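(* Let $m,n\in\mathbb N$ and $f\in\mathbb Z^{m+n}_+$. Then in $\mathcal E^{m+n}$ $$\mathcal U_f=\sum_{\Sigma\subseteq\Sigma^+_f}q^{|\Sigma|}\mathcal K_{f_\Sigma},$$ the sum being over all subsets $\Sigma$ of $\Sigma^+_f$.
   Context: Quantum group: $\mathcal U$ is the $\mathbb Q(q)$-algebra $U_q(\mathfrak{sl}(\infty))$ generated by $E_a,F_a,K_{a,a+1}^{\pm1}$ ($a\in\mathbb Z$), a subalgebra of the standard $U_q(\mathfrak{gl}(\infty))$; comultiplication $\Delta(E_a)=1\otimes E_a+E_a\otimes K_{a+1,a}$, $\Delta(F_a)=F_a\otimes1+K_{a,a+1}\otimes F_a$, $\Delta(K_{a,a+1})=K_{a,a+1}\otimes K_{a,a+1}$, where $K_{a+1,a}=K_{a,a+1}^{-1}$; bar map on $\mathcal U$: ring automorphism with $\bar q=q^{-1}$ fixing $E_a,F_a$ and inverting $K_{a,a+1}$. For $k\in\mathbb N$, $\Lambda^k\mathbb V$ is the $\mathcal U$-module with basis $v_{a_1}\wedge\cdots\wedge v_{a_k}$ ($a_1>\cdots>a_k$ integers), where for index set $S$: $F_a$ replaces $a$ by $a+1$ if $a\in S,a+1\notin S$ (else $0$), $E_a$ replaces $a+1$ by $a$ if $a+1\in S,a\notin S$ (else $0$), $K_{a,a+1}$ acts by $q^{[a\in S]-[a+1\in S]}$. Fock space: $I(m|n)=\{-m,\dots,-1\}\cup\{1,\dots,n\}$, $\mathbb Z^{m+n}$ the functions $I(m|n)\to\mathbb Z$,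 $\mathbb Z^{m+n}_+=\{f:f(-m)>\cdots>f(-1),\ f(1)>\cdots>f(n)\}$. $\mathcal E^{m+n}=\Lambda^m\mathbb V\otimes\Lambda^n\mathbb V$ (a $\mathcal U$-module via $\Delta$) with monomial basis $\mathcal K_f=v_{f(-m)}\wedge\cdots\wedge v_{f(-1)}\otimes v_{f(1)}\wedge\cdots\wedge v_{f(n)}$, $f\in\mathbb Z^{m+n}_+$. Bruhat ordering on $\mathbb Z^{m+n}$: transitive closure of $f<f\cdot\tau_{ij}$ for $i<j$ in $I(m|n)$ with $f(i)<f(j)$ ($\tau_{ij}$ transposition, $(f\cdot\tau)(k)=f(\tau(k))$); $f\in\mathbb Z^{m+n}_+$ is J-typical if minimal in $\mathbb Z^{m+n}_+$. The bar involution is the unique anti-linear map $u\mapsto\bar u$ on $\mathcal E^{m+n}$ with $\overline{\mathcal K_f}=\mathcal K_f$ for J-typical $f$, $\overline{Xu}=\bar X\bar u$ for $X\in\mathcal U$, which is an involution and satisfies $\overline{\mathcal K_f}\in\mathcal K_f+\sum_{g<f}\mathbb Z[q,q^{-1}]\mathcal K_g$. The canonical basis element $\mathcal U_f$ is the unique bar-invariant element in $\mathcal K_f+\sum_{g<f}q\mathbb Z[q]\mathcal K_g$. Positive pairs: for $f\in\mathbb Z^{m+n}$ injective on $\{-m,\dots,-1\}$ and on $\{1,\dots,n\}$, a pair $(i|j)$, $-m\le i\le-1$, $1\le j\le n$, is atypical if $f(i)>f(j)$, $f(i)\ne f(k)$ for all $1\le k\le n$, and $f(l)\ne f(j)$ for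 all $-m\le l\le-1$; its distance is $f(i)-f(j)$. Pairs are disjoint if they share neither entry. Recursively, $\Sigma^k_f$ ($k\ge1$) is the set of atypical pairs of distance $k$ disjoint from every pair in $\Sigma^1_f\cup\cdots\cup\Sigma^{k-1}_f$, and $\Sigma^+_f=\bigcup_{k\ge1}\Sigma^k_f$. For $\Sigma=\{(i_1|j_1),\dots,(i_k|j_k)\}\subseteq\Sigma^+_f$, $f_\Sigma\in\mathbb Z^{m+n}_+$ is obtained by exchanging the values $f(i_s)$ and $f(j_s)$ for all $s$ and then rearranging the values at negative positions in decreasing order and the values at positive positions in decreasing order. *)

theory Defs
  imports "HOL-Computational_Algebra.Polynomial" "HOL-Computational_Algebra.Fraction_Field"
begin

type_synonym qf = "rat poly fract"

definition qq :: qf where "qq = Fract [:0, 1:] 1"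

definition qpow :: "int \<Rightarrow> qf" where
  "qpow k = (if 0 \<le> k then qq ^ nat k else inverse qq ^ nat (- k))"

definition qbar :: "qf \<Rightarrow> qf" where
  "qbar = (THE \<sigma>. (\<forall>x y. \<sigma> (x + y) = \<sigma> x + \<sigma> y) \<and> (\<forall>x y. \<sigma> (x * y) = \<sigma> x * \<sigma> y)
               \<and> (\<forall>c. \<sigma> (Fract [:c:] 1) = Fract [:c:] 1) \<and> \<sigma> qq = inverse qq)"

definition laurent_int :: "qf \<Rightarrow> bool" where
  "laurent_int x \<longleftrightarrow> (\<exists>(p::int poly) (k::nat). x = Fract (map_poly of_int p) (monom 1 k))"

definition qZq :: "qf \<Rightarrow> bool" where
  "qZq x \<longleftrightarrow> (\<exists>(p::int poly). coeff p 0 = 0 \<and> x = Fract (map_poly of_int p) 1)"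

definition negI :: "nat \<Rightarrow> int set" where "negI m = {- int m .. -1}"
definition posI :: "nat \<Rightarrow> int set" where "posI n = {1 .. int n}"
definition Imn :: "nat \<Rightarrow> nat \<Rightarrow> int set" where "Imn m n = negI m \<union> posI n"

definition Zmn :: "nat \<Rightarrow> nat \<Rightarrow> (int \<Rightarrow> int) set" where
  "Zmn m n = {f. \<forall>x. x \<notin> Imn m n \<longrightarrow> f x = 0}"

definition Zp :: "nat \<Rightarrow> nat \<Rightarrow> (int \<Rightarrow> int) set" where
  "Zp m n = {f \<in> Zmn m n. (\<forall>i\<in>negI m. \<forall>j\<in>negI m. i < j \<longrightarrow> f i > f j)
                         \<and> (\<forall>i\<in>posI n. \<forall>j\<in>posI n. i < j \<longrightarrow> f i > f j)}"

definition swapv :: "(int \<Rightarrow> int) \<Rightarrow> int \<Rightarrow> int \<Rightarrow> (int \<Rightarrow> int)" where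
  "swapv f i j = (\<lambda>k. if k = i then f j else if k = j then f i else f k)"

definition bruhat_step :: "nat \<Rightarrow> nat \<Rightarrow> (int \<Rightarrow> int) \<Rightarrow> (int \<Rightarrow> int) \<Rightarrow> bool" where
  "bruhat_step m n f g \<longleftrightarrow> f \<in> Zmn m n \<and>
     (\<exists>i j. i \<in> Imn m n \<and> j \<in> Imn m n \<and> i < j \<and> f i < f j \<and> g = swapv f i j)"

definition bruhat_less :: "nat \<Rightarrow> nat \<Rightarrow> (int \<Rightarrow> int) \<Rightarrow> (int \<Rightarrow> int) \<Rightarrow> bool" where
  "bruhat_less m n = (bruhat_step m n)\<^sup>+\<^sup>+"

definition Jtypical :: "nat \<Rightarrow> nat \<Rightarrow> (int \<Rightarrow> int) \<Rightarrow> bool" where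
  "Jtypical m n f \<longleftrightarrow> f \<in> Zp m n \<and> \<not> (\<exists>g\<in>Zp m n. bruhat_less m n g f)"

section \<open>The Fock space E^{m+n} = Lambda^m V (x) Lambda^n V\<close>

text \<open>A vector is its coefficient function w.r.t. the monomial basis K_f, f in Z^{m+n}_+\<close>
type_synonym vec = "(int \<Rightarrow> int) \<Rightarrow> qf"

definition Evec :: "nat \<Rightarrow> nat \<Rightarrow> vec set" where
  "Evec m n = {u. finite {g. u g \<noteq> 0} \<and> (\<forall>g. u g \<noteq> 0 \<longrightarrow> g \<in> Zp m n)}"

definition Kb :: "(int \<Rightarrow> int) \<Rightarrow> vec" where
  "Kb f = (\<lambda>g. if g = f then 1 else 0)"

definition vadd :: "vec \<Rightarrow> vec \<Rightarrow> vec" where "vadd u v = (\<lambda>g. u g + v g)"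
definition vsmult :: "qf \<Rightarrow> vec \<Rightarrow> vec" where "vsmult c u = (\<lambda>g. c * u g)"

definition lin :: "((int \<Rightarrow> int) \<Rightarrow> vec) \<Rightarrow> vec \<Rightarrow> vec" where
  "lin T u = (\<lambda>h. \<Sum>g\<in>{g. u g \<noteq> 0}. u g * T g h)"

text \<open>K_{a,a+1} acts on a wedge with index set S by q^(eexp S a)\<close>
definition eexp :: "int set \<Rightarrow> int \<Rightarrow> int" where
  "eexp S a = (if a \<in> S then 1 else 0) - (if a + 1 \<in> S then 1 else 0)"

definition repl :: "(int \<Rightarrow> int) \<Rightarrow> int set \<Rightarrow> int \<Rightarrow> int \<Rightarrow> (int \<Rightarrow> int)" where
  "repl f P a b = (\<lambda>i. if i \<in> P \<and> f i = a then b else f i)"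

text \<open>Delta(F_a) = F_a (x) 1 + K_{a,a+1} (x) F_a\<close>
definition Fb :: "nat \<Rightarrow> nat \<Rightarrow> int \<Rightarrow> (int \<Rightarrow> int) \<Rightarrow> vec" where
  "Fb m n a f = (let S1 = f ` negI m; S2 = f ` posI n in
     (\<lambda>h. (if a \<in> S1 \<and> a + 1 \<notin> S1 \<and> h = repl f (negI m) a (a + 1) then 1 else 0)
        + (if a \<in> S2 \<and> a + 1 \<notin> S2 \<and> h = repl f (posI n) a (a + 1) then qpow (eexp S1 a) else 0)))"

text \<open>Delta(E_a) = 1 (x) E_a + E_a (x) K_{a+1,a}\<close>
definition Eb :: "nat \<Rightarrow> nat \<Rightarrow> int \<Rightarrow> (int \<Rightarrow> int) \<Rightarrow> vec" where
  "Eb m n a f = (let S1 = f ` negI m; S2 = f ` posI n in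
     (\<lambda>h. (if a + 1 \<in> S2 \<and> a \<notin> S2 \<and> h = repl f (posI n) (a + 1) a then 1 else 0)
        + (if a + 1 \<in> S1 \<and> a \<notin> S1 \<and> h = repl f (negI m) (a + 1) a then qpow (- eexp S2 a) else 0)))"

text \<open>Delta(K_{a,a+1}) = K_{a,a+1} (x) K_{a,a+1}; Kinvb is K_{a+1,a}\<close>
definition Kgb :: "nat \<Rightarrow> nat \<Rightarrow> int \<Rightarrow> (int \<Rightarrow> int) \<Rightarrow> vec" where
  "Kgb m n a f = vsmult (qpow (eexp (f ` negI m) a + eexp (f ` posI n) a)) (Kb f)"

definition Kinvb :: "nat \<Rightarrow> nat \<Rightarrow> int \<Rightarrow> (int \<Rightarrow> int) \<Rightarrow> vec" where
  "Kinvb m n a f = vsmult (qpow (- (eexp (f ` negI m) a + eexp (f ` posI n) a))) (Kb f)"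

definition actE :: "nat \<Rightarrow> nat \<Rightarrow> int \<Rightarrow> vec \<Rightarrow> vec" where "actE m n a = lin (Eb m n a)"
definition actF :: "nat \<Rightarrow> nat \<Rightarrow> int \<Rightarrow> vec \<Rightarrow> vec" where "actF m n a = lin (Fb m n a)"
definition actK :: "nat \<Rightarrow> nat \<Rightarrow> int \<Rightarrow> vec \<Rightarrow> vec" where "actK m n a = lin (Kgb m n a)"
definition actKinv :: "nat \<Rightarrow> nat \<Rightarrow> int \<Rightarrow> vec \<Rightarrow> vec" where "actKinv m n a = lin (Kinvb m n a)"

text \<open>Compatibility with X in U is expressed on the generators E_a, F_a, K_{a,a+1}^{+-1}
  (bar fixes E_a, F_a and inverts K_{a,a+1}); by anti-linearity this is equivalent.
  Outside E^{m+n} the map is fixed to 0 (extensional convention).\<close>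
definition is_bar :: "nat \<Rightarrow> nat \<Rightarrow> (vec \<Rightarrow> vec) \<Rightarrow> bool" where
  "is_bar m n B \<longleftrightarrow>
     (\<forall>u. u \<notin> Evec m n \<longrightarrow> B u = (\<lambda>_. 0)) \<and>
     (\<forall>u\<in>Evec m n. B u \<in> Evec m n) \<and>
     (\<forall>u\<in>Evec m n. \<forall>v\<in>Evec m n. B (vadd u v) = vadd (B u) (B v)) \<and>
     (\<forall>c. \<forall>u\<in>Evec m n. B (vsmult c u) = vsmult (qbar c) (B u)) \<and>
     (\<forall>f. Jtypical m n f \<longrightarrow> B (Kb f) = Kb f) \<and>
     (\<forall>a. \<forall>u\<in>Evec m n. B (actE m n a u) = actE m n a (B u)) \<and>
     (\<forall>a. \<forall>u\<in>Evec m n. B (actF m n a u) = actF m n a (B u)) \<and>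
     (\<forall>a. \<forall>u\<in>Evec m n. B (actK m n a u) = actKinv m n a (B u)) \<and>
     (\<forall>a. \<forall>u\<in>Evec m n. B (actKinv m n a u) = actK m n a (B u)) \<and>
     (\<forall>u\<in>Evec m n. B (B u) = u) \<and>
     (\<forall>f\<in>Zp m n. B (Kb f) f = 1 \<and>
        (\<forall>g. g \<noteq> f \<longrightarrow> B (Kb f) g \<noteq> 0 \<longrightarrow> bruhat_less m n g f \<and> laurent_int (B (Kb f) g)))"

definition bar_inv :: "nat \<Rightarrow> nat \<Rightarrow> vec \<Rightarrow> vec" where
  "bar_inv m n = (THE B. is_bar m n B)"

definition Ucan :: "nat \<Rightarrow> nat \<Rightarrow> (int \<Rightarrow> int) \<Rightarrow> vec" where
  "Ucan m n f = (THE u. u \<in> Evec m n \<and> bar_inv m n u = u \<and> u f = 1 \<and>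
      (\<forall>g. g \<noteq> f \<longrightarrow> u g \<noteq> 0 \<longrightarrow> bruhat_less m n g f \<and> qZq (u g)))"

definition atypical :: "nat \<Rightarrow> nat \<Rightarrow> (int \<Rightarrow> int) \<Rightarrow> int \<times> int \<Rightarrow> bool" where
  "atypical m n f p \<longleftrightarrow> (case p of (i, j) \<Rightarrow> i \<in> negI m \<and> j \<in> posI n \<and> f i > f j \<and>
      (\<forall>k\<in>posI n. f i \<noteq> f k) \<and> (\<forall>l\<in>negI m. f l \<noteq> f j))"

definition pdist :: "(int \<Rightarrow> int) \<Rightarrow> int \<times> int \<Rightarrow> int" where
  "pdist f p = f (fst p) - f (snd p)"

definition disjoint_pairs :: "int \<times> int \<Rightarrow> int \<times> int \<Rightarrow> bool" where
  "disjoint_pairs p p' \<longleftrightarrow> fst p \<noteq> fst p' \<and> snd p \<noteq> snd p'"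

primrec SigUpTo :: "nat \<Rightarrow> nat \<Rightarrow> (int \<Rightarrow> int) \<Rightarrow> nat \<Rightarrow> (int \<times> int) set" where
  "SigUpTo m n f 0 = {}"
| "SigUpTo m n f (Suc k) = SigUpTo m n f k \<union>
     {p. atypical m n f p \<and> pdist f p = int (Suc k) \<and> (\<forall>p'\<in>SigUpTo m n f k. disjoint_pairs p p')}"

definition SigPlus :: "nat \<Rightarrow> nat \<Rightarrow> (int \<Rightarrow> int) \<Rightarrow> (int \<times> int) set" where
  "SigPlus m n f = (\<Union>k. SigUpTo m n f k)"

definition exch :: "(int \<Rightarrow> int) \<Rightarrow> (int \<times> int) set \<Rightarrow> (int \<Rightarrow> int)" where
  "exch f \<Sigma> = (\<lambda>k. if (\<exists>j. (k, j) \<in> \<Sigma>) then f (THE j. (k, j) \<in> \<Sigma>)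
                   else if (\<exists>i. (i, k) \<in> \<Sigma>) then f (THE i. (i, k) \<in> \<Sigma>) else f k)"

definition fSig :: "nat \<Rightarrow> nat \<Rightarrow> (int \<Rightarrow> int) \<Rightarrow> (int \<times> int) set \<Rightarrow> (int \<Rightarrow> int)" where
  "fSig m n f \<Sigma> = (THE h. h \<in> Zp m n \<and> h ` negI m = exch f \<Sigma> ` negI m \<and> h ` posI n = exch f \<Sigma> ` posI n)"

end

theory Submission
  imports Defs
begin

text \<open>Encode a labelling by the bracket word whose opening (closing) brackets are the integers occurring
  only among its positive (negative) values. Then \<open>\<Sigma>\<^sup>+\<close> is the set of matching bracket pairs, exchanging
  a positive pair flips a matching pair, and the claimed canonical basis element is \<open>W f\<close>, the product
  over all pairs of \<open>(opening, closing) + q (closing, opening)\<close>. A local computation at \<open>a, a + 1\<close> shows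
  that \<open>E\<^sub>a\<close> and \<open>F\<^sub>a\<close> send each \<open>W f\<close> to \<open>0\<close>, to some \<open>W g\<close> or to \<open>(q + q\<^sup>-\<^sup>1) W g\<close>. As the \<open>W f\<close> are
  unitriangular with respect to the monomial basis, the antilinear map fixing all of them is therefore a bar
  involution. It is the only one: shrinking innermost pairs writes every \<open>W f\<close> as \<open>E\<^sub>a W g\<close> or
  \<open>F\<^sub>a W g\<close>, starting from the J-typical \<open>W g = K\<^sub>g\<close>. Hence \<open>W f\<close> is bar invariant, with off-diagonal
  coefficients in \<open>q\<int>[q]\<close>.\<close>

section \<open>The bar automorphism of the field of rational functions\<close>

text \<open>Both \<open>bar_inv\<close> and \<open>Ucan\<close> are definite descriptions, so
  neither says anything before existence and uniqueness are known. The usual construction of the bar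
  involution uses the quasi-R-matrix; here the order is reversed, and the expected answer defines
  the involution. This works because the scalars \<open>0\<close>, \<open>1\<close> and
  \<open>q + q^-1\<close> that occur are all bar invariant. The obstacle is that positive pairs are
  defined by recursion over distances, and moving a single value may regroup many of them. They are
  therefore characterised by a stability condition that has at most one solution
  (\<open>cupd_unique\<close>), so that after each move it suffices to exhibit some solution. The
  moves are those of Temperley-Lieb diagrams: a bracket slides past a neutral label, a cup appears,
  two strands are joined, or a closed loop contributes \<open>q + q^-1\<close>. All of this happens
  on labels of arbitrary integers, independently of \<open>m\<close> and \<open>n\<close>; that the
  resulting label comes from an element of \<open>Zp m n\<close> is settled afterwards.\<close>

definition emb :: "rat \<Rightarrow> qf" where "emb c = Fract [:c:] 1"

lemma emb_0 [simp]: "emb 0 = 0"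
  by (simp add: emb_def Zero_fract_def)

lemma emb_1 [simp]: "emb 1 = 1"
  by (simp add: emb_def One_fract_def one_pCons)

lemma emb_add: "emb (a + b) = emb a + emb b"
  by (simp add: emb_def)

lemma emb_mult: "emb (a * b) = emb a * emb b"
  by (simp add: emb_def mult.commute)

lemma emb_eq_0_iff [simp]: "emb c = 0 \<longleftrightarrow> c = 0"
  by (simp add: emb_def Zero_fract_def eq_fract)

text \<open>Evaluation of a rational polynomial at a field element. At \<open>qq\<close> it is the
  inclusion of polynomials into the field; at \<open>inverse qq\<close> it is what the bar map has
  to do on polynomials.\<close>

definition evl :: "qf \<Rightarrow> rat poly \<Rightarrow> qf" where
  "evl x p = poly (map_poly emb p) x"

lemma evl_pCons: "evl x (pCons a p) = emb a + x * evl x p"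
  by (simp add: evl_def map_poly_pCons)

lemma evl_0 [simp]: "evl x 0 = 0"
  by (simp add: evl_def)

lemma evl_1 [simp]: "evl x 1 = 1"
  by (simp add: evl_def)

lemma evl_add: "evl x (p + r) = evl x p + evl x r"
proof -
  have "map_poly emb (p + r) = map_poly emb p + map_poly emb r"
    by (rule poly_eqI) (simp add: coeff_map_poly emb_add)
  then show ?thesis by (simp add: evl_def)
qed

lemma evl_smult: "evl x (smult c p) = emb c * evl x p"
  by (induction p) (simp_all add: evl_pCons emb_mult algebra_simps)

lemma evl_mult: "evl x (p * r) = evl x p * evl x r"
  by (induction p) (simp_all add: evl_pCons evl_add evl_smult algebra_simps)

lemma evl_qq: "evl qq p = Fract p 1"
proof (induction p)
  case 0
  show ?case by (simp add: Zero_fract_def)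
next
  case (pCons a p)
  have "pCons a p = [:a:] + [:0, 1:] * p" by simp
  then have "Fract (pCons a p) 1 = emb a + qq * Fract p 1"
    by (simp add: emb_def qq_def)
  with pCons show ?case by (simp add: evl_pCons)
qed

lemma qq_nonzero [simp]: "qq \<noteq> 0"
  by (simp add: qq_def Zero_fract_def eq_fract)

lemma qq_power: "qq ^ k = Fract (monom 1 k) 1"
proof (induction k)
  case 0
  show ?case by (simp add: One_fract_def)
next
  case (Suc k)
  then show ?case by (simp add: qq_def monom_Suc)
qed

lemma map_poly_emb_reflect: "map_poly emb (reflect_poly p) = reflect_poly (map_poly emb p)"
proof -
  have "degree (map_poly emb p) = degree p"
    by (rule degree_map_poly) simp
  then show ?thesis
    by (intro poly_eqI) (simp add: coeff_map_poly coeff_reflect_poly)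
qed

text \<open>Clearing denominators turns evaluation at \<open>inverse qq\<close> into reversal of the
  coefficients. Hence this evaluation is injective and extends to fractions; integrality and degree
  bounds for the bar map also come from here.\<close>

lemma evl_inverse_qq: "qq ^ degree p * evl (inverse qq) p = Fract (reflect_poly p) 1"
proof -
  have d: "degree (map_poly emb p) = degree p"
    by (rule degree_map_poly) simp
  have "Fract (reflect_poly p) 1 = poly (reflect_poly (map_poly emb p)) qq"
    by (simp add: evl_qq [symmetric] evl_def map_poly_emb_reflect)
  also have "\<dots> = qq ^ degree p * poly (map_poly emb p) (inverse qq)"
    by (simp add: poly_reflect_poly_nz d)
  finally show ?thesis by (simp add: evl_def)
qed

lemma evl_inverse_qq_eq_0_iff [simp]: "evl (inverse qq) p = 0 \<longleftrightarrow> p = 0"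
proof
  assume "evl (inverse qq) p = 0"
  then have "Fract (reflect_poly p) 1 = 0"
    by (simp add: evl_inverse_qq [symmetric])
  then show "p = 0" by (simp add: Zero_fract_def eq_fract)
qed simp

definition is_qbar :: "(qf \<Rightarrow> qf) \<Rightarrow> bool" where
  "is_qbar \<sigma> \<longleftrightarrow> (\<forall>x y. \<sigma> (x + y) = \<sigma> x + \<sigma> y) \<and> (\<forall>x y. \<sigma> (x * y) = \<sigma> x * \<sigma> y)
               \<and> (\<forall>c. \<sigma> (Fract [:c:] 1) = Fract [:c:] 1) \<and> \<sigma> qq = inverse qq"

text \<open>The conditions determine the map on constants and on \<open>qq\<close>, hence on
  polynomials, hence on quotients. This gives uniqueness in the description of \<open>qbar\<close>
  and suggests the formula for existence.\<close>

lemma is_qbar_Fract: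
  assumes "is_qbar \<sigma>" "b \<noteq> 0"
  shows "\<sigma> (Fract a b) = evl (inverse qq) a / evl (inverse qq) b"
proof -
  have add: "\<sigma> (x + y) = \<sigma> x + \<sigma> y" and mult: "\<sigma> (x * y) = \<sigma> x * \<sigma> y"
    and c: "\<sigma> (emb d) = emb d" and q: "\<sigma> qq = inverse qq" for x y d
    using assms(1) by (auto simp: is_qbar_def emb_def)
  have pol: "\<sigma> (evl qq p) = evl (inverse qq) p" for p
  proof (induction p)
    case 0
    show ?case using c [of 0] by simp
  next
    case (pCons a p)
    then show ?case by (simp add: evl_pCons add mult c q)
  qed
  have "Fract a b * Fract b 1 = Fract a 1"
    using assms(2) by (simp add: eq_fract)
  then have "\<sigma> (Fract a b) * \<sigma> (Fract b 1) = \<sigma> (Fract a 1)"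
    by (metis mult)
  then have "\<sigma> (Fract a b) * evl (inverse qq) b = evl (inverse qq) a"
    by (simp add: pol [symmetric] evl_qq)
  then show ?thesis using assms(2) by (simp add: eq_divide_eq)
qed

lemma is_qbar_exists: "\<exists>\<sigma>. is_qbar \<sigma>"
proof -
  let ?e = "evl (inverse qq)"
  define \<sigma> where "\<sigma> x = (THE y. \<exists>a b. b \<noteq> 0 \<and> x = Fract a b \<and> y = ?e a / ?e b)" for x
  have S: "\<sigma> (Fract a b) = ?e a / ?e b" if b: "b \<noteq> 0" for a b
    unfolding \<sigma>_def
  proof (rule the_equality)
    show "\<exists>a' b'. b' \<noteq> 0 \<and> Fract a b = Fract a' b' \<and> ?e a / ?e b = ?e a' / ?e b'"
      using b by blast
  next
    fix y assume "\<exists>a' b'. b' \<noteq> 0 \<and> Fract a b = Fract a' b' \<and> y = ?e a' / ?e b'"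
    then obtain a' b' where *: "b' \<noteq> 0" "Fract a b = Fract a' b'" "y = ?e a' / ?e b'"
      by blast
    \<comment> \<open>Independence of the representing fraction: the cross-multiplied identity
      survives the multiplicative evaluation.\<close>
    then have "a * b' = a' * b" using b by (simp add: eq_fract)
    then have "?e a * ?e b' = ?e a' * ?e b" by (metis evl_mult)
    then show "y = ?e a / ?e b" using * b by (simp add: frac_eq_eq)
  qed
  have "\<sigma> (x + y) = \<sigma> x + \<sigma> y \<and> \<sigma> (x * y) = \<sigma> x * \<sigma> y" for x y
    by (cases x; cases y) (simp add: S evl_add evl_mult add_frac_eq mult.commute)
  moreover have "\<sigma> (Fract [:c:] 1) = Fract [:c:] 1" for c
    by (simp add: S evl_pCons emb_def)
  moreover have "\<sigma> qq = inverse qq"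
    by (simp add: qq_def S evl_pCons)
  ultimately show ?thesis unfolding is_qbar_def by blast
qed

lemma is_qbar_qbar: "is_qbar qbar"
proof -
  have "\<exists>!\<sigma>. is_qbar \<sigma>"
  proof (rule ex_ex1I [OF is_qbar_exists])
    fix \<sigma> \<tau> assume "is_qbar \<sigma>" "is_qbar \<tau>"
    then have "\<sigma> x = \<tau> x" for x
      by (cases x) (simp add: is_qbar_Fract)
    then show "\<sigma> = \<tau>" ..
  qed
  then show ?thesis
    using theI' [of is_qbar] unfolding qbar_def is_qbar_def by simp
qed

lemma qbar_add: "qbar (x + y) = qbar x + qbar y"
  and qbar_mult: "qbar (x * y) = qbar x * qbar y"
  and qbar_qq [simp]: "qbar qq = inverse qq"
  using is_qbar_qbar by (auto simp: is_qbar_def)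

lemma qbar_emb [simp]: "qbar (emb c) = emb c"
  using is_qbar_qbar by (auto simp: is_qbar_def emb_def)

lemma qbar_0 [simp]: "qbar 0 = 0"
  using qbar_emb [of 0] by (simp del: qbar_emb)

lemma qbar_1 [simp]: "qbar 1 = 1"
  using qbar_emb [of 1] by (simp del: qbar_emb)

lemma qbar_eq_0_iff [simp]: "qbar x = 0 \<longleftrightarrow> x = 0"
proof
  assume "qbar x = 0"
  show "x = 0"
  proof (rule ccontr)
    assume "x \<noteq> 0"
    then have "qbar x * qbar (inverse x) = 1" by (simp add: qbar_mult [symmetric])
    with \<open>qbar x = 0\<close> show False by simp
  qed
qed simp

lemma qbar_inverse: "qbar (inverse x) = inverse (qbar x)"
proof (cases "x = 0")
  case False
  then have "qbar x * qbar (inverse x) = 1" by (simp add: qbar_mult [symmetric])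
  then show ?thesis using False by (simp add: field_simps)
qed simp

lemma qbar_power: "qbar (x ^ k) = qbar x ^ k"
  by (induction k) (simp_all add: qbar_mult)

lemma qbar_evl_qq: "qbar (evl qq p) = evl (inverse qq) p"
  using is_qbar_Fract [OF is_qbar_qbar, of 1 p] by (simp add: evl_qq)

lemma qbar_qbar [simp]: "qbar (qbar x) = x"
proof -
  have "qbar (evl (inverse qq) p) = evl qq p" for p
    by (induction p) (simp_all add: evl_pCons qbar_add qbar_mult qbar_inverse)
  then have pol: "qbar (qbar (Fract p 1)) = Fract p 1" for p
    by (simp add: evl_qq [symmetric] qbar_evl_qq)
  show ?thesis
  proof (cases x)
    case (Fract a b)
    then have "x = Fract a 1 * inverse (Fract b 1)" by simp
    then show ?thesis by (simp only: qbar_mult qbar_inverse pol)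
  qed
qed

lemma qbar_qpow: "qbar (qpow k) = qpow (- k)"
  by (auto simp: qpow_def qbar_power qbar_inverse)

lemma qpow_simps [simp]: "qpow 0 = 1" "qpow 1 = qq" "qpow (- 1) = inverse qq"
  by (simp_all add: qpow_def)

section \<open>Laurent polynomials\<close>

lemma map_poly_of_int_add:
  "map_poly (of_int :: int \<Rightarrow> rat) (p + r) = map_poly of_int p + map_poly of_int r"
  by (rule poly_eqI) (simp add: coeff_map_poly)

lemma map_poly_of_int_minus:
  "map_poly (of_int :: int \<Rightarrow> rat) (- p) = - map_poly of_int p"
  by (rule poly_eqI) (simp add: coeff_map_poly)

lemma map_poly_of_int_mult:
  "map_poly (of_int :: int \<Rightarrow> rat) (p * r) = map_poly of_int p * map_poly of_int r"
  by (rule poly_eqI) (simp add: coeff_map_poly coeff_mult)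

lemma map_poly_of_int_monom:
  "map_poly (of_int :: int \<Rightarrow> rat) (monom c k) = monom (of_int c) k"
  by (rule poly_eqI) (simp add: coeff_map_poly)

lemma laurent_int_iff:
  "laurent_int x \<longleftrightarrow> (\<exists>p k. x = Fract (map_poly of_int p) 1 * inverse qq ^ k)"
  by (simp add: laurent_int_def qq_power power_inverse)

lemma laurent_int_add: "laurent_int x \<Longrightarrow> laurent_int y \<Longrightarrow> laurent_int (x + y)"
proof -
  assume "laurent_int x" "laurent_int y"
  then obtain p k r l where x: "x = Fract (map_poly of_int p) (monom 1 k)"
    and y: "y = Fract (map_poly of_int r) (monom 1 l)"
    unfolding laurent_int_def by blast
  have "x + y = Fract (map_poly of_int (p * monom 1 l + r * monom 1 k)) (monom 1 (k + l))"
    unfolding x y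
    by (simp add: map_poly_of_int_add map_poly_of_int_mult map_poly_of_int_monom mult_monom)
  then show ?thesis unfolding laurent_int_def by blast
qed

lemma laurent_int_mult: "laurent_int x \<Longrightarrow> laurent_int y \<Longrightarrow> laurent_int (x * y)"
proof -
  assume "laurent_int x" "laurent_int y"
  then obtain p k r l where x: "x = Fract (map_poly of_int p) (monom 1 k)"
    and y: "y = Fract (map_poly of_int r) (monom 1 l)"
    unfolding laurent_int_def by blast
  have "x * y = Fract (map_poly of_int (p * r)) (monom 1 (k + l))"
    unfolding x y by (simp add: map_poly_of_int_mult mult_monom)
  then show ?thesis unfolding laurent_int_def by blast
qed

lemma laurent_int_0: "laurent_int 0"
  unfolding laurent_int_def
  by (rule exI [of _ 0], rule exI [of _ 0]) (simp add: Zero_fract_def)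

lemma laurent_int_qq_power: "laurent_int (qq ^ k)"
  unfolding laurent_int_def qq_power
  by (rule exI [of _ "monom 1 k"], rule exI [of _ 0])
     (simp add: map_poly_of_int_monom)

lemma laurent_int_minus: "laurent_int x \<Longrightarrow> laurent_int (- x)"
proof -
  assume "laurent_int x"
  then obtain p k where x: "x = Fract (map_poly of_int p) (monom 1 k)"
    unfolding laurent_int_def by blast
  have "- x = Fract (map_poly of_int (- p)) (monom 1 k)"
    unfolding x by (simp add: map_poly_of_int_minus)
  then show ?thesis unfolding laurent_int_def by blast
qed

lemma laurent_int_sum: "(\<And>x. x \<in> A \<Longrightarrow> laurent_int (g x)) \<Longrightarrow> laurent_int (sum g A)"
  by (induction A rule: infinite_finite_induct) (simp_all add: laurent_int_0 laurent_int_add)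

lemma laurent_int_qbar: "laurent_int x \<Longrightarrow> laurent_int (qbar x)"
proof -
  assume "laurent_int x"
  then obtain p k where x: "x = Fract (map_poly of_int p) 1 * inverse qq ^ k"
    unfolding laurent_int_iff by blast
  let ?p = "map_poly (of_int :: int \<Rightarrow> rat) p"
  have deg: "degree ?p = degree p" by (rule degree_map_poly) simp
  then have refl: "reflect_poly ?p = map_poly of_int (reflect_poly p)"
    by (intro poly_eqI) (simp add: coeff_map_poly coeff_reflect_poly)
  have "qbar (Fract ?p 1) = evl (inverse qq) ?p"
    by (simp add: evl_qq [symmetric] qbar_evl_qq)
  also have "\<dots> = Fract (reflect_poly ?p) 1 * inverse qq ^ degree ?p"
    by (simp add: evl_inverse_qq [symmetric] field_simps)
  finally have "laurent_int (qbar (Fract ?p 1))"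
    unfolding laurent_int_iff refl by blast
  moreover have "qbar (inverse qq ^ k) = qq ^ k"
    by (simp add: qbar_power qbar_inverse)
  ultimately show ?thesis
    unfolding x by (simp add: qbar_mult laurent_int_mult laurent_int_qq_power)
qed

lemma qZq_diff: "qZq x \<Longrightarrow> qZq y \<Longrightarrow> qZq (x - y)"
proof -
  assume "qZq x" "qZq y"
  then obtain p r where "coeff p 0 = 0" "x = Fract (map_poly of_int p) 1"
    "coeff r 0 = 0" "y = Fract (map_poly of_int r) 1"
    unfolding qZq_def by blast
  moreover have "map_poly of_int (p - r) = map_poly of_int p - map_poly (of_int :: int \<Rightarrow> rat) r"
    by (rule poly_eqI) (simp add: coeff_map_poly)
  ultimately show ?thesis unfolding qZq_def
    by (intro exI [of _ "p - r"]) simp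
qed

lemma qZq_0 [simp]: "qZq 0"
  unfolding qZq_def by (rule exI [of _ 0]) (simp add: Zero_fract_def)

lemma qZq_qq_power: "0 < k \<Longrightarrow> qZq (qq ^ k)"
  unfolding qZq_def qq_power
  by (rule exI [of _ "monom 1 k"]) (simp add: map_poly_of_int_monom)

text \<open>If a polynomial p of degree d equals its bar image, then q^d p is the reversal of p.
  With zero constant term the left side has no coefficients in degrees up to d, while the right side
  has none above d, so both vanish. This is the source of uniqueness of canonical basis
  elements.\<close>

lemma qbar_fixed_qZq:
  assumes "qZq x" "qbar x = x"
  shows "x = 0"
proof -
  obtain p where p0: "coeff p 0 = 0" and x: "x = Fract (map_poly of_int p) 1"
    using assms(1) unfolding qZq_def by blast
  let ?p = "map_poly (of_int :: int \<Rightarrow> rat) p"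
  let ?d = "degree ?p"
  have "qbar x = evl (inverse qq) ?p"
    unfolding x by (simp add: evl_qq [symmetric] qbar_evl_qq)
  then have "qq ^ ?d * x = Fract (reflect_poly ?p) 1"
    using assms(2) by (simp add: evl_inverse_qq)
  then have eq: "monom 1 ?d * ?p = reflect_poly ?p"
    unfolding x qq_power by (simp add: eq_fract)
  have "coeff (reflect_poly ?p) k = 0" for k
  proof (cases "k \<le> ?d")
    case True
    then have "coeff (monom 1 ?d * ?p) k = 0"
      using p0 by (simp add: coeff_monom_mult coeff_map_poly)
    then show ?thesis by (simp only: eq)
  next
    case False
    then show ?thesis by (simp add: coeff_reflect_poly)
  qed
  then have "reflect_poly ?p = 0" by (intro poly_eqI) simp
  then have "?p = 0" by simp
  then show ?thesis unfolding x by (simp add: Zero_fract_def)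
qed

section \<open>Cup diagrams\<close>

text \<open>A vertex \<open>x\<close> is labelled by \<open>(x \<in> S, x \<in> T)\<close> for the index sets \<open>S\<close> and \<open>T\<close> of the two
  wedges. Reading \<open>opn\<close> as an opening and \<open>cls\<close> as a closing bracket turns the positive pairs
  into the matching pairs of brackets.\<close>

type_synonym diag = "int \<Rightarrow> bool \<times> bool"

abbreviation opn :: "bool \<times> bool" where "opn \<equiv> (False, True)"
abbreviation cls :: "bool \<times> bool" where "cls \<equiv> (True, False)"

definition verts :: "(int \<times> int) set \<Rightarrow> int set" where
  "verts M = fst ` M \<union> snd ` M"

lemma verts_simps [simp]: "verts {} = {}" "verts (insert (b, a) M) = insert b (insert a (verts M))"
  by (auto simp: verts_def)

text \<open>The last condition is that of a stable matching, in which close partners are preferred. It encodes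
  the recursion over distances in \<open>\<Sigma>\<^sup>+\<close> and forces the pairs to be nested.\<close>

definition cupd :: "diag \<Rightarrow> (int \<times> int) set \<Rightarrow> bool" where
  "cupd s M \<longleftrightarrow> finite M
     \<and> (\<forall>b a. (b, a) \<in> M \<longrightarrow> b < a \<and> s b = opn \<and> s a = cls)
     \<and> (\<forall>b a a'. (b, a) \<in> M \<longrightarrow> (b, a') \<in> M \<longrightarrow> a = a')
     \<and> (\<forall>b b' a. (b, a) \<in> M \<longrightarrow> (b', a) \<in> M \<longrightarrow> b = b')
     \<and> (\<forall>x y. x < y \<longrightarrow> s x = opn \<longrightarrow> s y = cls \<longrightarrow>
          (\<exists>z. z \<le> y \<and> (x, z) \<in> M) \<or> (\<exists>z. x \<le> z \<and> (z, y) \<in> M))"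

lemma cupdI:
  assumes "finite M"
    and "\<And>b a. (b, a) \<in> M \<Longrightarrow> b < a \<and> s b = opn \<and> s a = cls"
    and "\<And>b a a'. (b, a) \<in> M \<Longrightarrow> (b, a') \<in> M \<Longrightarrow> a = a'"
    and "\<And>b b' a. (b, a) \<in> M \<Longrightarrow> (b', a) \<in> M \<Longrightarrow> b = b'"
    and "\<And>x y. x < y \<Longrightarrow> s x = opn \<Longrightarrow> s y = cls \<Longrightarrow>
          (\<exists>z. z \<le> y \<and> (x, z) \<in> M) \<or> (\<exists>z. x \<le> z \<and> (z, y) \<in> M)"
  shows "cupd s M"
  using assms unfolding cupd_def by blast

lemma cupdD:
  assumes "cupd s M"
  shows "finite M"
    and "(b, a) \<in> M \<Longrightarrow> b < a" and "(b, a) \<in> M \<Longrightarrow> s b = opn" and "(b, a) \<in> M \<Longrightarrow> s a = cls"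
    and "(b, a) \<in> M \<Longrightarrow> (b, a') \<in> M \<Longrightarrow> a = a'"
    and "(b, a) \<in> M \<Longrightarrow> (b', a) \<in> M \<Longrightarrow> b = b'"
    and "x < y \<Longrightarrow> s x = opn \<Longrightarrow> s y = cls \<Longrightarrow>
          (\<exists>z. z \<le> y \<and> (x, z) \<in> M) \<or> (\<exists>z. x \<le> z \<and> (z, y) \<in> M)"
proof -
  show "finite M" "(b, a) \<in> M \<Longrightarrow> b < a" "(b, a) \<in> M \<Longrightarrow> s b = opn" "(b, a) \<in> M \<Longrightarrow> s a = cls"
    using assms unfolding cupd_def by blast+
  show "(b, a) \<in> M \<Longrightarrow> (b, a') \<in> M \<Longrightarrow> a = a'" "(b, a) \<in> M \<Longrightarrow> (b', a) \<in> M \<Longrightarrow> b = b'"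
    using assms unfolding cupd_def by blast+
  show "x < y \<Longrightarrow> s x = opn \<Longrightarrow> s y = cls \<Longrightarrow>
          (\<exists>z. z \<le> y \<and> (x, z) \<in> M) \<or> (\<exists>z. x \<le> z \<and> (z, y) \<in> M)"
    using assms unfolding cupd_def by blast
qed

lemma cupd_verts:
  assumes "cupd s M" "x \<in> verts M"
  shows "s x = opn \<or> s x = cls"
  using assms(2) cupdD(3,4) [OF assms(1)] by (auto simp: verts_def)

text \<open>Induction on the length of a pair. For a pair of one diagram, stability of the other
  provides either the same pair or a shorter one sharing an endpoint; by induction the shorter one
  also belongs to the first diagram, where endpoints have only one partner.\<close>

lemma cupd_unique:
  assumes "cupd s M" "cupd s M'"
  shows "M = M'"
proof -
  have "(b, a) \<in> M \<longleftrightarrow> (b, a) \<in> M'" for b a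
  proof (induction "nat (a - b)" arbitrary: a b rule: less_induct)
    case less
    have dir: "(b, a) \<in> N'" if "(b, a) \<in> N" and N: "cupd s N" and N': "cupd s N'"
      and IH: "\<And>b' a'. nat (a' - b') < nat (a - b) \<Longrightarrow> (b', a') \<in> N' \<Longrightarrow> (b', a') \<in> N" for N N'
    proof -
      have ba: "b < a" "s b = opn" "s a = cls" using cupdD(2-4) [OF N that(1)] by auto
      from cupdD(7) [OF N' this] show ?thesis
      proof (elim disjE exE conjE)
        fix z assume z: "z \<le> a" "(b, z) \<in> N'"
        have "b < z" using cupdD(2) [OF N' z(2)] .
        show ?thesis
        proof (cases "z = a")
          case False
          then have "(b, z) \<in> N" using z \<open>b < z\<close> by (intro IH) auto
          with that(1) cupdD(5) [OF N] z show ?thesis by blast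
        qed (use z in simp)
      next
        fix z assume z: "b \<le> z" "(z, a) \<in> N'"
        have "z < a" using cupdD(2) [OF N' z(2)] .
        show ?thesis
        proof (cases "z = b")
          case False
          then have "(z, a) \<in> N" using z \<open>z < a\<close> by (intro IH) auto
          with that(1) cupdD(6) [OF N] z show ?thesis by blast
        qed (use z in simp)
      qed
    qed
    show ?case
      using dir [of M M'] dir [of M' M] assms less by blast
  qed
  then show ?thesis by auto
qed

section \<open>Product vectors attached to cup diagrams\<close>

definition wt :: "bool \<times> bool \<Rightarrow> bool \<times> bool \<Rightarrow> qf" where
  "wt p r = (if p = opn \<and> r = cls then 1 else if p = cls \<and> r = opn then qq else 0)"

text \<open>The coefficient at \<open>h\<close> of the product over all pairs, with the labels of
  \<open>s\<close> kept fixed at unpaired vertices. It is defined for every label \<open>h\<close>,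
  whether or not \<open>h\<close> comes from a labelling, so that local moves can be computed
  freely.\<close>

definition Wt :: "diag \<Rightarrow> (int \<times> int) set \<Rightarrow> diag \<Rightarrow> qf" where
  "Wt s M h = (if \<forall>x. x \<notin> verts M \<longrightarrow> h x = s x then \<Prod>(b, a)\<in>M. wt (h b) (h a) else 0)"

lemma Wt_self: "cupd s M \<Longrightarrow> Wt s M s = 1"
proof -
  assume M: "cupd s M"
  have "(case p of (b, a) \<Rightarrow> wt (s b) (s a)) = 1" if "p \<in> M" for p
    using that cupdD(3,4) [OF M] by (cases p) (auto simp: wt_def)
  then show ?thesis by (simp add: Wt_def prod.neutral)
qed

lemma Wt_zero: "x \<notin> verts M \<Longrightarrow> h x \<noteq> s x \<Longrightarrow> Wt s M h = 0"
  by (auto simp: Wt_def)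

lemma Wt_zero_pair:
  assumes "finite M" "(b, a) \<in> M" "wt (h b) (h a) = 0"
  shows "Wt s M h = 0"
proof -
  have "(\<Prod>(b, a)\<in>M. wt (h b) (h a)) = 0"
    using assms by (intro prod_zero bexI [of _ "(b, a)"]) simp_all
  then show ?thesis by (simp add: Wt_def)
qed

text \<open>At unpaired vertices only the agreement of the two labels counts, not their values.
  Hence the labels of \<open>s\<close> and \<open>h\<close> may be changed there simultaneously,
  which is how \<open>a\<close> and \<open>a + 1\<close> are relabelled below.\<close>

lemma Wt_cong:
  assumes "\<And>x. x \<in> verts M \<Longrightarrow> h x = h' x"
    and "\<And>x. x \<notin> verts M \<Longrightarrow> h x = s x \<longleftrightarrow> h' x = s' x"
  shows "Wt s M h = Wt s' M h'"
proof -
  have "(\<Prod>(b, a)\<in>M. wt (h b) (h a)) = (\<Prod>(b, a)\<in>M. wt (h' b) (h' a))"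
  proof (intro prod.cong refl, safe)
    fix b a assume "(b, a) \<in> M"
    then have "b \<in> verts M" "a \<in> verts M" by (auto simp: verts_def image_iff intro: bexI [of _ "(b, a)"])
    then show "wt (h b) (h a) = wt (h' b) (h' a)" by (simp add: assms(1))
  qed
  moreover have "(\<forall>x. x \<notin> verts M \<longrightarrow> h x = s x) \<longleftrightarrow> (\<forall>x. x \<notin> verts M \<longrightarrow> h' x = s' x)"
    using assms(2) by blast
  ultimately show ?thesis by (simp only: Wt_def)
qed

text \<open>Splits off one factor. The two vertices are unpaired in the smaller diagram, and
  overwriting \<open>s\<close> there by \<open>h\<close> makes the agreement condition at them hold
  trivially.\<close>

lemma Wt_insert:
  assumes "finite M" "b \<notin> verts M" "a \<notin> verts M"
  shows "Wt s (insert (b, a) M) h = wt (h b) (h a) * Wt (s(b := h b, a := h a)) M h"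
proof -
  have "(b, a) \<notin> M" using assms(2) by (force simp: verts_def)
  moreover have c: "(\<forall>x. x \<notin> verts (insert (b, a) M) \<longrightarrow> h x = s x)
      \<longleftrightarrow> (\<forall>x. x \<notin> verts M \<longrightarrow> h x = (s(b := h b, a := h a)) x)"
    using assms(2,3) by auto
  moreover have p: "(\<Prod>(b, a)\<in>insert (b, a) M. wt (h b) (h a)) = wt (h b) (h a) * (\<Prod>(b, a)\<in>M. wt (h b) (h a))"
    using assms(1) calculation(1) by simp
  moreover have "(if Q then x * y else 0) = x * (if Q then y else 0)" for Q and x y :: qf
    by simp
  ultimately show ?thesis
    unfolding Wt_def c p by blast
qed

lemma Wt_nonzeroD:
  assumes "cupd s M" "Wt s M t \<noteq> 0"
  shows "t x = s x \<or> (t x = opn \<or> t x = cls) \<and> (s x = opn \<or> s x = cls)"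
proof (cases "x \<in> verts M")
  case True
  then obtain b a where ba: "(b, a) \<in> M" "x = b \<or> x = a" by (auto simp: verts_def)
  then have "wt (t b) (t a) \<noteq> 0"
    using Wt_zero_pair [OF cupdD(1) [OF assms(1)] ba(1)] assms(2) by blast
  with ba cupdD(3,4) [OF assms(1) ba(1)] show ?thesis
    by (auto simp: wt_def split: if_splits)
next
  case False
  then show ?thesis using Wt_zero assms(2) by metis
qed

section \<open>Local action of a generator at two adjacent vertices\<close>

text \<open>Interchanging the labels \<open>(False, False)\<close> and \<open>(True, True)\<close> turns \<open>F\<^sub>a\<close> into \<open>E\<^sub>a\<close>: below,
  \<open>gop False a\<close> is \<open>F\<^sub>a\<close> and \<open>gop True a\<close> is \<open>E\<^sub>a\<close>, in coordinates.\<close>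

definition gop :: "bool \<Rightarrow> int \<Rightarrow> (diag \<Rightarrow> qf) \<Rightarrow> diag \<Rightarrow> qf" where
  "gop u a \<phi> t = (
     if t a = (u, u) \<and> t (a + 1) = (\<not> u, \<not> u)
       then \<phi> (t(a := cls, a + 1 := opn)) + inverse qq * \<phi> (t(a := opn, a + 1 := cls))
     else if t a = (u, u) \<and> (t (a + 1) = opn \<or> t (a + 1) = cls)
       then \<phi> (t(a := t (a + 1), a + 1 := (u, u)))
     else if (t a = opn \<or> t a = cls) \<and> t (a + 1) = (\<not> u, \<not> u)
       then \<phi> (t(a := (\<not> u, \<not> u), a + 1 := t a))
     else if t a = opn \<and> t (a + 1) = cls then \<phi> (t(a := (\<not> u, \<not> u), a + 1 := (u, u)))
     else if t a = cls \<and> t (a + 1) = opn then qq * \<phi> (t(a := (\<not> u, \<not> u), a + 1 := (u, u)))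
     else 0)"

text \<open>Non-bracket labels are constant on the support of \<open>Wt s M\<close>. So throughout
  the support there is either nothing to move or no room for it.\<close>

lemma gop_Wt_zero:
  assumes M: "cupd s M" and s: "s a = (u, u) \<or> s (a + 1) = (\<not> u, \<not> u)"
  shows "gop u a (Wt s M) t = 0"
proof -
  have "a \<notin> verts M \<or> a + 1 \<notin> verts M"
    using cupd_verts [OF M] s by (cases u; fastforce)
  have z: "Wt s M h = 0" if "s a = (u, u) \<and> h a \<noteq> (u, u) \<or> s (a + 1) = (\<not> u, \<not> u) \<and> h (a + 1) \<noteq> (\<not> u, \<not> u)" for h
  proof (rule ccontr)
    assume "Wt s M h \<noteq> 0"
    from Wt_nonzeroD [OF M this, of a] Wt_nonzeroD [OF M this, of "a + 1"] that
    show False by (cases u; auto)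
  qed
  have "Wt s M (t(a := cls, a + 1 := opn)) = 0" "Wt s M (t(a := opn, a + 1 := cls)) = 0"
    "Wt s M (t(a := (\<not> u, \<not> u), a + 1 := (u, u))) = 0"
    "t (a + 1) \<noteq> (u, u) \<Longrightarrow> Wt s M (t(a := t (a + 1), a + 1 := (u, u))) = 0"
    "t a \<noteq> (\<not> u, \<not> u) \<Longrightarrow> Wt s M (t(a := (\<not> u, \<not> u), a + 1 := t a)) = 0"
    using s by (auto intro!: z)
  then show ?thesis by (auto simp: gop_def)
qed

definition shft :: "int \<Rightarrow> int \<Rightarrow> int" where
  "shft a x = (if x = a then a + 1 else if x = a + 1 then a else x)"

lemma shft_shft [simp]: "shft a (shft a x) = x"
  by (auto simp: shft_def)

lemma shft_eq_iff: "shft a x = y \<longleftrightarrow> x = shft a y"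
  by (auto simp: shft_def)

lemma shft_less: "x < y \<Longrightarrow> \<not> (x = a \<and> y = a + 1) \<Longrightarrow> shft a x < shft a y"
  by (auto simp: shft_def)

text \<open>At most one of the two vertices carries a bracket, so the transposition preserves the
  order of all brackets, and the matching depends only on that order.\<close>

lemma cupd_shft:
  assumes M: "cupd s M"
    and s: "\<not> ((s a = opn \<or> s a = cls) \<and> (s (a + 1) = opn \<or> s (a + 1) = cls))"
  shows "cupd (\<lambda>x. s (shft a x)) ((\<lambda>(x, y). (shft a x, shft a y)) ` M)"
    (is "cupd ?s ?M")
proof -
  have mem: "(x, y) \<in> ?M \<longleftrightarrow> (shft a x, shft a y) \<in> M" for x y
    by (auto simp: image_iff shft_eq_iff intro!: bexI [of _ "(shft a x, shft a y)"])
  have mono: "shft a x < shft a y" if "x < y" "s x = opn \<or> s x = cls" "s y = opn \<or> s y = cls" for x y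
    using s that by (intro shft_less) auto
  show ?thesis
  proof (rule cupdI)
    show "finite ?M" using cupdD(1) [OF M] by simp
  next
    fix x y assume "(x, y) \<in> ?M"
    then have *: "(shft a x, shft a y) \<in> M" by (simp add: mem)
    from cupdD(2-4) [OF M *] mono [of "shft a x" "shft a y"]
    show "x < y \<and> s (shft a x) = opn \<and> s (shft a y) = cls" by simp
  next
    fix b c c' assume "(b, c) \<in> ?M" "(b, c') \<in> ?M"
    then have "shft a c = shft a c'" using cupdD(5) [OF M] unfolding mem by blast
    then show "c = c'" by (metis shft_shft)
  next
    fix b c c' assume "(c, b) \<in> ?M" "(c', b) \<in> ?M"
    then have "shft a c = shft a c'" using cupdD(6) [OF M] unfolding mem by blast
    then show "c = c'" by (metis shft_shft)
  next
    fix x y assume xy: "x < y" "s (shft a x) = opn" "s (shft a y) = cls"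
    have "shft a x < shft a y"
      using xy s by (intro shft_less) (auto simp: shft_def)
    from cupdD(7) [OF M this xy(2,3)]
    show "(\<exists>z. z \<le> y \<and> (x, z) \<in> ?M) \<or> (\<exists>z. x \<le> z \<and> (z, y) \<in> ?M)"
    proof (elim disjE exE conjE)
      fix z assume z: "z \<le> shft a y" "(shft a x, z) \<in> M"
      then have "s z = cls" using cupdD(4) [OF M] by blast
      then have "shft a z \<le> y"
        using z(1) mono [of z "shft a y"] xy(3) by (cases "z = shft a y") auto
      moreover have "(x, shft a z) \<in> ?M" using z by (simp add: mem)
      ultimately show ?thesis by blast
    next
      fix z assume z: "shft a x \<le> z" "(z, shft a y) \<in> M"
      then have "s z = opn" using cupdD(3) [OF M] by blast
      then have "x \<le> shft a z"
        using z(1) mono [of "shft a x" z] xy(2) by (cases "z = shft a x") auto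
      moreover have "(shft a z, y) \<in> ?M" using z by (simp add: mem)
      ultimately show ?thesis by blast
    qed
  qed
qed

lemma Wt_shft:
  "Wt (\<lambda>x. s (shft a x)) ((\<lambda>(x, y). (shft a x, shft a y)) ` M) t = Wt s M (\<lambda>x. t (shft a x))"
proof -
  let ?f = "\<lambda>(x, y). (shft a x, shft a y)"
  have "inj_on ?f M"
    by (rule inj_onI) (auto simp: shft_eq_iff)
  then have 1: "(\<Prod>(b, c)\<in>?f ` M. wt (t b) (t c)) = (\<Prod>(b, c)\<in>M. wt (t (shft a b)) (t (shft a c)))"
    by (simp add: prod.reindex case_prod_unfold)
  have v: "x \<in> verts (?f ` M) \<longleftrightarrow> shft a x \<in> verts M" for x
  proof -
    have "verts (?f ` M) = shft a ` verts M"
      by (simp add: verts_def image_Un image_image case_prod_unfold)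
    also have "x \<in> \<dots> \<longleftrightarrow> shft a x \<in> verts M"
      by (metis image_iff shft_shft)
    finally show ?thesis .
  qed
  have 2: "(\<forall>x. x \<notin> verts (?f ` M) \<longrightarrow> t x = s (shft a x)) \<longleftrightarrow>
        (\<forall>x. x \<notin> verts M \<longrightarrow> t (shft a x) = s x)"
    unfolding v by (metis shft_shft)
  show ?thesis by (simp only: Wt_def 1 2)
qed

lemma gop_Wt_shft:
  assumes M: "cupd s M"
    and s: "(s a = opn \<or> s a = cls) \<and> s (a + 1) = (u, u) \<or>
            s a = (\<not> u, \<not> u) \<and> (s (a + 1) = opn \<or> s (a + 1) = cls)"
  shows "gop u a (Wt s M) t
       = Wt (\<lambda>x. s (shft a x)) ((\<lambda>(x, y). (shft a x, shft a y)) ` M) t"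
proof -
  have st: "(\<lambda>x. t (shft a x)) = t(a := t (a + 1), a + 1 := t a)"
    by (auto simp: shft_def)
  have z: "Wt s M h = 0" if "s a = (\<not> u, \<not> u) \<and> h a \<noteq> (\<not> u, \<not> u) \<or> s (a + 1) = (u, u) \<and> h (a + 1) \<noteq> (u, u)
     \<or> (s a = opn \<or> s a = cls) \<and> h a \<noteq> opn \<and> h a \<noteq> cls
     \<or> (s (a + 1) = opn \<or> s (a + 1) = cls) \<and> h (a + 1) \<noteq> opn \<and> h (a + 1) \<noteq> cls" for h
  proof (rule ccontr)
    assume "Wt s M h \<noteq> 0"
    from Wt_nonzeroD [OF M this, of a] Wt_nonzeroD [OF M this, of "a + 1"] that
    show False by (cases u; auto)
  qed
  show ?thesis unfolding Wt_shft st gop_def using s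
    by (auto simp: z)
qed

text \<open>A pair of neighbours satisfies stability against every other bracket: a closing bracket
  to the right of \<open>a\<close> lies at or beyond \<open>a + 1\<close>, and an opening bracket to
  the left of \<open>a + 1\<close> lies at or before \<open>a\<close>.\<close>

lemma cupd_new:
  assumes M: "cupd s M" and s: "s a \<noteq> opn" "s a \<noteq> cls" "s (a + 1) \<noteq> opn" "s (a + 1) \<noteq> cls"
  shows "cupd (s(a := opn, a + 1 := cls)) (insert (a, a + 1) M)"
proof -
  have nv: "a \<notin> verts M" "a + 1 \<notin> verts M" using cupd_verts [OF M] s by blast+
  then have nm: "(a, x) \<notin> M" "(x, a) \<notin> M" "(a + 1, x) \<notin> M" "(x, a + 1) \<notin> M" for x
    by (force simp: verts_def)+
  show ?thesis
  proof (rule cupdI)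
    show "finite (insert (a, a + 1) M)" using cupdD(1) [OF M] by simp
  next
    fix x y assume "(x, y) \<in> insert (a, a + 1) M"
    then show "x < y \<and> (s(a := opn, a + 1 := cls)) x = opn \<and> (s(a := opn, a + 1 := cls)) y = cls"
      using cupdD(2-4) [OF M, of x y] nm by (auto split: if_splits)
  next
    fix x y assume xy: "x < y" "(s(a := opn, a + 1 := cls)) x = opn" "(s(a := opn, a + 1 := cls)) y = cls"
    show "(\<exists>z. z \<le> y \<and> (x, z) \<in> insert (a, a + 1) M) \<or> (\<exists>z. x \<le> z \<and> (z, y) \<in> insert (a, a + 1) M)"
    proof (cases "x = a \<or> y = a + 1")
      case True
      then have "x = a \<and> a + 1 \<le> y \<or> y = a + 1 \<and> x \<le> a" using xy(1) by auto
      then show ?thesis by blast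
    next
      case False
      then show ?thesis using cupdD(7) [OF M, of x y] xy by (auto split: if_splits)
    qed
  qed (use cupdD(5,6) [OF M] nm in auto)
qed

text \<open>The two summands of the coproduct produce \<open>(opn, cls)\<close> with coefficient 1
  and \<open>(cls, opn)\<close> with coefficient \<open>qq\<close>, which is exactly the factor of a
  new pair.\<close>

lemma gop_Wt_new:
  assumes M: "cupd s M" and s: "s a = (\<not> u, \<not> u)" "s (a + 1) = (u, u)"
  shows "gop u a (Wt s M) t = Wt (s(a := opn, a + 1 := cls)) (insert (a, a + 1) M) t"
proof -
  have nv: "a \<notin> verts M" "a + 1 \<notin> verts M" using cupd_verts [OF M] s by (cases u; fastforce)+
  have R: "Wt (s(a := opn, a + 1 := cls)) (insert (a, a + 1) M) t
     = wt (t a) (t (a + 1)) * Wt s M (t(a := (\<not> u, \<not> u), a + 1 := (u, u)))"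
    unfolding Wt_insert [OF cupdD(1) [OF M] nv]
    by (intro arg_cong2 [where f = "(*)"] refl Wt_cong) (use nv s in auto)
  have z: "Wt s M h = 0" if "h a \<noteq> (\<not> u, \<not> u) \<or> h (a + 1) \<noteq> (u, u)" for h
    using that nv s by (auto intro: Wt_zero)
  obtain p q r w where t: "t a = (p, q)" "t (a + 1) = (r, w)" by (metis surj_pair)
  show ?thesis unfolding R gop_def t
    by (cases u; cases p; cases q; cases r; cases w) (simp_all add: wt_def z)
qed

text \<open>With brackets at both vertices, the result can only have labels \<open>(u, u)\<close>
  and \<open>(\<not> u, \<not> u)\<close> there. The generator thus contracts the two vertices, and
  one equation between coefficients remains for each of the four bracket patterns.\<close>

lemma gop_WtI:
  assumes M: "cupd s M"
    and s: "s a = opn \<or> s a = cls" "s (a + 1) = opn \<or> s (a + 1) = cls"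
    and nv: "a \<notin> verts M'" "a + 1 \<notin> verts M'"
    and s': "s' a = (u, u)" "s' (a + 1) = (\<not> u, \<not> u)"
    and eq: "\<And>t. t a = (u, u) \<Longrightarrow> t (a + 1) = (\<not> u, \<not> u) \<Longrightarrow>
       Wt s M (t(a := cls, a + 1 := opn)) + inverse qq * Wt s M (t(a := opn, a + 1 := cls))
       = c * Wt s' M' t"
  shows "gop u a (Wt s M) t = c * Wt s' M' t"
proof (cases "t a = (u, u) \<and> t (a + 1) = (\<not> u, \<not> u)")
  case True
  then show ?thesis using eq [of t] by (simp add: gop_def)
next
  case False
  then have R: "Wt s' M' t = 0"
    using Wt_zero [OF nv(1), of t s'] Wt_zero [OF nv(2), of t s'] s' by auto
  have z: "Wt s M h = 0" if "h a \<noteq> opn \<and> h a \<noteq> cls \<or> h (a + 1) \<noteq> opn \<and> h (a + 1) \<noteq> cls" for h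
  proof (rule ccontr)
    assume "Wt s M h \<noteq> 0"
    from Wt_nonzeroD [OF M this, of a] Wt_nonzeroD [OF M this, of "a + 1"] that s
    show False by auto
  qed
  show ?thesis using False unfolding R by (cases u) (auto simp: gop_def z)
qed

section \<open>Removing and joining pairs\<close>

lemma verts_mem:
  assumes "(b, a) \<in> M"
  shows "b \<in> verts M" "a \<in> verts M"
  using assms by (force simp: verts_def)+

lemma cupd_remove:
  assumes M: "cupd s M" and ba: "(b, a) \<in> M"
  obtains M0 where "M = insert (b, a) M0" "finite M0" "b \<notin> verts M0" "a \<notin> verts M0" "b \<noteq> a"
proof
  let ?M0 = "M - {(b, a)}"
  show "M = insert (b, a) ?M0" "finite ?M0" using ba cupdD(1) [OF M] by auto
  have s: "s b = opn" "s a = cls" using cupdD(3,4) [OF M ba] .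
  then show "b \<noteq> a" by auto
  have u: "(b, y) \<in> M \<Longrightarrow> y = a" "(y, a) \<in> M \<Longrightarrow> y = b" for y
    using cupdD(5,6) [OF M] ba by blast+
  have v: "(y, b) \<notin> M" "(a, y) \<notin> M" for y
    using cupdD(4) [OF M, of y b] cupdD(3) [OF M, of a y] s by auto
  have "x \<in> verts ?M0 \<Longrightarrow> \<exists>y z. (y, z) \<in> M \<and> (y, z) \<noteq> (b, a) \<and> (x = y \<or> x = z)" for x
    by (force simp: verts_def)
  then show "b \<notin> verts ?M0" "a \<notin> verts ?M0"
    using u v by blast+
qed

lemma cupd_remove2:
  assumes M: "cupd s M" and ba: "(b, a) \<in> M" "(b', a') \<in> M" "b \<noteq> b'"
  obtains M0 where "M = insert (b, a) (insert (b', a') M0)" "finite M0"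
    "b \<notin> verts M0" "a \<notin> verts M0" "b' \<notin> verts M0" "a' \<notin> verts M0"
    "distinct [b, a, b', a']"
proof -
  obtain M1 where M1: "M = insert (b, a) M1" "finite M1" "b \<notin> verts M1" "a \<notin> verts M1" "b \<noteq> a"
    using cupd_remove [OF M ba(1)] .
  obtain M2 where M2: "M = insert (b', a') M2" "finite M2" "b' \<notin> verts M2" "a' \<notin> verts M2" "b' \<noteq> a'"
    using cupd_remove [OF M ba(2)] .
  have m: "(b', a') \<in> M1" using M1(1) ba by auto
  let ?M0 = "M1 - {(b', a')}"
  have "M = insert (b, a) (insert (b', a') ?M0)" using M1(1) m by auto
  moreover have "b \<notin> verts ?M0" "a \<notin> verts ?M0" using M1(3,4) by (auto simp: verts_def)
  moreover have "?M0 \<subseteq> M2" using M1(1) M2(1) by auto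
  then have "b' \<notin> verts ?M0" "a' \<notin> verts ?M0" using M2(3,4) by (auto simp: verts_def)
  moreover have "distinct [b, a, b', a']"
    using M1(3-5) M2(5) verts_mem [OF m] by auto
  moreover have "finite ?M0" using M1(2) by simp
  ultimately show ?thesis using that by blast
qed

text \<open>With \<open>lpair\<close> this names the two alternatives of the stability condition:
  the opening bracket \<open>x\<close> has a partner no farther than \<open>y\<close>, or the
  closing bracket \<open>y\<close> has a partner no farther than \<open>x\<close>. Insertion of a
  pair then becomes a rewrite rule.\<close>

definition rpair :: "(int \<times> int) set \<Rightarrow> int \<Rightarrow> int \<Rightarrow> bool" where
  "rpair M x y \<longleftrightarrow> (\<exists>z\<le>y. (x, z) \<in> M)"

definition lpair :: "(int \<times> int) set \<Rightarrow> int \<Rightarrow> int \<Rightarrow> bool" where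
  "lpair M x y \<longleftrightarrow> (\<exists>z\<ge>x. (z, y) \<in> M)"

lemma rpair_insert: "rpair (insert (b, a) M) x y \<longleftrightarrow> x = b \<and> a \<le> y \<or> rpair M x y"
  by (auto simp: rpair_def)

lemma lpair_insert: "lpair (insert (b, a) M) x y \<longleftrightarrow> y = a \<and> x \<le> b \<or> lpair M x y"
  by (auto simp: lpair_def)

lemma lpair_mono: "lpair M x y \<Longrightarrow> x' \<le> x \<Longrightarrow> lpair M x' y"
  unfolding lpair_def using order_trans by blast

lemma rpair_mono: "rpair M x y \<Longrightarrow> y \<le> y' \<Longrightarrow> rpair M x y'"
  unfolding rpair_def using order_trans by blast

lemma rpair_verts: "x \<notin> verts M \<Longrightarrow> \<not> rpair M x y"
  unfolding rpair_def using verts_mem(1) by blast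

lemma lpair_verts: "y \<notin> verts M \<Longrightarrow> \<not> lpair M x y"
  unfolding lpair_def using verts_mem(2) by blast

lemma cupd_pair:
  assumes "cupd s M" "x < y" "s x = opn" "s y = cls"
  shows "rpair M x y \<or> lpair M x y"
  using cupdD(7) [OF assms] unfolding rpair_def lpair_def by blast

lemma cupd_subI:
  assumes M: "cupd s M" and sub: "M0 \<subseteq> M"
    and s': "\<And>x. x \<in> verts M0 \<Longrightarrow> s' x = s x"
    and G: "\<And>x y. x < y \<Longrightarrow> s' x = opn \<Longrightarrow> s' y = cls \<Longrightarrow> rpair M0 x y \<or> lpair M0 x y"
  shows "cupd s' M0"
proof (rule cupdI)
  show "finite M0" using cupdD(1) [OF M] sub finite_subset by blast
  fix b a assume ba: "(b, a) \<in> M0"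
  then have "(b, a) \<in> M" using sub by blast
  with s' verts_mem [OF ba] show "b < a \<and> s' b = opn \<and> s' a = cls"
    using cupdD(2-4) [OF M] by simp
next
  fix x y assume "x < y" "s' x = opn" "s' y = cls"
  from G [OF this] show "(\<exists>z. z \<le> y \<and> (x, z) \<in> M0) \<or> (\<exists>z. x \<le> z \<and> (z, y) \<in> M0)"
    unfolding rpair_def lpair_def .
qed (use sub cupdD(5,6) [OF M] in blast)+

text \<open>For pairs inherited from a known diagram only stability has to be checked again. The
  instance formed by the new pair itself is exempt, since that pair is its own witness.\<close>

lemma cupd_insI:
  assumes M: "cupd s M" and sub: "M0 \<subseteq> M" and pq: "p \<notin> verts M0" "q \<notin> verts M0"
    and s': "\<And>x. x \<in> verts M0 \<Longrightarrow> s' x = s x" and lt: "p < q" "s' p = opn" "s' q = cls"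
    and G: "\<And>x y. x < y \<Longrightarrow> s' x = opn \<Longrightarrow> s' y = cls \<Longrightarrow> (x = p \<longrightarrow> y \<noteq> q) \<Longrightarrow>
      rpair (insert (p, q) M0) x y \<or> lpair (insert (p, q) M0) x y"
  shows "cupd s' (insert (p, q) M0)"
proof (rule cupdI)
  show "finite (insert (p, q) M0)" using cupdD(1) [OF M] sub finite_subset by blast
  have *: "b < a \<and> s' b = opn \<and> s' a = cls" if ba: "(b, a) \<in> M0" for b a
  proof -
    have "(b, a) \<in> M" using ba sub by blast
    with s' verts_mem [OF ba] show ?thesis using cupdD(2-4) [OF M] by simp
  qed
  then show "\<And>b a. (b, a) \<in> insert (p, q) M0 \<Longrightarrow> b < a \<and> s' b = opn \<and> s' a = cls"
    using lt by blast
  show "b = b'" if "(b, a) \<in> insert (p, q) M0" "(b', a) \<in> insert (p, q) M0" for b b' a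
    using that verts_mem [of b a M0] verts_mem [of b' a M0] pq cupdD(6) [OF M] sub by blast
  show "a = a'" if "(b, a) \<in> insert (p, q) M0" "(b, a') \<in> insert (p, q) M0" for b a a'
    using that verts_mem [of b a M0] verts_mem [of b a' M0] pq cupdD(5) [OF M] sub by blast
  fix x y assume xy: "x < y" "s' x = opn" "s' y = cls"
  show "(\<exists>z. z \<le> y \<and> (x, z) \<in> insert (p, q) M0) \<or> (\<exists>z. x \<le> z \<and> (z, y) \<in> insert (p, q) M0)"
  proof (cases "x = p \<and> y = q")
    case False
    then show ?thesis using G [OF xy] unfolding rpair_def lpair_def by blast
  qed auto
qed

section \<open>Contraction of two adjacent brackets\<close>

lemma gop_Wt_cup:
  assumes M: "cupd s M" and s: "s a = opn" "s (a + 1) = cls"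
  shows "\<exists>s' M'. cupd s' M' \<and> (\<forall>t. gop u a (Wt s M) t = (qq + inverse qq) * Wt s' M' t)"
proof -
  let ?s = "s(a := (u, u), a + 1 := (\<not> u, \<not> u))"
  have nO: "?s x = opn \<longleftrightarrow> s x = opn \<and> x \<noteq> a" "?s x = cls \<longleftrightarrow> s x = cls \<and> x \<noteq> a + 1" for x
    using s by (cases u; auto)+
  \<comment> \<open>Stability for neighbours leaves no other partner: a witness would have to end at
    or before \<open>a + 1\<close>, or start at or after \<open>a\<close>.\<close>
  have "(a, a + 1) \<in> M"
  proof -
    have "(\<exists>z. z \<le> a + 1 \<and> (a, z) \<in> M) \<or> (\<exists>z. a \<le> z \<and> (z, a + 1) \<in> M)"
      using cupdD(7) [OF M _ s] by simp
    then show ?thesis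
    proof (elim disjE exE conjE)
      fix z assume z: "z \<le> a + 1" "(a, z) \<in> M"
      with cupdD(2) [OF M z(2)] have "z = a + 1" by simp
      with z show ?thesis by simp
    next
      fix z assume z: "a \<le> z" "(z, a + 1) \<in> M"
      with cupdD(2) [OF M z(2)] have "z = a" by simp
      with z show ?thesis by simp
    qed
  qed
  then obtain M0 where M0: "M = insert (a, a + 1) M0" "finite M0" "a \<notin> verts M0" "a + 1 \<notin> verts M0"
    using cupd_remove [OF M] by metis
  have "cupd ?s M0"
  proof (rule cupd_subI [OF M])
    fix x y assume xy: "x < y" "?s x = opn" "?s y = cls"
    then show "rpair M0 x y \<or> lpair M0 x y"
      using cupd_pair [OF M, of x y] unfolding nO M0(1) rpair_insert lpair_insert by blast
  qed (use M0 in auto)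
  moreover have "gop u a (Wt s M) t = (qq + inverse qq) * Wt ?s M0 t" for t
  proof (rule gop_WtI [OF M _ _ M0(3,4)])
    fix t :: diag assume t: "t a = (u, u)" "t (a + 1) = (\<not> u, \<not> u)"
    have 1: "Wt s M (t(a := cls, a + 1 := opn)) = qq * Wt ?s M0 t"
      unfolding M0(1) Wt_insert [OF M0(2-4)]
      by (intro arg_cong2 [where f = "(*)"] Wt_cong) (use M0 t in \<open>auto simp: wt_def\<close>)
    have 2: "Wt s M (t(a := opn, a + 1 := cls)) = 1 * Wt ?s M0 t"
      unfolding M0(1) Wt_insert [OF M0(2-4)]
      by (intro arg_cong2 [where f = "(*)"] Wt_cong) (use M0 t in \<open>auto simp: wt_def\<close>)
    \<comment> \<open>The closed loop: the flipped pair contributes \<open>qq\<close>, and the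
      unflipped one contributes 1 times the \<open>inverse qq\<close> of the contraction.\<close>
    show "Wt s M (t(a := cls, a + 1 := opn)) + inverse qq * Wt s M (t(a := opn, a + 1 := cls))
        = (qq + inverse qq) * Wt ?s M0 t"
      unfolding 1 2 by (simp add: algebra_simps)
  qed (use s in auto)
  ultimately show ?thesis by blast
qed

lemma not_in_verts:
  assumes "\<And>b. (b, a) \<notin> M" "\<And>b. (a, b) \<notin> M"
  shows "a \<notin> verts M"
  using assms by (auto simp: verts_def)

text \<open>The contraction joins the strands that end at \<open>a\<close> and \<open>a + 1\<close>.
  If both vertices are paired, their partners become a pair; if only one is, its partner becomes
  unpaired and keeps its label; if neither is, both labels are fixed and only the first term of the
  contraction survives.\<close>

lemma gop_Wt_cap:
  assumes M: "cupd s M" and s: "s a = cls" "s (a + 1) = opn"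
  shows "\<exists>s' M'. cupd s' M' \<and> (\<forall>t. gop u a (Wt s M) t = Wt s' M' t)"
proof -
  let ?s = "s(a := (u, u), a + 1 := (\<not> u, \<not> u))"
  have nO: "?s x = opn \<longleftrightarrow> s x = opn \<and> x \<noteq> a + 1" "?s x = cls \<longleftrightarrow> s x = cls \<and> x \<noteq> a" for x
    using s by (cases u; auto)+
  have far: "x < a" if "s x = opn" "x \<noteq> a + 1" "x < a + 1" for x
    using that s by (cases "x = a") auto
  have far': "a + 1 < x" if "s x = cls" "x \<noteq> a" "a < x" for x
    using that s by (cases "x = a + 1") auto
  have nv1: "a \<notin> verts M" if "\<And>b. (b, a) \<notin> M"
    using that cupdD(3) [OF M, of a] s by (intro not_in_verts) auto
  have nv2: "a + 1 \<notin> verts M" if "\<And>d. (a + 1, d) \<notin> M"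
    using that cupdD(4) [OF M, of _ "a + 1"] s by (intro not_in_verts) auto
  consider (both) b d where "(b, a) \<in> M" "(a + 1, d) \<in> M"
    | (left) b where "(b, a) \<in> M" "\<And>d. (a + 1, d) \<notin> M"
    | (right) d where "\<And>b. (b, a) \<notin> M" "(a + 1, d) \<in> M"
    | (none) "\<And>b. (b, a) \<notin> M" "\<And>d. (a + 1, d) \<notin> M" by blast
  then show ?thesis
  proof cases
    case both
    have lt: "b < a" "a + 1 < d" using cupdD(2) [OF M] both by blast+
    have sd: "s b = opn" "s d = cls" using cupdD(3,4) [OF M] both by blast+
    have "b \<noteq> a + 1" using lt by simp
    then obtain M0 where M0: "M = insert (b, a) (insert (a + 1, d) M0)" "finite M0"
      "b \<notin> verts M0" "a \<notin> verts M0" "a + 1 \<notin> verts M0" "d \<notin> verts M0"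
      using cupd_remove2 [OF M both] by metis
    note pair = cupd_pair [OF M, unfolded M0(1) rpair_insert lpair_insert]
    let ?M = "insert (b, d) M0"
    have "cupd ?s ?M"
    proof (rule cupd_insI [OF M])
      fix x y assume xy: "x < y" "?s x = opn" "?s y = cls" and n: "x = b \<longrightarrow> y \<noteq> d"
      have xs: "s x = opn" "s y = cls" "x \<noteq> a + 1" "y \<noteq> a" using xy unfolding nO by auto
      \<comment> \<open>Stability may have rested on a removed pair. If this was
        \<open>(b, a)\<close>, so that \<open>x = b\<close>, comparing the opening bracket
        \<open>a + 1\<close> with \<open>y\<close> yields a new witness; if it was
        \<open>(a + 1, d)\<close>, so that \<open>y = d\<close>, compare \<open>x\<close> with the
        closing bracket \<open>a\<close>.\<close>
      show "rpair ?M x y \<or> lpair ?M x y"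
        using pair [OF xy(1) xs(1,2)] pair [of "a + 1" y] pair [of x a] xs xy(1) n s lt
          far [of x] far' [of y] rpair_verts [OF M0(5), of y] lpair_verts [OF M0(4), of x]
          lpair_mono [of M0 "a + 1" y x] rpair_mono [of M0 x a y]
        unfolding rpair_insert lpair_insert by (cases "y < a"; cases "a + 1 < x"; force)
    qed (use M0 lt sd in \<open>auto simp: nO\<close>)
    moreover have "gop u a (Wt s M) t = 1 * Wt ?s ?M t" for t
    proof (rule gop_WtI [OF M])
      show nv: "a \<notin> verts ?M" "a + 1 \<notin> verts ?M" using M0 lt by auto
      fix t :: diag assume t: "t a = (u, u)" "t (a + 1) = (\<not> u, \<not> u)"
      let ?R = "Wt (?s(b := t b, d := t d)) M0 t"
      have 1: "Wt s M (t(a := cls, a + 1 := opn)) = wt (t b) cls * (wt opn (t d) * ?R)"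
        unfolding M0(1) using M0 lt
        by (simp add: Wt_insert) (intro disjI2 Wt_cong; use M0 t lt in auto)
      have 2: "Wt s M (t(a := opn, a + 1 := cls)) = wt (t b) opn * (wt cls (t d) * ?R)"
        unfolding M0(1) using M0 lt
        by (simp add: Wt_insert) (intro disjI2 Wt_cong; use M0 t lt in auto)
      have 3: "Wt ?s ?M t = wt (t b) (t d) * ?R"
        using M0 by (simp add: Wt_insert)
      \<comment> \<open>Only two cases are nonzero: \<open>(opn, cls)\<close> at
        \<open>(b, d)\<close> gets 1 from the first term, and \<open>(cls, opn)\<close> gets two
        factors \<open>qq\<close> and one \<open>inverse qq\<close> from the second.\<close>
      show "Wt s M (t(a := cls, a + 1 := opn)) + inverse qq * Wt s M (t(a := opn, a + 1 := cls))
          = 1 * Wt ?s ?M t"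
        unfolding 1 2 3 by (auto simp: wt_def)
    qed (use s in auto)
    ultimately show ?thesis by auto
  next
    case left
    have lt: "b < a" and sb: "s b = opn" using cupdD(2,3) [OF M left(1)] by blast+
    obtain M0 where M0: "M = insert (b, a) M0" "finite M0" "b \<notin> verts M0" "a \<notin> verts M0"
      using cupd_remove [OF M left(1)] by metis
    have nv: "a + 1 \<notin> verts M" using nv2 left by blast
    then have nv0: "a + 1 \<notin> verts M0" "b \<noteq> a + 1" using M0(1) by auto
    note pair = cupd_pair [OF M, unfolded M0(1) rpair_insert lpair_insert]
    have "cupd ?s M0"
    proof (rule cupd_subI [OF M])
      fix x y assume xy: "x < y" "?s x = opn" "?s y = cls"
      have xs: "s x = opn" "s y = cls" "x \<noteq> a + 1" "y \<noteq> a" using xy unfolding nO by auto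
      show "rpair M0 x y \<or> lpair M0 x y"
        using pair [OF xy(1) xs(1,2)] pair [of "a + 1" y] xs xy(1) s lt
          far' [of y] rpair_verts [OF nv0(1), of y]
          lpair_mono [of M0 "a + 1" y x] by (cases "y < a"; force)
    qed (use M0 nv0 in auto)
    moreover have "gop u a (Wt s M) t = 1 * Wt ?s M0 t" for t
    proof (rule gop_WtI [OF M _ _ M0(4) nv0(1)])
      fix t :: diag assume t: "t a = (u, u)" "t (a + 1) = (\<not> u, \<not> u)"
      have 1: "Wt s M (t(a := cls, a + 1 := opn)) = Wt ?s M0 t"
      proof (cases "t b = opn")
        case True
        then show ?thesis unfolding M0(1) using M0 lt nv0
          by (simp add: Wt_insert wt_def) (intro Wt_cong; use M0 nv0 t s sb True in auto)
      next
        case False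
        then show ?thesis
          using lt nv0 M0(2-4) Wt_zero [OF M0(3), of t ?s] sb by (simp add: M0(1) Wt_insert wt_def)
      qed
      have 2: "Wt s M (t(a := opn, a + 1 := cls)) = 0"
        using nv s by (intro Wt_zero [of "a + 1"]) auto
      show "Wt s M (t(a := cls, a + 1 := opn)) + inverse qq * Wt s M (t(a := opn, a + 1 := cls))
          = 1 * Wt ?s M0 t"
        unfolding 1 2 by simp
    qed (use s in auto)
    ultimately show ?thesis by auto
  next
    case right
    have lt: "a + 1 < d" and sd: "s d = cls" using cupdD(2,4) [OF M right(2)] by blast+
    obtain M0 where M0: "M = insert (a + 1, d) M0" "finite M0" "a + 1 \<notin> verts M0" "d \<notin> verts M0"
      using cupd_remove [OF M right(2)] by metis
    have nv: "a \<notin> verts M" using nv1 right by blast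
    then have nv0: "a \<notin> verts M0" "d \<noteq> a" using M0(1) by auto
    note pair = cupd_pair [OF M, unfolded M0(1) rpair_insert lpair_insert]
    have "cupd ?s M0"
    proof (rule cupd_subI [OF M])
      fix x y assume xy: "x < y" "?s x = opn" "?s y = cls"
      have xs: "s x = opn" "s y = cls" "x \<noteq> a + 1" "y \<noteq> a" using xy unfolding nO by auto
      show "rpair M0 x y \<or> lpair M0 x y"
        using pair [OF xy(1) xs(1,2)] pair [of x a] xs xy(1) s lt
          far [of x] lpair_verts [OF nv0(1), of x]
          rpair_mono [of M0 x a y] by (cases "a + 1 < x"; force)
    qed (use M0 nv0 in auto)
    moreover have "gop u a (Wt s M) t = 1 * Wt ?s M0 t" for t
    proof (rule gop_WtI [OF M _ _ nv0(1) M0(3)])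
      fix t :: diag assume t: "t a = (u, u)" "t (a + 1) = (\<not> u, \<not> u)"
      have 1: "Wt s M (t(a := cls, a + 1 := opn)) = Wt ?s M0 t"
      proof (cases "t d = cls")
        case True
        then show ?thesis unfolding M0(1) using M0 lt nv0
          by (simp add: Wt_insert wt_def) (intro Wt_cong; use M0 nv0 t s sd lt True in auto)
      next
        case False
        then show ?thesis
          using lt nv0 M0(2-4) Wt_zero [OF M0(4), of t ?s] sd by (simp add: M0(1) Wt_insert wt_def)
      qed
      have 2: "Wt s M (t(a := opn, a + 1 := cls)) = 0"
        using nv s by (intro Wt_zero [of "a"]) auto
      show "Wt s M (t(a := cls, a + 1 := opn)) + inverse qq * Wt s M (t(a := opn, a + 1 := cls))
          = 1 * Wt ?s M0 t"
        unfolding 1 2 by simp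
    qed (use s in auto)
    ultimately show ?thesis by auto
  next
    case none
    have nv: "a \<notin> verts M" "a + 1 \<notin> verts M" using nv1 nv2 none by blast+
    have "cupd ?s M"
    proof (rule cupd_subI [OF M])
      fix x y assume xy: "x < y" "?s x = opn" "?s y = cls"
      then show "rpair M x y \<or> lpair M x y"
        using cupd_pair [OF M, of x y] unfolding nO by blast
    qed (use nv in auto)
    moreover have "gop u a (Wt s M) t = 1 * Wt ?s M t" for t
    proof (rule gop_WtI [OF M _ _ nv])
      fix t :: diag assume t: "t a = (u, u)" "t (a + 1) = (\<not> u, \<not> u)"
      have 1: "Wt s M (t(a := cls, a + 1 := opn)) = Wt ?s M t"
        by (intro Wt_cong; use nv t s in auto)
      have 2: "Wt s M (t(a := opn, a + 1 := cls)) = 0"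
        using nv s by (intro Wt_zero [of "a"]) auto
      show "Wt s M (t(a := cls, a + 1 := opn)) + inverse qq * Wt s M (t(a := opn, a + 1 := cls))
          = 1 * Wt ?s M t"
        unfolding 1 2 by simp
    qed (use s in auto)
    ultimately show ?thesis by auto
  qed
qed

text \<open>The closing bracket \<open>a\<close> prefers \<open>b'\<close> to its partner
  \<open>b\<close>, so by stability \<open>b'\<close> must already have a partner at or before
  \<open>a\<close>.\<close>

lemma cupd_noncrossing:
  assumes M: "cupd s M" and "(b, a) \<in> M" "(b', a') \<in> M" "b < b'" "b' < a"
  shows "a' < a"
proof -
  have "s b' = opn" "s a = cls" using cupdD(3,4) [OF M] assms by blast+
  from cupd_pair [OF M \<open>b' < a\<close> this] have "a' \<le> a"
    unfolding rpair_def lpair_def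
    using cupdD(5,6) [OF M] assms by (metis linorder_not_less)
  moreover have "a' \<noteq> a" using cupdD(6) [OF M] assms by blast
  ultimately show ?thesis by simp
qed

text \<open>The strands leaving \<open>a\<close> and \<open>a + 1\<close> both go right and are
  nested, so contraction straightens them: the nearer end \<open>c\<close> turns into an opening
  bracket, paired with \<open>d\<close> if \<open>a\<close> was paired with \<open>d\<close> and
  unpaired otherwise. If both vertices are unpaired, both labels are rigidly \<open>opn\<close>,
  whereas a contraction needs opposite brackets.\<close>

lemma gop_Wt_opn_opn:
  assumes M: "cupd s M" and s: "s a = opn" "s (a + 1) = opn"
  shows "(\<forall>t. gop u a (Wt s M) t = 0) \<or>
    (\<exists>s' M'. cupd s' M' \<and> (\<forall>t. gop u a (Wt s M) t = Wt s' M' t))"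
proof -
  have n1: "a \<notin> verts M" if "\<And>d. (a, d) \<notin> M"
    using that cupdD(4) [OF M, of _ a] s by (intro not_in_verts) auto
  have n2: "a + 1 \<notin> verts M" if "\<And>d. (a + 1, d) \<notin> M"
    using that cupdD(4) [OF M, of _ "a + 1"] s by (intro not_in_verts) auto
  consider (both) d c where "(a, d) \<in> M" "(a + 1, c) \<in> M"
    | (left) d where "(a, d) \<in> M" "\<And>c. (a + 1, c) \<notin> M"
    | (right) c where "\<And>d. (a, d) \<notin> M" "(a + 1, c) \<in> M"
    | (none) "\<And>d. (a, d) \<notin> M" "\<And>c. (a + 1, c) \<notin> M" by blast
  then show ?thesis
  proof cases
    case both
    let ?s = "s(a := (u, u), a + 1 := (\<not> u, \<not> u), c := opn)"
    have lt: "a < d" "a + 1 < c" using cupdD(2) [OF M] both by blast+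
    have sd: "s d = cls" "s c = cls" using cupdD(4) [OF M] both by blast+
    then have "d \<noteq> a + 1" using s by auto
    then have cd: "c < d" using cupd_noncrossing [OF M both] lt by simp
    obtain M0 where M0: "M = insert (a, d) (insert (a + 1, c) M0)" "finite M0"
      "a \<notin> verts M0" "d \<notin> verts M0" "a + 1 \<notin> verts M0" "c \<notin> verts M0"
      using cupd_remove2 [OF M both] by auto
    note pair = cupd_pair [OF M, unfolded M0(1) rpair_insert lpair_insert]
    have nO: "?s x = opn \<longleftrightarrow> s x = opn \<and> x \<noteq> a \<and> x \<noteq> a + 1 \<or> x = c"
      "?s x = cls \<longleftrightarrow> s x = cls \<and> x \<noteq> c" for x
      using s lt by (cases u; auto)+
    let ?M = "insert (c, d) M0"
    have "cupd ?s ?M"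
    proof (rule cupd_insI [OF M])
      fix x y assume xy: "x < y" "?s x = opn" "?s y = cls" and n: "x = c \<longrightarrow> y \<noteq> d"
      have y: "s y = cls" "y \<noteq> c" using xy unfolding nO by auto
      show "rpair ?M x y \<or> lpair ?M x y"
      proof (cases "x = c")
        case True
        \<comment> \<open>For the new opening bracket \<open>c\<close>, stability is borrowed from
          the old one at \<open>a\<close>. A partner of \<open>y\<close> strictly between
          \<open>a + 1\<close> and \<open>c\<close> would, by nesting, force \<open>y\<close> to lie
          before \<open>c\<close>.\<close>
        have "lpair M0 c y" if "lpair M0 a y"
        proof -
          obtain z where z: "z \<ge> a" "(z, y) \<in> M0" using \<open>lpair M0 a y\<close> by (auto simp: lpair_def)
          then have "z \<noteq> a" "z \<noteq> a + 1" using verts_mem(1) M0 by metis+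
          moreover have "(z, y) \<in> M" using z M0(1) by simp
          ultimately have "c \<le> z"
            using cupd_noncrossing [OF M both(2), of z y] z(1) True xy(1) by linarith
          then show ?thesis using z(2) by (auto simp: lpair_def)
        qed
        then show ?thesis
          using pair [OF _ s(1) y(1)] xy(1) True y n lt rpair_verts [OF M0(3), of y]
          unfolding rpair_insert lpair_insert by auto
      next
        case False
        then have "s x = opn" "x \<noteq> a" "x \<noteq> a + 1" using xy(2) unfolding nO by auto
        then show ?thesis
          using pair [OF xy(1) _ y(1)] y lt unfolding rpair_insert lpair_insert by auto
      qed
    qed (use M0 lt sd cd s in \<open>auto simp: nO\<close>)
    moreover have "gop u a (Wt s M) t = 1 * Wt ?s ?M t" for t
    proof (rule gop_WtI [OF M])
      show nv: "a \<notin> verts ?M" "a + 1 \<notin> verts ?M" using M0 lt cd by auto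
      fix t :: diag assume t: "t a = (u, u)" "t (a + 1) = (\<not> u, \<not> u)"
      let ?R = "Wt (?s(c := t c, d := t d)) M0 t"
      have 1: "Wt s M (t(a := cls, a + 1 := opn)) = wt cls (t d) * (wt opn (t c) * ?R)"
        unfolding M0(1) using M0 lt cd
        by (simp add: Wt_insert) (intro disjI2 Wt_cong; use M0 t lt cd in auto)
      have 2: "Wt s M (t(a := opn, a + 1 := cls)) = wt opn (t d) * (wt cls (t c) * ?R)"
        unfolding M0(1) using M0 lt cd
        by (simp add: Wt_insert) (intro disjI2 Wt_cong; use M0 t lt cd in auto)
      have 3: "Wt ?s ?M t = wt (t c) (t d) * ?R"
        using M0 by (simp add: Wt_insert)
      show "Wt s M (t(a := cls, a + 1 := opn)) + inverse qq * Wt s M (t(a := opn, a + 1 := cls))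
          = 1 * Wt ?s ?M t"
        unfolding 1 2 3 by (auto simp: wt_def)
    qed (use s lt in auto)
    ultimately show ?thesis by auto
  next
    case right
    let ?s = "s(a := (u, u), a + 1 := (\<not> u, \<not> u), c := opn)"
    have lt: "a + 1 < c" using cupdD(2) [OF M] right by blast+
    have sc: "s c = cls" using cupdD(4) [OF M] right by blast
    obtain M0 where M0: "M = insert (a + 1, c) M0" "finite M0" "a + 1 \<notin> verts M0" "c \<notin> verts M0"
      using cupd_remove [OF M right(2)] by metis
    have nv: "a \<notin> verts M" using n1 right by blast
    then have nv0: "a \<notin> verts M0" using M0(1) by auto
    note pair = cupd_pair [OF M, unfolded M0(1) rpair_insert lpair_insert]
    have nO: "?s x = opn \<longleftrightarrow> s x = opn \<and> x \<noteq> a \<and> x \<noteq> a + 1 \<or> x = c"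
      "?s x = cls \<longleftrightarrow> s x = cls \<and> x \<noteq> c" for x
      using s lt by (cases u; auto)+
    have "cupd ?s M0"
    proof (rule cupd_subI [OF M])
      fix x y assume xy: "x < y" "?s x = opn" "?s y = cls"
      have y: "s y = cls" "y \<noteq> c" using xy unfolding nO by auto
      show "rpair M0 x y \<or> lpair M0 x y"
      proof (cases "x = c")
        case True
        have "lpair M0 c y" if "lpair M0 a y"
        proof -
          obtain z where z: "z \<ge> a" "(z, y) \<in> M0" using \<open>lpair M0 a y\<close> by (auto simp: lpair_def)
          then have "z \<noteq> a" "z \<noteq> a + 1" using verts_mem(1) M0 nv0 by metis+
          moreover have "(z, y) \<in> M" using z M0(1) by simp
          ultimately have "c \<le> z"
            using cupd_noncrossing [OF M right(2), of z y] z(1) True xy(1) by linarith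
          then show ?thesis using z(2) by (auto simp: lpair_def)
        qed
        then show ?thesis
          using pair [OF _ s(1) y(1)] xy(1) True y lt rpair_verts [OF nv0, of y] by auto
      next
        case False
        then have "s x = opn" "x \<noteq> a" "x \<noteq> a + 1" using xy(2) unfolding nO by auto
        then show ?thesis
          using pair [OF xy(1) _ y(1)] y lt by auto
      qed
    qed (use M0 nv0 in auto)
    moreover have "gop u a (Wt s M) t = 1 * Wt ?s M0 t" for t
    proof (rule gop_WtI [OF M _ _ nv0 M0(3)])
      fix t :: diag assume t: "t a = (u, u)" "t (a + 1) = (\<not> u, \<not> u)"
      \<comment> \<open>The vertex \<open>a\<close> is unpaired and must read \<open>opn\<close>, so
        \<open>a + 1\<close> reads \<open>cls\<close>. Its pair is therefore flipped, and the
        resulting \<open>qq\<close> cancels the \<open>inverse qq\<close> of the contraction;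
        \<open>c\<close> is left reading \<open>opn\<close>.\<close>
      have 1: "Wt s M (t(a := opn, a + 1 := cls)) = qq * Wt ?s M0 t"
      proof (cases "t c = opn")
        case True
        then show ?thesis unfolding M0(1) using M0 lt nv0
          by (simp add: Wt_insert wt_def) (intro Wt_cong; use M0 nv0 t s lt True in auto)
      next
        case False
        then show ?thesis
          using lt nv0 M0(2-4) Wt_zero [OF M0(4), of t ?s] by (simp add: M0(1) Wt_insert wt_def)
      qed
      have 2: "Wt s M (t(a := cls, a + 1 := opn)) = 0"
        using nv s by (intro Wt_zero [of "a"]) auto
      show "Wt s M (t(a := cls, a + 1 := opn)) + inverse qq * Wt s M (t(a := opn, a + 1 := cls))
          = 1 * Wt ?s M0 t"
        unfolding 1 2 by simp
    qed (use s lt in auto)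
    ultimately show ?thesis by auto
  next
    case left
    have lt: "a < d" and sd: "s d = cls" using cupdD(2,4) [OF M left(1)] by blast+
    \<comment> \<open>This case cannot occur: the opening bracket \<open>a + 1\<close> lies under
      the pair \<open>(a, d)\<close> and prefers \<open>d\<close> to having no partner, and
      \<open>d\<close> prefers it to \<open>a\<close>.\<close>
    have "rpair M (a + 1) d \<or> lpair M (a + 1) d"
      using s sd lt by (intro cupd_pair [OF M]) (cases "d = a + 1"; auto)+
    then show ?thesis
      using left cupdD(6) [OF M left(1)] unfolding rpair_def lpair_def
      by (metis zle_add1_eq_le order_less_irrefl)
  next
    case none
    have nv: "a \<notin> verts M" "a + 1 \<notin> verts M" using n1 n2 none by blast+
    have "gop u a (Wt s M) t = 0 * Wt (s(a := (u, u), a + 1 := (\<not> u, \<not> u))) {} t" for t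
    proof (rule gop_WtI [OF M])
      fix t
      show "Wt s M (t(a := cls, a + 1 := opn)) + inverse qq * Wt s M (t(a := opn, a + 1 := cls))
         = 0 * Wt (s(a := (u, u), a + 1 := (\<not> u, \<not> u))) {} t"
        using Wt_zero [OF nv(1), of "t(a := cls, a + 1 := opn)" s]
          Wt_zero [OF nv(2), of "t(a := opn, a + 1 := cls)" s] s by simp
    qed (use s in auto)
    then show ?thesis by simp
  qed
qed

text \<open>The mirror image of the case of two opening brackets: the partner \<open>b\<close> of
  \<open>a\<close> turns into a closing bracket, paired with the partner \<open>c\<close> of
  \<open>a + 1\<close> when there is one.\<close>

lemma gop_Wt_cls_cls:
  assumes M: "cupd s M" and s: "s a = cls" "s (a + 1) = cls"
  shows "(\<forall>t. gop u a (Wt s M) t = 0) \<or>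
    (\<exists>s' M'. cupd s' M' \<and> (\<forall>t. gop u a (Wt s M) t = Wt s' M' t))"
proof -
  have n1: "a \<notin> verts M" if "\<And>b. (b, a) \<notin> M"
    using that cupdD(3) [OF M, of a] s by (intro not_in_verts) auto
  have n2: "a + 1 \<notin> verts M" if "\<And>b. (b, a + 1) \<notin> M"
    using that cupdD(3) [OF M, of "a + 1"] s by (intro not_in_verts) auto
  consider (both) b c where "(b, a) \<in> M" "(c, a + 1) \<in> M"
    | (left) b where "(b, a) \<in> M" "\<And>c. (c, a + 1) \<notin> M"
    | (right) c where "\<And>b. (b, a) \<notin> M" "(c, a + 1) \<in> M"
    | (none) "\<And>b. (b, a) \<notin> M" "\<And>c. (c, a + 1) \<notin> M" by blast
  then show ?thesis
  proof cases
    case both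
    let ?s = "s(a := (u, u), a + 1 := (\<not> u, \<not> u), b := cls)"
    have lt: "b < a" "c < a + 1" using cupdD(2) [OF M] both by blast+
    have sb: "s b = opn" "s c = opn" using cupdD(3) [OF M] both by blast+
    then have ca: "c \<noteq> a" using s by auto
    have bc: "b \<noteq> c" using cupdD(5) [OF M both(1), of "a + 1"] both(2) by auto
    have cb: "c < b"
      using cupd_noncrossing [OF M both] lt ca bc by linarith
    obtain M0 where M0: "M = insert (b, a) (insert (c, a + 1) M0)" "finite M0"
      "b \<notin> verts M0" "a \<notin> verts M0" "c \<notin> verts M0" "a + 1 \<notin> verts M0"
      using cupd_remove2 [OF M both bc] by metis
    note pair = cupd_pair [OF M, unfolded M0(1) rpair_insert lpair_insert]
    have nO: "?s x = cls \<longleftrightarrow> s x = cls \<and> x \<noteq> a \<and> x \<noteq> a + 1 \<or> x = b"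
      "?s x = opn \<longleftrightarrow> s x = opn \<and> x \<noteq> b" for x
      using s lt by (cases u; auto)+
    let ?M = "insert (c, b) M0"
    have "cupd ?s ?M"
    proof (rule cupd_insI [OF M])
      fix x y assume xy: "x < y" "?s x = opn" "?s y = cls" and n: "x = c \<longrightarrow> y \<noteq> b"
      have x: "s x = opn" "x \<noteq> b" using xy unfolding nO by auto
      show "rpair ?M x y \<or> lpair ?M x y"
      proof (cases "y = b")
        case True
        have "rpair M0 x b" if "rpair M0 x (a + 1)"
        proof -
          obtain z where z: "z \<le> a + 1" "(x, z) \<in> M0" using \<open>rpair M0 x (a + 1)\<close> by (auto simp: rpair_def)
          then have "z \<noteq> a" "z \<noteq> a + 1" using verts_mem(2) M0 by metis+
          moreover have "(x, z) \<in> M" using z M0(1) by simp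
          ultimately have "z \<le> b"
            using cupd_noncrossing [OF M _ both(1), of x z] z(1) True xy(1) by linarith
          then show ?thesis using z(2) by (auto simp: rpair_def)
        qed
        then show ?thesis
          using pair [OF _ x(1) s(2)] xy(1) True x n lt lpair_verts [OF M0(6), of x]
          unfolding rpair_insert lpair_insert by auto
      next
        case False
        then have "s y = cls" "y \<noteq> a" "y \<noteq> a + 1" using xy(3) unfolding nO by auto
        then show ?thesis
          using pair [OF xy(1) x(1)] x lt unfolding rpair_insert lpair_insert by auto
      qed
    qed (use M0 lt sb cb s in \<open>auto simp: nO\<close>)
    moreover have "gop u a (Wt s M) t = 1 * Wt ?s ?M t" for t
    proof (rule gop_WtI [OF M])
      show nv: "a \<notin> verts ?M" "a + 1 \<notin> verts ?M" using M0 lt cb by auto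
      fix t :: diag assume t: "t a = (u, u)" "t (a + 1) = (\<not> u, \<not> u)"
      let ?R = "Wt (?s(c := t c, b := t b)) M0 t"
      have 1: "Wt s M (t(a := cls, a + 1 := opn)) = wt (t b) cls * (wt (t c) opn * ?R)"
        unfolding M0(1) using M0 lt cb
        by (simp add: Wt_insert) (intro disjI2 Wt_cong; use M0 t lt cb in auto)
      have 2: "Wt s M (t(a := opn, a + 1 := cls)) = wt (t b) opn * (wt (t c) cls * ?R)"
        unfolding M0(1) using M0 lt cb
        by (simp add: Wt_insert) (intro disjI2 Wt_cong; use M0 t lt cb in auto)
      have 3: "Wt ?s ?M t = wt (t c) (t b) * ?R"
        using M0 by (simp add: Wt_insert)
      show "Wt s M (t(a := cls, a + 1 := opn)) + inverse qq * Wt s M (t(a := opn, a + 1 := cls))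
          = 1 * Wt ?s ?M t"
        unfolding 1 2 3 by (auto simp: wt_def)
    qed (use s lt in auto)
    ultimately show ?thesis by auto
  next
    case left
    let ?s = "s(a := (u, u), a + 1 := (\<not> u, \<not> u), b := cls)"
    have lt: "b < a" using cupdD(2) [OF M] left by blast+
    have sb: "s b = opn" using cupdD(3) [OF M] left by blast
    obtain M0 where M0: "M = insert (b, a) M0" "finite M0" "b \<notin> verts M0" "a \<notin> verts M0"
      using cupd_remove [OF M left(1)] by metis
    have nv: "a + 1 \<notin> verts M" using n2 left by blast
    then have nv0: "a + 1 \<notin> verts M0" using M0(1) by auto
    note pair = cupd_pair [OF M, unfolded M0(1) rpair_insert lpair_insert]
    have nO: "?s x = cls \<longleftrightarrow> s x = cls \<and> x \<noteq> a \<and> x \<noteq> a + 1 \<or> x = b"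
      "?s x = opn \<longleftrightarrow> s x = opn \<and> x \<noteq> b" for x
      using s lt by (cases u; auto)+
    have "cupd ?s M0"
    proof (rule cupd_subI [OF M])
      fix x y assume xy: "x < y" "?s x = opn" "?s y = cls"
      have x: "s x = opn" "x \<noteq> b" using xy unfolding nO by auto
      show "rpair M0 x y \<or> lpair M0 x y"
      proof (cases "y = b")
        case True
        have "rpair M0 x b" if "rpair M0 x (a + 1)"
        proof -
          obtain z where z: "z \<le> a + 1" "(x, z) \<in> M0" using \<open>rpair M0 x (a + 1)\<close> by (auto simp: rpair_def)
          then have "z \<noteq> a" "z \<noteq> a + 1" using verts_mem(2) M0 nv0 by metis+
          moreover have "(x, z) \<in> M" using z M0(1) by simp
          ultimately have "z \<le> b"
            using cupd_noncrossing [OF M _ left(1), of x z] z(1) True xy(1) by linarith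
          then show ?thesis using z(2) by (auto simp: rpair_def)
        qed
        then show ?thesis
          using pair [OF _ x(1) s(2)] xy(1) True x lt lpair_verts [OF nv0, of x] by auto
      next
        case False
        then have "s y = cls" "y \<noteq> a" "y \<noteq> a + 1" using xy(3) unfolding nO by auto
        then show ?thesis
          using pair [OF xy(1) x(1)] x lt by auto
      qed
    qed (use M0 nv0 in auto)
    moreover have "gop u a (Wt s M) t = 1 * Wt ?s M0 t" for t
    proof (rule gop_WtI [OF M _ _ M0(4) nv0])
      fix t :: diag assume t: "t a = (u, u)" "t (a + 1) = (\<not> u, \<not> u)"
      have 1: "Wt s M (t(a := opn, a + 1 := cls)) = qq * Wt ?s M0 t"
      proof (cases "t b = cls")
        case True
        then show ?thesis unfolding M0(1) using M0 lt nv0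
          by (simp add: Wt_insert wt_def) (intro Wt_cong; use M0 nv0 t s lt True in auto)
      next
        case False
        then show ?thesis
          using lt nv0 M0(2-4) Wt_zero [OF M0(3), of t ?s] by (simp add: M0(1) Wt_insert wt_def)
      qed
      have 2: "Wt s M (t(a := cls, a + 1 := opn)) = 0"
        using nv s by (intro Wt_zero [of "a + 1"]) auto
      show "Wt s M (t(a := cls, a + 1 := opn)) + inverse qq * Wt s M (t(a := opn, a + 1 := cls))
          = 1 * Wt ?s M0 t"
        unfolding 1 2 by simp
    qed (use s lt in auto)
    ultimately show ?thesis by auto
  next
    case right
    have lt: "c < a + 1" and sc: "s c = opn" using cupdD(2,3) [OF M right(2)] by blast+
    have "rpair M c a \<or> lpair M c a"
      using s sc lt by (intro cupd_pair [OF M]) (cases "c = a"; auto)+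
    then show ?thesis
      using right cupdD(5) [OF M right(2)] unfolding rpair_def lpair_def
      by (metis zle_add1_eq_le order_less_irrefl zless_add1_eq)
  next
    case none
    have nv: "a \<notin> verts M" "a + 1 \<notin> verts M" using n1 n2 none by blast+
    have "gop u a (Wt s M) t = 0 * Wt (s(a := (u, u), a + 1 := (\<not> u, \<not> u))) {} t" for t
    proof (rule gop_WtI [OF M])
      fix t
      show "Wt s M (t(a := cls, a + 1 := opn)) + inverse qq * Wt s M (t(a := opn, a + 1 := cls))
         = 0 * Wt (s(a := (u, u), a + 1 := (\<not> u, \<not> u))) {} t"
        using Wt_zero [OF nv(2), of "t(a := cls, a + 1 := opn)" s]
          Wt_zero [OF nv(1), of "t(a := opn, a + 1 := cls)" s] s by simp
    qed (use s in auto)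
    then show ?thesis by simp
  qed
qed

text \<open>Seven label patterns exhaust all possibilities at \<open>a\<close> and
  \<open>a + 1\<close>. The point is that each admissible scalar is bar invariant. For
  \<open>c = 0\<close> the diagram is a mere placeholder.\<close>

lemma gop_Wt:
  assumes M: "cupd s M"
  obtains s' M' c where "cupd s' M'" "c = 0 \<or> c = 1 \<or> c = qq + inverse qq"
    "\<And>t. gop u a (Wt s M) t = c * Wt s' M' t"
proof -
  have "\<exists>s' M' c. cupd s' M' \<and> (c = 0 \<or> c = 1 \<or> c = qq + inverse qq) \<and>
    (\<forall>t. gop u a (Wt s M) t = c * Wt s' M' t)" (is "?P")
  proof -
    have z: ?P if "\<forall>t. gop u a (Wt s M) t = 0"
      using that M by (intro exI [of _ s] exI [of _ M] exI [of _ 0]) simp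
    have o: ?P if "\<exists>s' M'. cupd s' M' \<and> (\<forall>t. gop u a (Wt s M) t = Wt s' M' t)"
    proof -
      obtain s' M' where *: "cupd s' M'" "\<forall>t. gop u a (Wt s M) t = Wt s' M' t"
        using \<open>\<exists>s' M'. _ s' M'\<close> by blast
      then show ?thesis by (intro exI [of _ s'] exI [of _ M'] exI [of _ 1]) simp
    qed
    let ?oc = "\<lambda>p. p = opn \<or> p = cls"
    have val: "p = (u, u) \<or> p = (\<not> u, \<not> u) \<or> ?oc p" for p :: "bool \<times> bool"
      by (cases p; cases u; auto)
    consider "s a = (u, u) \<or> s (a + 1) = (\<not> u, \<not> u)"
      | "?oc (s a) \<and> s (a + 1) = (u, u) \<or> s a = (\<not> u, \<not> u) \<and> ?oc (s (a + 1))"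
      | "s a = (\<not> u, \<not> u)" "s (a + 1) = (u, u)"
      | "s a = opn" "s (a + 1) = cls" | "s a = cls" "s (a + 1) = opn"
      | "s a = opn" "s (a + 1) = opn" | "s a = cls" "s (a + 1) = cls"
      using val [of "s a"] val [of "s (a + 1)"] by blast
    then show ?P
    proof cases
      case 1
      then show ?thesis using gop_Wt_zero [OF M] z by blast
    next
      case 2
      then have "\<not> (?oc (s a) \<and> ?oc (s (a + 1)))" by (cases u; auto)
      then show ?thesis using gop_Wt_shft [OF M 2] cupd_shft [OF M] by (intro o) blast
    next
      case 3
      then have "\<not> ?oc (s a)" "\<not> ?oc (s (a + 1))" by (cases u; auto)+
      then show ?thesis using gop_Wt_new [OF M 3] cupd_new [OF M] by (intro o) blast
    next
      case 4
      show ?thesis using gop_Wt_cup [OF M 4] by blast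
    next
      case 5
      show ?thesis using gop_Wt_cap [OF M 5] o by blast
    next
      case 6
      show ?thesis using gop_Wt_opn_opn [OF M 6] o z by blast
    next
      case 7
      show ?thesis using gop_Wt_cls_cls [OF M 7] o z by blast
    qed
  qed
  then show ?thesis using that by blast
qed

section \<open>Monotone labellings and the Bruhat ordering\<close>

definition st :: "nat \<Rightarrow> nat \<Rightarrow> (int \<Rightarrow> int) \<Rightarrow> diag" where
  "st m n f x = (x \<in> f ` negI m, x \<in> f ` posI n)"

lemma finite_index [simp]: "finite (negI m)" "finite (posI n)" "finite (Imn m n)"
  by (simp_all add: negI_def posI_def Imn_def)

lemma index_disjoint: "negI m \<inter> posI n = {}"
  by (auto simp: negI_def posI_def)

lemma index_not_both: "i \<in> negI m \<Longrightarrow> i \<notin> posI n"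
  by (auto simp: negI_def posI_def)

lemma index_less: "i \<in> negI m \<Longrightarrow> j \<in> posI n \<Longrightarrow> i < j"
  by (auto simp: negI_def posI_def)

text \<open>The rank determines the value: the number of image elements above \<open>f i\<close> is
  the number of indices before \<open>i\<close>, and this is the same for both functions.\<close>

lemma strict_antimono_unique:
  fixes f g :: "int \<Rightarrow> int"
  assumes fin: "finite A"
    and f: "\<And>i j. i \<in> A \<Longrightarrow> j \<in> A \<Longrightarrow> i < j \<Longrightarrow> f j < f i"
    and g: "\<And>i j. i \<in> A \<Longrightarrow> j \<in> A \<Longrightarrow> i < j \<Longrightarrow> g j < g i"
    and img: "f ` A = g ` A" and i: "i \<in> A"
  shows "f i = g i"
proof -
  have card: "card {y \<in> h ` A. h i < y} = card {j \<in> A. j < i}"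
    if h: "\<And>i j. i \<in> A \<Longrightarrow> j \<in> A \<Longrightarrow> i < j \<Longrightarrow> h j < h i" for h :: "int \<Rightarrow> int"
  proof -
    have "{y \<in> h ` A. h i < y} = h ` {j \<in> A. j < i}"
    proof (intro equalityI subsetI)
      fix y assume "y \<in> {y \<in> h ` A. h i < y}"
      then obtain j where "j \<in> A" "y = h j" "h i < h j" by auto
      moreover have "j < i"
        using h [OF i \<open>j \<in> A\<close>] \<open>h i < h j\<close> by (cases i j rule: linorder_cases) auto
      ultimately show "y \<in> h ` {j \<in> A. j < i}" by auto
    qed (use h i in auto)
    moreover have "inj_on h {j \<in> A. j < i}"
    proof (rule inj_onI)
      fix j k assume "j \<in> {j \<in> A. j < i}" "k \<in> {j \<in> A. j < i}" "h j = h k"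
      then show "j = k" using h [of j k] h [of k j] by (cases j k rule: linorder_cases) auto
    qed
    ultimately show ?thesis by (simp add: card_image)
  qed
  have lt: "\<not> f' i < g' i" if "card {y \<in> B. f' i < y} = card {y \<in> B. g' i < y}" "g' i \<in> B" "finite B"
    for f' g' :: "int \<Rightarrow> int" and B
  proof
    assume "f' i < g' i"
    then have "{y \<in> B. g' i < y} \<subset> {y \<in> B. f' i < y}" using that(2) by auto
    then have "card {y \<in> B. g' i < y} < card {y \<in> B. f' i < y}"
      using that(3) by (intro psubset_card_mono) auto
    with that(1) show False by simp
  qed
  have "card {y \<in> f ` A. f i < y} = card {y \<in> f ` A. g i < y}"
    using card [of f] card [of g] f g img by simp
  moreover have "g i \<in> f ` A" "f i \<in> f ` A" "finite (f ` A)" using i img fin by auto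
  ultimately show ?thesis using lt [of "f ` A" f g] lt [of "f ` A" g f] by force
qed

lemma ZpD:
  assumes "f \<in> Zp m n"
  shows "x \<notin> Imn m n \<Longrightarrow> f x = 0"
    and "i \<in> negI m \<Longrightarrow> j \<in> negI m \<Longrightarrow> i < j \<Longrightarrow> f j < f i"
    and "i \<in> posI n \<Longrightarrow> j \<in> posI n \<Longrightarrow> i < j \<Longrightarrow> f j < f i"
  using assms by (auto simp: Zp_def Zmn_def)

lemma Zp_inj:
  assumes "f \<in> Zp m n"
  shows "inj_on f (negI m)" "inj_on f (posI n)"
proof -
  show "inj_on f (negI m)"
    by (rule inj_onI, rule ccontr) (metis ZpD(2) [OF assms] linorder_neqE order_less_irrefl)
  show "inj_on f (posI n)"
    by (rule inj_onI, rule ccontr) (metis ZpD(3) [OF assms] linorder_neqE order_less_irrefl)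
qed

lemma Zp_eqI:
  assumes f: "f \<in> Zp m n" and g: "g \<in> Zp m n"
    and "f ` negI m = g ` negI m" "f ` posI n = g ` posI n"
  shows "f = g"
proof
  fix x
  consider "x \<in> negI m" | "x \<in> posI n" | "x \<notin> Imn m n" by (auto simp: Imn_def)
  then show "f x = g x"
  proof cases
    case 1
    show ?thesis
      by (rule strict_antimono_unique [OF finite_index(1) ZpD(2) [OF f] ZpD(2) [OF g] assms(3) 1])
  next
    case 2
    show ?thesis
      by (rule strict_antimono_unique [OF finite_index(2) ZpD(3) [OF f] ZpD(3) [OF g] assms(4) 2])
  qed (simp add: ZpD(1) [OF f] ZpD(1) [OF g])
qed

lemma st_eq_iff: "st m n f = st m n g \<longleftrightarrow> f ` negI m = g ` negI m \<and> f ` posI n = g ` posI n"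
  unfolding st_def fun_eq_iff by auto

lemma st_inj: "f \<in> Zp m n \<Longrightarrow> g \<in> Zp m n \<Longrightarrow> st m n f = st m n g \<Longrightarrow> f = g"
  by (simp add: st_eq_iff Zp_eqI)

section \<open>Statistics that control the Bruhat ordering\<close>

lemma sum_swapv:
  fixes \<phi> :: "int \<Rightarrow> int \<Rightarrow> int"
  assumes "finite I" "i \<in> I" "j \<in> I" "i \<noteq> j"
  shows "(\<Sum>k\<in>I. \<phi> k (swapv f i j k)) =
    (\<Sum>k\<in>I. \<phi> k (f k)) + (\<phi> i (f j) + \<phi> j (f i) - \<phi> i (f i) - \<phi> j (f j))"
proof -
  have I: "I = insert i (insert j (I - {i, j}))" using assms by auto
  have s: "(\<Sum>k\<in>I. h k) = h i + h j + (\<Sum>k\<in>I - {i, j}. h k)" for h :: "int \<Rightarrow> int"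
    using assms by (subst I) simp
  have "(\<Sum>k\<in>I - {i, j}. \<phi> k (swapv f i j k)) = (\<Sum>k\<in>I - {i, j}. \<phi> k (f k))"
    by (intro sum.cong) (auto simp: swapv_def)
  then show ?thesis using assms(4) by (simp add: s swapv_def)
qed

text \<open>A Bruhat step swapping \<open>i < j\<close> raises this sum by
  \<open>(j - i) * (f j - f i) > 0\<close>, which makes the ordering irreflexive.\<close>

definition moment :: "nat \<Rightarrow> nat \<Rightarrow> (int \<Rightarrow> int) \<Rightarrow> int" where
  "moment m n f = (\<Sum>k\<in>Imn m n. - k * f k)"

definition mass :: "nat \<Rightarrow> nat \<Rightarrow> (int \<Rightarrow> int) \<Rightarrow> int" where
  "mass m n f = (\<Sum>k\<in>Imn m n. \<bar>f k\<bar>)"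

text \<open>Bruhat steps can only move larger values to the negative side. Together with the
  invariant multiplicities \<open>occ\<close> this detects minimal labellings.\<close>

definition negsum :: "nat \<Rightarrow> nat \<Rightarrow> (int \<Rightarrow> int) \<Rightarrow> int" where
  "negsum m n f = (\<Sum>k\<in>Imn m n. if k \<in> negI m then f k else 0)"

definition occ :: "nat \<Rightarrow> nat \<Rightarrow> (int \<Rightarrow> int) \<Rightarrow> int \<Rightarrow> int" where
  "occ m n f v = (\<Sum>k\<in>Imn m n. if f k = v then 1 else 0)"

lemma bruhat_step_props:
  assumes "bruhat_step m n f g"
  shows "g \<in> Zmn m n" "moment m n f < moment m n g" "mass m n g = mass m n f"
    "negsum m n f \<le> negsum m n g" "occ m n g v = occ m n f v"
proof -
  obtain i j where ij: "i \<in> Imn m n" "j \<in> Imn m n" "i < j" "f i < f j" and g: "g = swapv f i j"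
    and f: "f \<in> Zmn m n"
    using assms unfolding bruhat_step_def by blast
  note sw = sum_swapv [OF finite_index(3) ij(1,2), where f = f]
  show "g \<in> Zmn m n" using f ij by (auto simp: g Zmn_def swapv_def)
  have "0 < (j - i) * (f j - f i)" using ij by simp
  then show "moment m n f < moment m n g"
    using sw [of "\<lambda>k x. - k * x"] ij(3) by (simp add: moment_def g algebra_simps)
  show "mass m n g = mass m n f"
    using sw [of "\<lambda>k x. \<bar>x\<bar>"] ij(3) by (simp add: mass_def g)
  show "negsum m n f \<le> negsum m n g"
    using sw [of "\<lambda>k x. if k \<in> negI m then x else 0"] ij
    by (auto simp: negsum_def g negI_def Imn_def posI_def)
  show "occ m n g v = occ m n f v"
    using sw [of "\<lambda>k x. if x = v then 1 else 0"] ij(3) by (simp add: occ_def g)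
qed

lemma bruhat_less_props:
  assumes "bruhat_less m n f g"
  shows "moment m n f < moment m n g \<and> mass m n g = mass m n f \<and>
    negsum m n f \<le> negsum m n g \<and> (\<forall>v. occ m n g v = occ m n f v)"
  using assms unfolding bruhat_less_def
proof (induction rule: tranclp_induct)
  case (base g)
  then show ?case using bruhat_step_props [of m n f g] by simp
next
  case (step g h)
  then show ?case using bruhat_step_props [OF step(2)] by fastforce
qed

lemma bruhat_less_trans: "bruhat_less m n f g \<Longrightarrow> bruhat_less m n g h \<Longrightarrow> bruhat_less m n f h"
  unfolding bruhat_less_def by (rule tranclp_trans)

lemma bruhat_less_irrefl: "\<not> bruhat_less m n f f"
  using bruhat_less_props by blast

lemma moment_bound: "\<bar>moment m n f\<bar> \<le> int (m + n) * mass m n f"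
proof -
  have "\<bar>moment m n f\<bar> \<le> (\<Sum>k\<in>Imn m n. \<bar>- k * f k\<bar>)"
    unfolding moment_def by (rule sum_abs)
  also have "\<dots> \<le> (\<Sum>k\<in>Imn m n. int (m + n) * \<bar>f k\<bar>)"
    by (intro sum_mono) (auto simp: abs_mult Imn_def negI_def posI_def intro!: mult_right_mono)
  finally show ?thesis by (simp add: mass_def sum_distrib_left)
qed

text \<open>Bruhat-smaller labellings have the same mass, so this bounds the length of descending chains.\<close>

definition height :: "nat \<Rightarrow> nat \<Rightarrow> (int \<Rightarrow> int) \<Rightarrow> nat" where
  "height m n f = nat (moment m n f + int (m + n) * mass m n f)"

lemma height_less: "bruhat_less m n f g \<Longrightarrow> height m n f < height m n g"
  using bruhat_less_props [of m n f g] moment_bound [of m n f] by (auto simp: height_def)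

text \<open>Sorting by swaps within one side. Each swap is an upward Bruhat step, and the process
  stops because \<open>moment\<close> grows while staying bounded in terms of the constant
  \<open>mass\<close>.\<close>

lemma sort_exists:
  assumes "h \<in> Zmn m n" "inj_on h (negI m)" "inj_on h (posI n)"
  shows "\<exists>h'\<in>Zp m n. h' ` negI m = h ` negI m \<and> h' ` posI n = h ` posI n \<and>
    (bruhat_step m n)\<^sup>*\<^sup>* h h'"
  using assms
proof (induction "nat (int (m + n) * mass m n h - moment m n h)" arbitrary: h rule: less_induct)
  case less
  show ?case
  proof (cases "h \<in> Zp m n")
    case True
    then show ?thesis by auto
  next
    case False
    then have "\<exists>i j. (i \<in> negI m \<and> j \<in> negI m \<or> i \<in> posI n \<and> j \<in> posI n) \<and> i < j \<and> \<not> h j < h i"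
      using less.prems(1) by (auto simp: Zp_def)
    then obtain i j where ij: "i \<in> negI m \<and> j \<in> negI m \<or> i \<in> posI n \<and> j \<in> posI n" "i < j" "\<not> h j < h i"
      by blast
    then have "h i \<noteq> h j" using less.prems(2,3) by (auto simp: inj_on_def)
    then have lt: "h i < h j" using ij by simp
    let ?g = "swapv h i j"
    have step: "bruhat_step m n h ?g"
      unfolding bruhat_step_def using less.prems(1) ij lt by (auto simp: Imn_def)
    define \<tau> where "\<tau> k = (if k = i then j else if k = j then i else k)" for k
    have g: "?g = h \<circ> \<tau>" by (auto simp: swapv_def \<tau>_def)
    have \<tau>\<tau>: "\<tau> (\<tau> k) = k" for k by (auto simp: \<tau>_def)
    have inv: "\<tau> k \<in> negI m \<longleftrightarrow> k \<in> negI m" "\<tau> k \<in> posI n \<longleftrightarrow> k \<in> posI n" for k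
      using ij(1) index_disjoint [of m n] by (auto simp: \<tau>_def)
    have img: "\<tau> ` negI m = negI m" "\<tau> ` posI n = posI n"
      using inv \<tau>\<tau> by (auto simp: image_iff) metis+
    have inj: "inj_on \<tau> A" for A by (metis \<tau>\<tau> inj_onI)
    have "moment m n h < moment m n ?g" "mass m n ?g = mass m n h" "?g \<in> Zmn m n"
      using bruhat_step_props [OF step] by auto
    then have "nat (int (m + n) * mass m n ?g - moment m n ?g) < nat (int (m + n) * mass m n h - moment m n h)"
      using moment_bound [of m n ?g] by auto
    moreover have "inj_on ?g (negI m)" "inj_on ?g (posI n)"
      unfolding g using less.prems(2,3) inj by (auto intro!: comp_inj_on simp: img)
    ultimately obtain h' where "h' \<in> Zp m n" "h' ` negI m = ?g ` negI m" "h' ` posI n = ?g ` posI n"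
      "(bruhat_step m n)\<^sup>*\<^sup>* ?g h'"
      using less.hyps [of ?g] \<open>?g \<in> Zmn m n\<close> by blast
    moreover have "?g ` negI m = h ` negI m" "?g ` posI n = h ` posI n"
      unfolding g image_comp [symmetric] img by simp_all
    ultimately show ?thesis using step by (metis converse_rtranclp_into_rtranclp)
  qed
qed

text \<open>Swapping the two values goes up if \<open>x < y\<close>, and sorting each side goes up in any case.\<close>

lemma flip_exists:
  assumes g: "g \<in> Zp m n" and x: "st m n g x = cls" and y: "st m n g y = opn"
  shows "\<exists>h\<in>Zp m n. st m n h = (st m n g)(x := opn, y := cls) \<and> (x < y \<longrightarrow> bruhat_less m n g h)"
proof -
  have xy: "x \<in> g ` negI m" "x \<notin> g ` posI n" "y \<notin> g ` negI m" "y \<in> g ` posI n"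
    using x y by (auto simp: st_def)
  then obtain i j where i: "i \<in> negI m" "g i = x" and j: "j \<in> posI n" "g j = y" by auto
  let ?h = "swapv g i j"
  have ij: "i \<notin> posI n" "j \<notin> negI m" using i j index_disjoint [of m n] by auto
  have Zmn: "g \<in> Zmn m n" using g by (simp add: Zp_def)
  have ineg: "g k \<noteq> x" if "k \<in> negI m" "k \<noteq> i" for k
    using that i Zp_inj(1) [OF g] by (auto simp: inj_on_def)
  have jpos: "g k \<noteq> y" if "k \<in> posI n" "k \<noteq> j" for k
    using that j Zp_inj(2) [OF g] by (auto simp: inj_on_def)
  have neg: "?h ` negI m = insert y (g ` negI m - {x})"
    using i j ij ineg by (force simp: swapv_def)
  have pos: "?h ` posI n = insert x (g ` posI n - {y})"
    using i j ij jpos by (force simp: swapv_def)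
  have "inj_on (g(i := y)) (negI m)" "inj_on (g(j := x)) (posI n)"
    using Zp_inj [OF g] xy by (auto intro: inj_on_fun_updI)
  moreover have "?h k = (g(i := y)) k" if "k \<in> negI m" for k
    using that i j ij by (auto simp: swapv_def)
  moreover have "?h k = (g(j := x)) k" if "k \<in> posI n" for k
    using that i j ij by (auto simp: swapv_def)
  ultimately have "inj_on ?h (negI m)" "inj_on ?h (posI n)"
    by (simp_all cong: inj_on_cong)
  moreover have "?h \<in> Zmn m n"
    using Zmn i j by (auto simp: Zmn_def swapv_def Imn_def)
  ultimately obtain h where h: "h \<in> Zp m n" "h ` negI m = ?h ` negI m" "h ` posI n = ?h ` posI n"
      "(bruhat_step m n)\<^sup>*\<^sup>* ?h h"
    using sort_exists by blast
  have "st m n h = (st m n g)(x := opn, y := cls)"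
    using xy by (auto simp: st_def fun_eq_iff h(2,3) neg pos)
  moreover have "bruhat_less m n g h" if "x < y"
  proof -
    have "bruhat_step m n g ?h"
      unfolding bruhat_step_def using Zmn i j that index_less [OF i(1) j(1)]
      by (auto simp: Imn_def)
    then show ?thesis unfolding bruhat_less_def using h(4) by (rule rtranclp_into_tranclp2)
  qed
  ultimately show ?thesis using h(1) by blast
qed

text \<open>Descending is obtained from ascending: undo the flip starting from \<open>g\<close>,
  where the sorted result lies above \<open>g\<close>, and recognise that result as \<open>f\<close>
  by its label.\<close>

lemma flip_bruhat_less:
  assumes f: "f \<in> Zp m n" and g: "g \<in> Zp m n" and xy: "x < y"
    and x: "st m n f x = opn" and y: "st m n f y = cls" and st: "st m n g = (st m n f)(x := cls, y := opn)"
  shows "bruhat_less m n g f"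
proof -
  have "st m n g x = cls" "st m n g y = opn" using st xy by auto
  from flip_exists [OF g this] obtain h where h: "h \<in> Zp m n"
    "st m n h = (st m n g)(x := opn, y := cls)" "bruhat_less m n g h" using xy by blast
  have "st m n h = st m n f" using h(2) st x y by auto
  with h f st_inj show ?thesis by blast
qed

section \<open>The support of a product vector\<close>

lemma Wt_nonzero_iff:
  assumes "finite M"
  shows "Wt s M t \<noteq> 0 \<longleftrightarrow> (\<forall>x. x \<notin> verts M \<longrightarrow> t x = s x) \<and>
    (\<forall>b a. (b, a) \<in> M \<longrightarrow> t b = opn \<and> t a = cls \<or> t b = cls \<and> t a = opn)"
proof -
  have "(\<Prod>(b, a)\<in>M. wt (t b) (t a)) \<noteq> 0 \<longleftrightarrow> (\<forall>b a. (b, a) \<in> M \<longrightarrow> wt (t b) (t a) \<noteq> 0)"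
    using assms by auto
  moreover have "wt p r \<noteq> 0 \<longleftrightarrow> p = opn \<and> r = cls \<or> p = cls \<and> r = opn" for p r
    by (auto simp: wt_def)
  ultimately have *: "(\<Prod>(b, a)\<in>M. wt (t b) (t a)) \<noteq> 0 \<longleftrightarrow>
    (\<forall>b a. (b, a) \<in> M \<longrightarrow> t b = opn \<and> t a = cls \<or> t b = cls \<and> t a = opn)"
    by (simp only:)
  have "(if P then x else 0) \<noteq> 0 \<longleftrightarrow> P \<and> x \<noteq> 0" for P and x :: qf
    by simp
  then show ?thesis unfolding Wt_def * by (simp only: *)
qed

lemma Wt_eq_power:
  assumes "finite M" "Wt s M t \<noteq> 0"
  shows "Wt s M t = qq ^ card {p \<in> M. t (fst p) = cls}"
proof -
  have nz: "\<And>x. x \<notin> verts M \<Longrightarrow> t x = s x"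
    "\<And>b a. (b, a) \<in> M \<Longrightarrow> t b = opn \<and> t a = cls \<or> t b = cls \<and> t a = opn"
    using assms by (simp_all only: Wt_nonzero_iff) blast+
  have "Wt s M t = (\<Prod>p\<in>M. if t (fst p) = cls then qq else 1)"
    unfolding Wt_def using nz(1)
    by (auto intro!: prod.cong simp: wt_def dest!: nz(2))
  also have "\<dots> = qq ^ card {p \<in> M. t (fst p) = cls}"
    using assms(1) by (simp add: prod.If_cases Int_def)
  finally show ?thesis .
qed

lemma Wt_flip:
  assumes M: "cupd s M" and nz: "Wt s M t \<noteq> 0" and ba: "(b, a) \<in> M" "t b = cls"
  shows "t a = opn" "Wt s M (t(b := opn, a := cls)) \<noteq> 0"
proof -
  note fin = cupdD(1) [OF M]
  have lt: "b < a" using cupdD(2) [OF M ba(1)] .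
  show "t a = opn" using nz ba unfolding Wt_nonzero_iff [OF fin] by fastforce
  have "t b' = opn \<and> t a' = cls \<or> t b' = cls \<and> t a' = opn" if "(b', a') \<in> M" for b' a'
    using nz that unfolding Wt_nonzero_iff [OF fin] by blast
  moreover have "b' \<noteq> a \<and> a' \<noteq> b \<and> (b' = b \<longleftrightarrow> a' = a)" if "(b', a') \<in> M" for b' a'
    using cupdD(3,4) [OF M that] cupdD(3,4) [OF M ba(1)] cupdD(5,6) [OF M] that ba(1)
    by (metis Pair_inject)
  moreover have "b \<in> verts M" "a \<in> verts M" using verts_mem [OF ba(1)] .
  ultimately show "Wt s M (t(b := opn, a := cls)) \<noteq> 0"
    using nz lt unfolding Wt_nonzero_iff [OF fin] by (auto; metis)
qed

text \<open>Induction on the number of flipped pairs. Unflipping one pair gives a label realised by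
  some \<open>g\<close> at or below \<open>f\<close>; flipping the pair again in \<open>g\<close>
  realises \<open>t\<close> and goes strictly down.\<close>

lemma Wt_support:
  assumes f: "f \<in> Zp m n" and M: "cupd (st m n f) M" and nz: "Wt (st m n f) M t \<noteq> 0"
  shows "\<exists>g\<in>Zp m n. st m n g = t \<and> (g = f \<or> bruhat_less m n g f)"
  using nz
proof (induction "card {p \<in> M. t (fst p) = cls}" arbitrary: t rule: less_induct)
  case less
  note fin = cupdD(1) [OF M]
  show ?case
  proof (cases "\<exists>b a. (b, a) \<in> M \<and> t b = cls")
    case False
    have "t x = st m n f x" for x
    proof (cases "x \<in> verts M")
      case True
      then obtain b a where ba: "(b, a) \<in> M" "x = b \<or> x = a" by (auto simp: verts_def)
      then have "t b = opn \<and> t a = cls"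
        using False less.prems unfolding Wt_nonzero_iff [OF fin] by blast
      then show ?thesis using cupdD(3,4) [OF M ba(1)] ba(2) by auto
    next
      case False
      then show ?thesis using less.prems unfolding Wt_nonzero_iff [OF fin] by blast
    qed
    then have "st m n f = t" by auto
    then show ?thesis using f by blast
  next
    case True
    then obtain b a where ba: "(b, a) \<in> M" "t b = cls" by blast
    have lt: "b < a" using cupdD(2) [OF M ba(1)] .
    let ?t = "t(b := opn, a := cls)"
    have ta: "t a = opn" and nz: "Wt (st m n f) M ?t \<noteq> 0"
      using Wt_flip [OF M less.prems ba] by auto
    have "p \<in> M \<Longrightarrow> fst p \<noteq> a" for p
      using cupdD(3) [OF M, of "fst p" "snd p"] cupdD(4) [OF M ba(1)] by auto
    then have "{p \<in> M. ?t (fst p) = cls} \<subseteq> {p \<in> M. t (fst p) = cls} - {(b, a)}"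
      using lt by auto
    moreover have "(b, a) \<in> {p \<in> M. t (fst p) = cls}" using ba by simp
    ultimately have "{p \<in> M. ?t (fst p) = cls} \<subset> {p \<in> M. t (fst p) = cls}" by blast
    then have "card {p \<in> M. ?t (fst p) = cls} < card {p \<in> M. t (fst p) = cls}"
      using fin by (intro psubset_card_mono) auto
    from less.hyps [OF this nz] obtain g where g: "g \<in> Zp m n" "st m n g = ?t"
      "g = f \<or> bruhat_less m n g f" by blast
    have gb: "st m n g b = opn" "st m n g a = cls" using g(2) lt by auto
    from flip_exists [OF g(1) gb(2,1)] obtain h where
      h: "h \<in> Zp m n" "st m n h = (st m n g)(a := opn, b := cls)" by blast
    have "st m n h = (st m n g)(b := cls, a := opn)" using h(2) lt by (simp add: fun_upd_twist)
    then have "bruhat_less m n h g" using flip_bruhat_less [OF g(1) h(1) lt gb] by blast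
    moreover have "st m n h = t" using h(2) g(2) ba(2) ta lt by auto
    ultimately show ?thesis using h(1) g(3) bruhat_less_trans by blast
  qed
qed

section \<open>J-typical labellings are those without pairs\<close>

lemma occ_st:
  assumes f: "f \<in> Zp m n"
  shows "occ m n f v = (if fst (st m n f v) then 1 else 0) + (if snd (st m n f v) then 1 else 0)"
proof -
  have one: "(\<Sum>k\<in>A. if f k = v then 1 else 0) = (if v \<in> f ` A then 1 else (0 :: int))"
    if A: "finite A" "inj_on f A" for A
  proof (cases "v \<in> f ` A")
    case True
    then obtain i where i: "i \<in> A" "f i = v" by auto
    then have "(\<Sum>k\<in>A. if f k = v then 1 else (0 :: int)) = (\<Sum>k\<in>A. if k = i then 1 else 0)"
      using A(2) by (intro sum.cong) (auto simp: inj_on_def)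
    then show ?thesis using True i A(1) by simp
  next
    case False
    then show ?thesis by (auto intro!: sum.neutral)
  qed
  show ?thesis
    using one [OF finite_index(1) Zp_inj(1) [OF f]] one [OF finite_index(2) Zp_inj(2) [OF f]]
    by (simp add: occ_def Imn_def sum.union_disjoint index_disjoint st_def)
qed

lemma negsum_eq:
  assumes f: "f \<in> Zp m n"
  shows "negsum m n f = \<Sum>(f ` negI m)"
proof -
  have "negsum m n f = (\<Sum>k\<in>negI m. f k)"
    unfolding negsum_def Imn_def
    by (subst sum.union_disjoint) (auto simp: index_disjoint index_not_both intro!: sum.neutral)
  then show ?thesis by (simp add: sum.reindex [OF Zp_inj(1) [OF f]])
qed

lemma card_image_Zp: "f \<in> Zp m n \<Longrightarrow> card (f ` negI m) = m"
  by (simp add: card_image Zp_inj(1)) (simp add: negI_def)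

lemma sum_less_of_separated:
  fixes X Y :: "int set"
  assumes "finite X" "finite Y" "card X = card Y" "X \<noteq> {}" "\<And>x y. x \<in> X \<Longrightarrow> y \<in> Y \<Longrightarrow> x < y"
  shows "\<Sum>X < \<Sum>Y"
proof -
  have "Y \<noteq> {}" using assms(1,3,4) by auto
  have "\<Sum>X \<le> of_nat (card X) * Max X"
    using sum_bounded_above [of X "\<lambda>x. x" "Max X"] assms(1) by simp
  also have "\<dots> < of_nat (card X) * Min Y"
    using assms \<open>Y \<noteq> {}\<close> by (intro mult_strict_left_mono) (auto simp: card_gt_0_iff)
  also have "\<dots> \<le> \<Sum>Y"
    using sum_bounded_below [of Y "Min Y" "\<lambda>x. x"] assms(2,3) by simp
  finally show ?thesis .
qed

text \<open>Without pairs, every closing bracket lies left of every opening one. A smaller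
  \<open>g\<close> has the same values with multiplicity, so its negative side arises from that of
  \<open>f\<close> by trading closing brackets for equally many opening ones. This would increase
  \<open>negsum\<close>, which cannot increase when going down.\<close>

lemma cupd_empty_minimal:
  assumes f: "f \<in> Zp m n" and M: "cupd (st m n f) {}" and g: "g \<in> Zp m n"
  shows "\<not> bruhat_less m n g f"
proof
  assume less: "bruhat_less m n g f"
  note props = bruhat_less_props [OF less]
  let ?A = "f ` negI m" and ?B = "g ` negI m"
  \<comment> \<open>Each side is injective, so the multiplicity of a value is the number of sides on
    which it occurs.\<close>
  have occ: "(if x \<in> f ` negI m then 1 else 0) + (if x \<in> f ` posI n then 1 else 0) =
    (if x \<in> g ` negI m then 1 else 0) + (if x \<in> g ` posI n then 1 else (0 :: int))" for x
    using props occ_st [OF f, of x] occ_st [OF g, of x] by (simp add: st_def)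
  have A: "st m n f x = cls" if "x \<in> ?A - ?B" for x
    using that occ [of x] by (auto simp: st_def split: if_splits)
  have B: "st m n f x = opn" if "x \<in> ?B - ?A" for x
    using that occ [of x] by (auto simp: st_def split: if_splits)
  have sep: "x < y" if "x \<in> ?A - ?B" "y \<in> ?B - ?A" for x y
    using cupdD(7) [OF M, of y x] A [OF that(1)] B [OF that(2)] that by force
  have cards: "card ?A = card ?B" using card_image_Zp f g by metis
  have fin: "finite ?A" "finite ?B" by auto
  have card: "card (?A - ?B) = card (?B - ?A)"
    using card_Diff_subset_Int [of ?A ?B] card_Diff_subset_Int [of ?B ?A] cards
    by (simp add: Int_commute)
  have sums: "\<Sum>?A - \<Sum>(?A - ?B) = \<Sum>?B - \<Sum>(?B - ?A)"
    using sum.Int_Diff [OF fin(1), of "\<lambda>x. x" ?B] sum.Int_Diff [OF fin(2), of "\<lambda>x. x" ?A]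
    by (simp add: Int_commute)
  have "?A - ?B = {}"
  proof (rule ccontr)
    assume "?A - ?B \<noteq> {}"
    then have "\<Sum>(?A - ?B) < \<Sum>(?B - ?A)"
      using fin card sep by (intro sum_less_of_separated) auto
    then show False using props sums negsum_eq [OF f] negsum_eq [OF g] by linarith
  qed
  then have AB: "?A = ?B" using fin cards by (metis Diff_eq_empty_iff card_subset_eq)
  then have "x \<in> f ` posI n \<longleftrightarrow> x \<in> g ` posI n" for x
    using occ [of x] by (auto split: if_splits)
  then have "f = g" using Zp_eqI [OF f g AB] by blast
  then show False using less bruhat_less_irrefl by blast
qed

lemma Jtypical_iff:
  assumes f: "f \<in> Zp m n" and M: "cupd (st m n f) M"
  shows "Jtypical m n f \<longleftrightarrow> M = {}"
proof
  assume "M = {}"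
  then show "Jtypical m n f"
    using cupd_empty_minimal [OF f] M f unfolding Jtypical_def by blast
next
  assume J: "Jtypical m n f"
  show "M = {}"
  proof (rule ccontr)
    assume "M \<noteq> {}"
    then obtain b a where ba: "(b, a) \<in> M" by auto
    have lt: "b < a" and s: "st m n f b = opn" "st m n f a = cls" using cupdD(2-4) [OF M ba] .
    from flip_exists [OF f s(2,1)] obtain h where
      h: "h \<in> Zp m n" "st m n h = (st m n f)(a := opn, b := cls)" by blast
    have "st m n h = (st m n f)(b := cls, a := opn)" using h(2) lt by (simp add: fun_upd_twist)
    then have "bruhat_less m n h f" using flip_bruhat_less [OF f h(1) lt s] by blast
    with J h(1) show False unfolding Jtypical_def by blast
  qed
qed

text \<open>A value moves to a free neighbouring integer, so it cannot pass any other value of its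
  side; the result is decreasing without being sorted again.\<close>

lemma Zp_repl_neg:
  assumes f: "f \<in> Zp m n" and ab: "b = a + 1 \<or> a = b + 1" and a: "a \<in> f ` negI m" and b: "b \<notin> f ` negI m"
  shows "repl f (negI m) a b \<in> Zp m n"
    "repl f (negI m) a b ` negI m = insert b (f ` negI m - {a})"
    "repl f (negI m) a b ` posI n = f ` posI n"
proof -
  have nb: "f i \<noteq> b" if "i \<in> negI m" for i using b that by auto
  have 1: "repl f (negI m) a b j < repl f (negI m) a b i" if "i \<in> negI m" "j \<in> negI m" "i < j" for i j
    using ZpD(2) [OF f that] that nb [of i] nb [of j] ab index_not_both by (auto simp: repl_def)
  have 2: "repl f (negI m) a b j < repl f (negI m) a b i" if "i \<in> posI n" "j \<in> posI n" "i < j" for i j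
    using ZpD(3) [OF f that] that nb [of i] nb [of j] ab index_not_both by (auto simp: repl_def)
  have "repl f (negI m) a b x = 0" if "x \<notin> Imn m n" for x
    using ZpD(1) [OF f that] that by (auto simp: repl_def Imn_def)
  with 1 2 show "repl f (negI m) a b \<in> Zp m n"
    by (simp add: Zp_def Zmn_def)
  show "repl f (negI m) a b ` negI m = insert b (f ` negI m - {a})"
    using a b by (auto simp: repl_def image_iff)
  show "repl f (negI m) a b ` posI n = f ` posI n"
    using index_disjoint [of m n] by (intro image_cong refl) (auto simp: repl_def)
qed

lemma Zp_repl_pos:
  assumes f: "f \<in> Zp m n" and ab: "b = a + 1 \<or> a = b + 1" and a: "a \<in> f ` posI n" and b: "b \<notin> f ` posI n"
  shows "repl f (posI n) a b \<in> Zp m n"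
    "repl f (posI n) a b ` negI m = f ` negI m"
    "repl f (posI n) a b ` posI n = insert b (f ` posI n - {a})"
proof -
  have nb: "f i \<noteq> b" if "i \<in> posI n" for i using b that by auto
  have 1: "repl f (posI n) a b j < repl f (posI n) a b i" if "i \<in> negI m" "j \<in> negI m" "i < j" for i j
    using ZpD(2) [OF f that] that nb [of i] nb [of j] ab index_not_both by (auto simp: repl_def)
  have 2: "repl f (posI n) a b j < repl f (posI n) a b i" if "i \<in> posI n" "j \<in> posI n" "i < j" for i j
    using ZpD(3) [OF f that] that nb [of i] nb [of j] ab index_not_both by (auto simp: repl_def)
  have "repl f (posI n) a b x = 0" if "x \<notin> Imn m n" for x
    using ZpD(1) [OF f that] that by (auto simp: repl_def Imn_def)
  with 1 2 show "repl f (posI n) a b \<in> Zp m n"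
    by (simp add: Zp_def Zmn_def)
  show "repl f (posI n) a b ` posI n = insert b (f ` posI n - {a})"
    using a b by (auto simp: repl_def image_iff)
  show "repl f (posI n) a b ` negI m = f ` negI m"
    using index_disjoint [of m n] by (intro image_cong refl) (auto simp: repl_def)
qed

section \<open>Positive pairs as a cup diagram\<close>

text \<open>Passes from positions to values and reverses each pair: the positive position supplies
  the opening bracket, which is the smaller value.\<close>

definition cups :: "nat \<Rightarrow> nat \<Rightarrow> (int \<Rightarrow> int) \<Rightarrow> (int \<times> int) set" where
  "cups m n f = (\<lambda>(i, j). (f j, f i)) ` SigPlus m n f"

lemma atypical_iff:
  "atypical m n f (i, j) \<longleftrightarrow> i \<in> negI m \<and> j \<in> posI n \<and> f j < f i \<and>
     st m n f (f i) = cls \<and> st m n f (f j) = opn"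
  by (auto simp: atypical_def st_def image_iff)

lemma SigUpTo_D:
  "p \<in> SigUpTo m n f k \<Longrightarrow> atypical m n f p \<and> 0 < pdist f p \<and> pdist f p \<le> int k"
proof (induction k)
  case (Suc k)
  then show ?case by (cases p) (auto simp: pdist_def atypical_iff)
qed simp

lemma SigUpTo_Suc_iff:
  assumes "atypical m n f p" "pdist f p = int (Suc k)"
  shows "p \<in> SigUpTo m n f (Suc k) \<longleftrightarrow> (\<forall>p'\<in>SigUpTo m n f k. disjoint_pairs p p')"
  using assms SigUpTo_D [of p m n f k] by auto

lemma SigUpTo_mono: "k \<le> l \<Longrightarrow> SigUpTo m n f k \<subseteq> SigUpTo m n f l"
  by (induction l) (auto simp: le_Suc_eq)

lemma SigUpTo_pdist:
  "p \<in> SigUpTo m n f k \<Longrightarrow> pdist f p \<le> int l \<Longrightarrow> p \<in> SigUpTo m n f l"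
proof (induction k)
  case (Suc k)
  show ?case
  proof (cases "p \<in> SigUpTo m n f k")
    case False
    then have "pdist f p = int (Suc k)" using Suc.prems by auto
    then have "Suc k \<le> l" using Suc.prems by simp
    then show ?thesis using SigUpTo_mono Suc.prems(1) by blast
  qed (use Suc in simp)
qed simp

lemma SigPlus_atypical: "p \<in> SigPlus m n f \<Longrightarrow> atypical m n f p"
  unfolding SigPlus_def using SigUpTo_D by blast

text \<open>The recursion forces disjointness only between pairs of different distances. For equal
  distances a shared entry makes both values agree, and injectivity on each side does the
  rest.\<close>

lemma SigPlus_unique:
  assumes f: "f \<in> Zp m n" and p: "p \<in> SigPlus m n f" and p': "p' \<in> SigPlus m n f"
    and "fst p = fst p' \<or> snd p = snd p'"
  shows "p = p'"
proof -
  have lt: False if h: "p \<in> SigPlus m n f" "p' \<in> SigPlus m n f" "fst p = fst p' \<or> snd p = snd p'"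
    "pdist f p < pdist f p'" for p p'
  proof -
    obtain k where k: "p' \<in> SigUpTo m n f k" using h(2) by (auto simp: SigPlus_def)
    note D = SigUpTo_D [OF k]
    define l where "l = nat (pdist f p' - 1)"
    have l: "pdist f p' = int (Suc l)" using D by (simp add: l_def)
    have "p' \<in> SigUpTo m n f (Suc l)" using SigUpTo_pdist [OF k, of "Suc l"] l by simp
    then have "\<forall>q\<in>SigUpTo m n f l. disjoint_pairs p' q" using SigUpTo_Suc_iff D l by blast
    moreover have "p \<in> SigUpTo m n f l"
    proof -
      obtain k' where k': "p \<in> SigUpTo m n f k'" using h(1) by (auto simp: SigPlus_def)
      show ?thesis using SigUpTo_pdist [OF k', of l] l h(4) by simp
    qed
    ultimately show False using h(3) by (auto simp: disjoint_pairs_def)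
  qed
  have "fst p' = fst p \<or> snd p' = snd p" using assms(4) by presburger
  then have "\<not> pdist f p' < pdist f p" using lt [OF p' p] by blast
  moreover have "\<not> pdist f p < pdist f p'" using lt [OF p p' assms(4)] by blast
  ultimately have "pdist f p = pdist f p'" by simp
  moreover have "atypical m n f p" "atypical m n f p'" using p p' SigPlus_atypical by blast+
  then have in_I: "fst p \<in> negI m" "fst p' \<in> negI m" "snd p \<in> posI n" "snd p' \<in> posI n"
    by (cases p; cases p'; simp add: atypical_iff)+
  ultimately have "f (fst p) = f (fst p')" "f (snd p) = f (snd p')"
    using assms(4) by (auto simp: pdist_def)
  then have "fst p = fst p'" "snd p = snd p'"
    using Zp_inj [OF f] in_I unfolding inj_on_def by blast+
  then show ?thesis by (simp add: prod_eq_iff)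
qed

lemma finite_SigPlus [simp]: "finite (SigPlus m n f)"
proof (rule finite_subset)
  show "SigPlus m n f \<subseteq> negI m \<times> posI n"
    using SigPlus_atypical by (fastforce simp: atypical_iff)
qed simp

lemma SigPlus_values:
  assumes f: "f \<in> Zp m n" and p: "p \<in> SigPlus m n f" and p': "p' \<in> SigPlus m n f"
  shows "f (fst p) = f (fst p') \<longleftrightarrow> p = p'" "f (snd p) = f (snd p') \<longleftrightarrow> p = p'"
    "f (fst p) \<noteq> f (snd p')"
proof -
  have a: "atypical m n f p" "atypical m n f p'" using p p' SigPlus_atypical by blast+
  then have "fst p \<in> negI m" "fst p' \<in> negI m" "snd p \<in> posI n" "snd p' \<in> posI n"
    by (cases p; cases p'; simp add: atypical_iff)+
  then show "f (fst p) = f (fst p') \<longleftrightarrow> p = p'" "f (snd p) = f (snd p') \<longleftrightarrow> p = p'"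
    using Zp_inj [OF f] SigPlus_unique [OF f p p'] unfolding inj_on_def by blast+
  show "f (fst p) \<noteq> f (snd p')"
    using a by (cases p; cases p'; auto simp: atypical_iff)
qed

lemma cupd_cups:
  assumes f: "f \<in> Zp m n"
  shows "cupd (st m n f) (cups m n f)"
proof (rule cupdI)
  show "finite (cups m n f)" by (simp add: cups_def)
next
  fix b a assume "(b, a) \<in> cups m n f"
  then show "b < a \<and> st m n f b = opn \<and> st m n f a = cls"
    using SigPlus_atypical by (fastforce simp: cups_def atypical_iff)
next
  fix b a a' assume "(b, a) \<in> cups m n f" "(b, a') \<in> cups m n f"
  then show "a = a'" using SigPlus_values(2) [OF f] by (fastforce simp: cups_def)
next
  fix b b' a assume "(b, a) \<in> cups m n f" "(b', a) \<in> cups m n f"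
  then show "b = b'" using SigPlus_values(1) [OF f] by (fastforce simp: cups_def)
next
  fix x y assume xy: "x < y" "st m n f x = opn" "st m n f y = cls"
  then obtain i j where ij: "i \<in> negI m" "f i = y" "j \<in> posI n" "f j = x"
    by (auto simp: st_def)
  then have at: "atypical m n f (i, j)" using xy by (simp add: atypical_iff)
  \<comment> \<open>Chosen so that the distance is \<open>Suc k\<close>, the stage at which the pair
    is decided; the pairs that may block it are those of stage \<open>k\<close>.\<close>
  define k where "k = nat (y - x - 1)"
  have k: "pdist f (i, j) = int (Suc k)" using xy ij by (simp add: pdist_def k_def)
  show "(\<exists>z\<le>y. (x, z) \<in> cups m n f) \<or> (\<exists>z\<ge>x. (z, y) \<in> cups m n f)"
  proof (cases "(i, j) \<in> SigUpTo m n f (Suc k)")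
    case True
    then have "(i, j) \<in> SigPlus m n f" unfolding SigPlus_def by blast
    then have "(x, y) \<in> cups m n f" using ij by (force simp: cups_def)
    then show ?thesis by blast
  next
    case False
    then obtain i' j' where p: "(i', j') \<in> SigUpTo m n f k" "i = i' \<or> j = j'"
      using SigUpTo_Suc_iff [OF at k] by (fastforce simp: disjoint_pairs_def)
    then have "(i', j') \<in> SigPlus m n f" by (auto simp: SigPlus_def)
    then have c: "(f j', f i') \<in> cups m n f" by (force simp: cups_def)
    have "f i' - f j' \<le> int k" using SigUpTo_D [OF p(1)] by (simp add: pdist_def)
    then have "i = i' \<Longrightarrow> x \<le> f j'" "j = j' \<Longrightarrow> f i' \<le> y"
      using k ij by (simp_all add: pdist_def)
    with p(2) c ij show ?thesis by blast
  qed
qed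

lemma cups_unique: "f \<in> Zp m n \<Longrightarrow> cupd (st m n f) M \<Longrightarrow> cups m n f = M"
  using cupd_unique cupd_cups by blast

section \<open>The canonical vectors\<close>

definition W :: "nat \<Rightarrow> nat \<Rightarrow> (int \<Rightarrow> int) \<Rightarrow> vec" where
  "W m n f g = (if g \<in> Zp m n then Wt (st m n f) (cups m n f) (st m n g) else 0)"

lemma W_self: "f \<in> Zp m n \<Longrightarrow> W m n f f = 1"
  by (simp add: W_def Wt_self cupd_cups)

lemma W_nonzeroD:
  assumes "f \<in> Zp m n" "W m n f g \<noteq> 0"
  shows "g \<in> Zp m n" "g = f \<or> bruhat_less m n g f"
proof -
  show g: "g \<in> Zp m n" using assms by (auto simp: W_def split: if_splits)
  then show "g = f \<or> bruhat_less m n g f"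
    using Wt_support [OF assms(1) cupd_cups [OF assms(1)], of "st m n g"] assms st_inj
    by (fastforce simp: W_def)
qed

text \<open>The exponent counts flipped pairs, and a label with no flipped pair is that of
  \<open>f\<close> itself.\<close>

lemma W_off_diagonal:
  assumes f: "f \<in> Zp m n" and nz: "W m n f g \<noteq> 0" and "g \<noteq> f"
  obtains k where "0 < k" "W m n f g = qq ^ k"
proof -
  let ?M = "cups m n f"
  have M: "cupd (st m n f) ?M" by (rule cupd_cups [OF f])
  have g: "g \<in> Zp m n" and nz': "Wt (st m n f) ?M (st m n g) \<noteq> 0"
    using nz by (auto simp: W_def split: if_splits)
  let ?P = "{p \<in> ?M. st m n g (fst p) = cls}"
  have "?P \<noteq> {}"
  proof
    assume e: "?P = {}"
    have "st m n g x = st m n f x" for x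
    proof (cases "x \<in> verts ?M")
      case True
      then obtain b a where ba: "(b, a) \<in> ?M" "x = b \<or> x = a" by (auto simp: verts_def)
      have "st m n g b \<noteq> cls" using e ba(1) by auto
      then have "st m n g b = opn \<and> st m n g a = cls"
        using nz' ba(1) unfolding Wt_nonzero_iff [OF cupdD(1) [OF M]] by blast
      then show ?thesis using cupdD(3,4) [OF M ba(1)] ba(2) by auto
    next
      case False
      then show ?thesis using nz' unfolding Wt_nonzero_iff [OF cupdD(1) [OF M]] by blast
    qed
    then have "g = f" using st_inj [OF g f] by blast
    with assms(3) show False ..
  qed
  moreover have "finite ?P" using cupdD(1) [OF M] by simp
  ultimately have "0 < card ?P" by (simp add: card_gt_0_iff)
  then show ?thesis
    using that [of "card ?P"] Wt_eq_power [OF cupdD(1) [OF M] nz'] g by (simp add: W_def)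
qed

section \<open>Expansion over subsets of positive pairs\<close>

definition flips :: "nat \<Rightarrow> nat \<Rightarrow> (int \<Rightarrow> int) \<Rightarrow> (int \<times> int) set \<Rightarrow> diag" where
  "flips m n f \<Sigma> x = (if \<exists>p\<in>\<Sigma>. x = f (fst p) then opn
     else if \<exists>p\<in>\<Sigma>. x = f (snd p) then cls else st m n f x)"

lemma exch_eq:
  assumes f: "f \<in> Zp m n" and \<Sigma>: "\<Sigma> \<subseteq> SigPlus m n f"
  shows "(i, j) \<in> \<Sigma> \<Longrightarrow> exch f \<Sigma> i = f j" "(i, j) \<in> \<Sigma> \<Longrightarrow> exch f \<Sigma> j = f i"
    "k \<notin> fst ` \<Sigma> \<Longrightarrow> k \<notin> snd ` \<Sigma> \<Longrightarrow> exch f \<Sigma> k = f k"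
proof -
  assume ij: "(i, j) \<in> \<Sigma>"
  have i: "i \<in> negI m" and j: "j \<in> posI n"
    using ij \<Sigma> SigPlus_atypical by (fastforce simp: atypical_iff)+
  have "(THE j. (i, j) \<in> \<Sigma>) = j"
    using ij \<Sigma> SigPlus_unique [OF f, of "(i, _)" "(i, j)"] by (intro the_equality) auto
  with ij show "exch f \<Sigma> i = f j" by (auto simp: exch_def)
  have "(THE i. (i, j) \<in> \<Sigma>) = i"
    using ij \<Sigma> SigPlus_unique [OF f, of "(_, j)" "(i, j)"] by (intro the_equality) auto
  moreover have "(j, k) \<notin> \<Sigma>" for k
  proof
    assume "(j, k) \<in> \<Sigma>"
    then have "j \<in> negI m" using \<Sigma> SigPlus_atypical by (fastforce simp: atypical_iff)
    with j show False using index_not_both by blast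
  qed
  ultimately show "exch f \<Sigma> j = f i" using ij by (auto simp: exch_def)
next
  assume "k \<notin> fst ` \<Sigma>" "k \<notin> snd ` \<Sigma>"
  then show "exch f \<Sigma> k = f k" by (force simp: exch_def)
qed

lemma flips_eq:
  assumes f: "f \<in> Zp m n" and \<Sigma>: "\<Sigma> \<subseteq> SigPlus m n f" and p: "p \<in> SigPlus m n f"
  shows "flips m n f \<Sigma> (f (fst p)) = (if p \<in> \<Sigma> then opn else cls)"
    "flips m n f \<Sigma> (f (snd p)) = (if p \<in> \<Sigma> then cls else opn)"
proof -
  have v: "f (fst p) = f (fst p') \<longleftrightarrow> p = p'" "f (snd p) = f (snd p') \<longleftrightarrow> p = p'"
    "f (fst p) \<noteq> f (snd p')" "f (snd p) \<noteq> f (fst p')" if "p' \<in> \<Sigma>" for p'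
    using SigPlus_values [OF f p, of p'] SigPlus_values(3) [OF f _ p, of p'] that \<Sigma> by auto
  have "st m n f (f (fst p)) = cls" "st m n f (f (snd p)) = opn"
    using SigPlus_atypical [OF p] by (cases p; simp add: atypical_iff)+
  with v show "flips m n f \<Sigma> (f (fst p)) = (if p \<in> \<Sigma> then opn else cls)"
    "flips m n f \<Sigma> (f (snd p)) = (if p \<in> \<Sigma> then cls else opn)"
    unfolding flips_def by (smt (verit))+
qed

lemma Wt_flips:
  assumes f: "f \<in> Zp m n" and \<Sigma>: "\<Sigma> \<subseteq> SigPlus m n f"
  shows "Wt (st m n f) (cups m n f) (flips m n f \<Sigma>) \<noteq> 0"
proof -
  have fin: "finite (cups m n f)" by (simp add: cups_def)
  have "x = f (fst p) \<or> x = f (snd p) \<Longrightarrow> p \<in> \<Sigma> \<Longrightarrow> x \<in> verts (cups m n f)" for x p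
    using \<Sigma> by (cases p) (force simp: verts_def cups_def)
  then have "x \<notin> verts (cups m n f) \<Longrightarrow> flips m n f \<Sigma> x = st m n f x" for x
    unfolding flips_def by meson
  moreover have "flips m n f \<Sigma> b = opn \<and> flips m n f \<Sigma> a = cls \<or>
      flips m n f \<Sigma> b = cls \<and> flips m n f \<Sigma> a = opn" if ba: "(b, a) \<in> cups m n f" for b a
  proof -
    obtain i j where "(i, j) \<in> SigPlus m n f" "b = f j" "a = f i"
      using ba by (auto simp: cups_def)
    then show ?thesis using flips_eq [OF f \<Sigma>, of "(i, j)"] by simp
  qed
  ultimately show ?thesis unfolding Wt_nonzero_iff [OF fin] by blast
qed

lemma exch_images:
  assumes f: "f \<in> Zp m n" and \<Sigma>: "\<Sigma> \<subseteq> SigPlus m n f"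
  shows "x \<in> exch f \<Sigma> ` negI m \<longleftrightarrow> fst (flips m n f \<Sigma> x)"
    "x \<in> exch f \<Sigma> ` posI n \<longleftrightarrow> snd (flips m n f \<Sigma> x)"
proof -
  note ex = exch_eq [OF f \<Sigma>]
  have at: "i \<in> negI m" "j \<in> posI n" "st m n f (f i) = cls" "st m n f (f j) = opn" if "(i, j) \<in> \<Sigma>" for i j
    using that \<Sigma> SigPlus_atypical by (fastforce simp: atypical_iff)+
  consider (1) i j where "(i, j) \<in> \<Sigma>" "x = f i" | (2) i j where "(i, j) \<in> \<Sigma>" "x = f j"
    | (3) "\<forall>p\<in>\<Sigma>. x \<noteq> f (fst p) \<and> x \<noteq> f (snd p)" by force
  then have "(x \<in> exch f \<Sigma> ` negI m \<longleftrightarrow> fst (flips m n f \<Sigma> x)) \<and>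
    (x \<in> exch f \<Sigma> ` posI n \<longleftrightarrow> snd (flips m n f \<Sigma> x))"
  proof cases
    case 1
    then have "flips m n f \<Sigma> x = opn" using flips_eq(1) [OF f \<Sigma>, of "(i, j)"] \<Sigma> by auto
    moreover have "x \<in> exch f \<Sigma> ` posI n" using ex(2) [OF 1(1)] 1 at [OF 1(1)] by force
    moreover have "x \<noteq> exch f \<Sigma> k" if k: "k \<in> negI m" for k
    proof (cases "k \<in> fst ` \<Sigma>")
      case True
      then obtain l where l: "(k, l) \<in> \<Sigma>" by auto
      then show ?thesis using ex(1) [OF l] at(4) [OF l] at(3) [OF 1(1)] 1(2) by auto
    next
      case False
      moreover have "k \<notin> snd ` \<Sigma>" using at(2) k index_not_both by force
      ultimately have "exch f \<Sigma> k = f k" using ex(3) by blast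
      moreover have "k \<noteq> i" using False 1(1) by force
      ultimately show ?thesis using Zp_inj(1) [OF f] at(1) [OF 1(1)] k 1(2) by (auto simp: inj_on_def)
    qed
    then have "x \<notin> exch f \<Sigma> ` negI m" by blast
    ultimately show ?thesis by simp
  next
    case 2
    then have "flips m n f \<Sigma> x = cls" using flips_eq(2) [OF f \<Sigma>, of "(i, j)"] \<Sigma> by auto
    moreover have "x \<in> exch f \<Sigma> ` negI m" using ex(1) [OF 2(1)] 2 at [OF 2(1)] by force
    moreover have "x \<noteq> exch f \<Sigma> k" if k: "k \<in> posI n" for k
    proof (cases "k \<in> snd ` \<Sigma>")
      case True
      then obtain l where l: "(l, k) \<in> \<Sigma>" by auto
      then show ?thesis using ex(2) [OF l] at(3) [OF l] at(4) [OF 2(1)] 2(2) by auto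
    next
      case False
      moreover have "k \<notin> fst ` \<Sigma>" using at(1) k index_not_both by force
      ultimately have "exch f \<Sigma> k = f k" using ex(3) by blast
      moreover have "k \<noteq> j" using False 2(1) by force
      ultimately show ?thesis using Zp_inj(2) [OF f] at(2) [OF 2(1)] k 2(2) by (auto simp: inj_on_def)
    qed
    then have "x \<notin> exch f \<Sigma> ` posI n" by blast
    ultimately show ?thesis by simp
  next
    case 3
    then have fl: "flips m n f \<Sigma> x = st m n f x" unfolding flips_def by meson
    have img: "x = exch f \<Sigma> k \<longleftrightarrow> x = f k" for k
    proof -
      consider l where "(k, l) \<in> \<Sigma>" | l where "(l, k) \<in> \<Sigma>" | "k \<notin> fst ` \<Sigma>" "k \<notin> snd ` \<Sigma>" by force
      then show ?thesis
      proof cases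
        case (1 l)
        then show ?thesis using 3 ex(1) [OF 1] by force
      next
        case (2 l)
        then show ?thesis using 3 ex(2) [OF 2] by force
      qed (use ex(3) in auto)
    qed
    show ?thesis unfolding fl by (simp add: st_def image_iff img)
  qed
  then show "x \<in> exch f \<Sigma> ` negI m \<longleftrightarrow> fst (flips m n f \<Sigma> x)"
    "x \<in> exch f \<Sigma> ` posI n \<longleftrightarrow> snd (flips m n f \<Sigma> x)" by blast+
qed

text \<open>Justifies the definite description in \<open>fSig\<close>. Existence is read off from
  \<open>Wt_support\<close>, because the flipped label lies in the support; the two images determine
  an element of \<open>Zp m n\<close>.\<close>

lemma fSig_props:
  assumes f: "f \<in> Zp m n" and \<Sigma>: "\<Sigma> \<subseteq> SigPlus m n f"
  shows "fSig m n f \<Sigma> \<in> Zp m n" "st m n (fSig m n f \<Sigma>) = flips m n f \<Sigma>"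
proof -
  obtain h where h: "h \<in> Zp m n" "st m n h = flips m n f \<Sigma>"
    using Wt_support [OF f cupd_cups [OF f] Wt_flips [OF f \<Sigma>]] by blast
  have "x \<in> h ` negI m \<longleftrightarrow> x \<in> exch f \<Sigma> ` negI m" "x \<in> h ` posI n \<longleftrightarrow> x \<in> exch f \<Sigma> ` posI n" for x
    unfolding exch_images [OF f \<Sigma>] h(2) [symmetric] by (simp_all add: st_def)
  then have img: "h ` negI m = exch f \<Sigma> ` negI m" "h ` posI n = exch f \<Sigma> ` posI n" by blast+
  have "fSig m n f \<Sigma> = h"
    unfolding fSig_def
  proof (rule the_equality)
    fix h' assume "h' \<in> Zp m n \<and> h' ` negI m = exch f \<Sigma> ` negI m \<and> h' ` posI n = exch f \<Sigma> ` posI n"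
    then show "h' = h" using Zp_eqI [of h' m n h] h(1) img by simp
  qed (use h img in simp)
  with h show "fSig m n f \<Sigma> \<in> Zp m n" "st m n (fSig m n f \<Sigma>) = flips m n f \<Sigma>" by simp_all
qed

lemma W_eq_sum:
  assumes f: "f \<in> Zp m n"
  shows "W m n f g = (\<Sum>\<Sigma>\<in>Pow (SigPlus m n f). if fSig m n f \<Sigma> = g then qq ^ card \<Sigma> else 0)"
    and "W m n f g \<noteq> 0 \<Longrightarrow> \<exists>\<Sigma>\<in>Pow (SigPlus m n f). g = fSig m n f \<Sigma>"
proof -
  let ?S = "SigPlus m n f" and ?M = "cups m n f"
  have fin: "finite ?M" by (simp add: cups_def)
  \<comment> \<open>The only subset that can produce \<open>g\<close>, recovered from its label as
    the pairs whose opening vertex now reads \<open>cls\<close>. So at most one summand is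
    nonzero.\<close>
  define D where "D = {p \<in> ?S. st m n g (f (snd p)) = cls}"
  have uniq: "\<Sigma> = D" if "\<Sigma> \<in> Pow ?S" "fSig m n f \<Sigma> = g" for \<Sigma>
  proof -
    have "\<Sigma> = {p \<in> ?S. flips m n f \<Sigma> (f (snd p)) = cls}"
      using that(1) flips_eq(2) [OF f, of \<Sigma>] by (auto split: if_splits)
    also have "\<dots> = D" using fSig_props(2) [OF f, of \<Sigma>] that by (simp add: D_def)
    finally show ?thesis .
  qed
  have D: "D \<subseteq> ?S" by (auto simp: D_def)
  have g: "fSig m n f D = g" if nz: "W m n f g \<noteq> 0"
  proof -
    have gZ: "g \<in> Zp m n" and nz': "Wt (st m n f) ?M (st m n g) \<noteq> 0"
      using nz by (auto simp: W_def split: if_splits)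
    have "st m n g x = flips m n f D x" for x
    proof (cases "x \<in> verts ?M")
      case True
      then obtain p where p: "p \<in> ?S" "x = f (fst p) \<or> x = f (snd p)"
        by (auto simp: verts_def cups_def)
      then have "(f (snd p), f (fst p)) \<in> ?M" by (cases p) (force simp: cups_def)
      then have "st m n g (f (snd p)) = opn \<and> st m n g (f (fst p)) = cls \<or>
        st m n g (f (snd p)) = cls \<and> st m n g (f (fst p)) = opn"
        using nz' unfolding Wt_nonzero_iff [OF fin] by blast
      then show ?thesis using p flips_eq [OF f D p(1)] by (auto simp: D_def)
    next
      case False
      then show ?thesis
        using nz' Wt_flips [OF f D] unfolding Wt_nonzero_iff [OF fin] by auto
    qed
    then have "st m n (fSig m n f D) = st m n g" using fSig_props(2) [OF f D] by auto
    then show ?thesis using st_inj [OF fSig_props(1) [OF f D] gZ] by blast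
  qed
  show "\<exists>\<Sigma>\<in>Pow ?S. g = fSig m n f \<Sigma>" if "W m n f g \<noteq> 0" using g [OF that] D by blast
  show "W m n f g = (\<Sum>\<Sigma>\<in>Pow ?S. if fSig m n f \<Sigma> = g then qq ^ card \<Sigma> else 0)"
  proof (cases "fSig m n f D = g")
    case True
    have gZ: "g \<in> Zp m n" using fSig_props(1) [OF f D] True by simp
    have stg: "st m n g = flips m n f D" using fSig_props(2) [OF f D] True by simp
    have "{p \<in> ?M. st m n g (fst p) = cls} = (\<lambda>(i, j). (f j, f i)) ` D"
      by (force simp: cups_def D_def)
    moreover have "inj_on (\<lambda>(i, j). (f j, f i)) D"
    proof (rule inj_onI)
      fix p p' assume p: "p \<in> D" "p' \<in> D" and "(case p of (i, j) \<Rightarrow> (f j, f i)) = (case p' of (i, j) \<Rightarrow> (f j, f i))"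
      then have "f (fst p) = f (fst p')" by (simp add: case_prod_unfold)
      moreover have "p \<in> ?S" "p' \<in> ?S" using p D by blast+
      ultimately show "p = p'" using SigPlus_values(1) [OF f] by blast
    qed
    ultimately have "card {p \<in> ?M. st m n g (fst p) = cls} = card D" by (simp add: card_image)
    then have "W m n f g = qq ^ card D"
      using Wt_eq_power [OF fin Wt_flips [OF f D]] gZ stg by (simp add: W_def)
    moreover have "(\<Sum>\<Sigma>\<in>Pow ?S. if fSig m n f \<Sigma> = g then qq ^ card \<Sigma> else 0)
      = (\<Sum>\<Sigma>\<in>Pow ?S. if \<Sigma> = D then qq ^ card D else 0)"
    proof (intro sum.cong refl)
      fix \<Sigma> assume "\<Sigma> \<in> Pow ?S"
      then have "fSig m n f \<Sigma> = g \<longleftrightarrow> \<Sigma> = D" using uniq True by blast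
      then show "(if fSig m n f \<Sigma> = g then qq ^ card \<Sigma> else 0) = (if \<Sigma> = D then qq ^ card D else 0)"
        by simp
    qed
    ultimately show ?thesis using D by simp
  next
    case False
    then have "W m n f g = 0" using g by blast
    moreover have "fSig m n f \<Sigma> \<noteq> g" if "\<Sigma> \<in> Pow ?S" for \<Sigma>
      using uniq [OF that] False by blast
    then have "(\<Sum>\<Sigma>\<in>Pow ?S. if fSig m n f \<Sigma> = g then qq ^ card \<Sigma> else 0) = 0"
      by (intro sum.neutral) simp
    ultimately show ?thesis by simp
  qed
qed

lemma W_Evec:
  assumes f: "f \<in> Zp m n"
  shows "W m n f \<in> Evec m n"
proof -
  have "{g. W m n f g \<noteq> 0} \<subseteq> fSig m n f ` Pow (SigPlus m n f)"
    using W_eq_sum(2) [OF f] by blast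
  then have "finite {g. W m n f g \<noteq> 0}" by (rule finite_subset) simp
  then show ?thesis using W_nonzeroD [OF f] by (simp add: Evec_def)
qed

section \<open>Action of the generators on the canonical vectors\<close>

text \<open>Identifies the case distinction in \<open>gop\<close> with the two summands of the
  coproduct of \<open>F_a\<close>. The power of q may be read off the output \<open>t\<close>, since
  the summand carrying it leaves the first tensor factor unchanged.\<close>

lemma gop_False:
  "gop False a \<phi> t =
     (if fst (t (a + 1)) \<and> \<not> fst (t a)
      then \<phi> (t(a := (True, snd (t a)), a + 1 := (False, snd (t (a + 1))))) else 0) +
     (if snd (t (a + 1)) \<and> \<not> snd (t a)
      then qpow ((if fst (t a) then 1 else 0) - (if fst (t (a + 1)) then 1 else 0)) *
        \<phi> (t(a := (fst (t a), True), a + 1 := (fst (t (a + 1)), False))) else 0)"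
proof -
  obtain p q r w where t: "t a = (p, q)" "t (a + 1) = (r, w)" by (metis surj_pair)
  show ?thesis
    unfolding gop_def t by (cases p; cases q; cases r; cases w) simp_all
qed

lemma gop_True:
  "gop True a \<phi> t =
     (if snd (t a) \<and> \<not> snd (t (a + 1))
      then \<phi> (t(a := (fst (t a), False), a + 1 := (fst (t (a + 1)), True))) else 0) +
     (if fst (t a) \<and> \<not> fst (t (a + 1))
      then qpow (- ((if snd (t a) then 1 else 0) - (if snd (t (a + 1)) then 1 else 0))) *
        \<phi> (t(a := (False, snd (t a)), a + 1 := (True, snd (t (a + 1))))) else 0)"
proof -
  obtain p q r w where t: "t a = (p, q)" "t (a + 1) = (r, w)" by (metis surj_pair)
  show ?thesis
    unfolding gop_def t by (cases p; cases q; cases r; cases w) simp_all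
qed

lemma st_repl_neg:
  assumes f: "f \<in> Zp m n" and ab: "b = a + 1 \<or> a = b + 1" and s: "fst (st m n f a)" "\<not> fst (st m n f b)"
  shows "repl f (negI m) a b \<in> Zp m n"
    "st m n (repl f (negI m) a b) = (st m n f)(a := (False, snd (st m n f a)), b := (True, snd (st m n f b)))"
proof -
  have "a \<in> f ` negI m" "b \<notin> f ` negI m" using s by (simp_all add: st_def)
  note R = Zp_repl_neg [OF f ab this]
  show "repl f (negI m) a b \<in> Zp m n" by (rule R)
  show "st m n (repl f (negI m) a b) = (st m n f)(a := (False, snd (st m n f a)), b := (True, snd (st m n f b)))"
    using ab by (auto simp: fun_eq_iff st_def R(2,3))
qed

lemma st_repl_pos:
  assumes f: "f \<in> Zp m n" and ab: "b = a + 1 \<or> a = b + 1" and s: "snd (st m n f a)" "\<not> snd (st m n f b)"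
  shows "repl f (posI n) a b \<in> Zp m n"
    "st m n (repl f (posI n) a b) = (st m n f)(a := (fst (st m n f a), False), b := (fst (st m n f b), True))"
proof -
  have "a \<in> f ` posI n" "b \<notin> f ` posI n" using s by (simp_all add: st_def)
  note R = Zp_repl_pos [OF f ab this]
  show "repl f (posI n) a b \<in> Zp m n" by (rule R)
  show "st m n (repl f (posI n) a b) = (st m n f)(a := (fst (st m n f a), False), b := (fst (st m n f b), True))"
    using ab by (auto simp: fun_eq_iff st_def R(2,3))
qed

text \<open>Each elementary move is undone by the opposite move. So \<open>h\<close> has at most one
  preimage under each summand of a generator, and the sum in \<open>lin\<close> collapses to
  explicit coefficients.\<close>

lemma repl_inverse_iff:
  assumes "a \<noteq> b"
  shows "a \<in> g ` P \<and> b \<notin> g ` P \<and> h = repl g P a b \<longleftrightarrow> b \<in> h ` P \<and> a \<notin> h ` P \<and> g = repl h P b a"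
proof -
  have "b \<in> h ` P \<and> a \<notin> h ` P \<and> g = repl h P b a"
    if "a \<noteq> b" and *: "a \<in> g ` P" "b \<notin> g ` P" "h = repl g P a b" for a b g h
  proof (intro conjI)
    show "b \<in> h ` P" using * by (force simp: repl_def)
    show "a \<notin> h ` P" using * \<open>a \<noteq> b\<close> by (auto simp: repl_def)
    show "g = repl h P b a" using * by (auto simp: repl_def fun_eq_iff)
  qed
  from this [of a b g h] this [of b a h g] assms show ?thesis by blast
qed

lemma repl_image_other:
  "P \<inter> Q = {} \<Longrightarrow> repl g P a b ` Q = g ` Q"
  by (intro image_cong refl) (auto simp: repl_def)

lemma sum_support_eq:
  fixes u :: vec
  assumes "finite {g. u g \<noteq> 0}"
  shows "(\<Sum>g\<in>{g. u g \<noteq> 0}. u g * (if C \<and> g = g' then c else 0)) = (if C then c * u g' else 0)"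
proof (cases "C \<and> u g' \<noteq> 0")
  case True
  then have "(\<Sum>g\<in>{g. u g \<noteq> 0}. u g * (if C \<and> g = g' then c else 0)) =
    (\<Sum>g\<in>{g. u g \<noteq> 0}. if g = g' then c * u g' else 0)"
    by (intro sum.cong) auto
  then show ?thesis using True assms by simp
next
  case False
  then show ?thesis by (auto intro!: sum.neutral)
qed

lemma actF_eq:
  assumes u: "u \<in> Evec m n"
  shows "actF m n a u h =
     (if a + 1 \<in> h ` negI m \<and> a \<notin> h ` negI m then u (repl h (negI m) (a + 1) a) else 0) +
     (if a + 1 \<in> h ` posI n \<and> a \<notin> h ` posI n
      then qpow (eexp (h ` negI m) a) * u (repl h (posI n) (a + 1) a) else 0)"
proof -
  have fin: "finite {g. u g \<noteq> 0}" using u by (simp add: Evec_def)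
  have "Fb m n a g h =
      (if (a + 1 \<in> h ` negI m \<and> a \<notin> h ` negI m) \<and> g = repl h (negI m) (a + 1) a then 1 else 0) +
      (if (a + 1 \<in> h ` posI n \<and> a \<notin> h ` posI n) \<and> g = repl h (posI n) (a + 1) a
       then qpow (eexp (h ` negI m) a) else 0)" for g
  proof -
    have "repl h (posI n) (a + 1) a ` negI m = h ` negI m"
      by (rule repl_image_other) (use index_disjoint in blast)
    then show ?thesis
      using repl_inverse_iff [of a "a + 1" g "negI m" h] repl_inverse_iff [of a "a + 1" g "posI n" h]
      unfolding Fb_def Let_def by (auto simp del: add_diff_cancel)
  qed
  then show ?thesis
    unfolding actF_def lin_def
    by (simp only: distrib_left sum.distrib sum_support_eq [OF fin]) simp
qed

lemma actE_eq:
  assumes u: "u \<in> Evec m n"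
  shows "actE m n a u h =
     (if a \<in> h ` posI n \<and> a + 1 \<notin> h ` posI n then u (repl h (posI n) a (a + 1)) else 0) +
     (if a \<in> h ` negI m \<and> a + 1 \<notin> h ` negI m
      then qpow (- eexp (h ` posI n) a) * u (repl h (negI m) a (a + 1)) else 0)"
proof -
  have fin: "finite {g. u g \<noteq> 0}" using u by (simp add: Evec_def)
  have "Eb m n a g h =
      (if (a \<in> h ` posI n \<and> a + 1 \<notin> h ` posI n) \<and> g = repl h (posI n) a (a + 1) then 1 else 0) +
      (if (a \<in> h ` negI m \<and> a + 1 \<notin> h ` negI m) \<and> g = repl h (negI m) a (a + 1)
       then qpow (- eexp (h ` posI n) a) else 0)" for g
  proof -
    have "repl h (negI m) a (a + 1) ` posI n = h ` posI n"
      by (rule repl_image_other) (use index_disjoint in blast)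
    then show ?thesis
      using repl_inverse_iff [of "a + 1" a g "negI m" h] repl_inverse_iff [of "a + 1" a g "posI n" h]
      unfolding Eb_def Let_def by (auto simp del: add_diff_cancel)
  qed
  then show ?thesis
    unfolding actE_def lin_def
    by (simp only: distrib_left sum.distrib sum_support_eq [OF fin]) simp
qed

lemma repl_notin_Zp:
  assumes "h \<notin> Zp m n" "a \<in> h ` P" "b \<notin> h ` P" "P = negI m \<or> P = posI n" "b = a + 1 \<or> a = b + 1"
  shows "repl h P a b \<notin> Zp m n"
proof
  assume g: "repl h P a b \<in> Zp m n"
  have "a \<noteq> b" using assms by auto
  then have "b \<in> repl h P a b ` P" "a \<notin> repl h P a b ` P" "h = repl (repl h P a b) P b a"
    using repl_inverse_iff [of a b h P "repl h P a b"] assms by blast+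
  then have "h \<in> Zp m n"
    using Zp_repl_neg(1) [OF g, of a b] Zp_repl_pos(1) [OF g, of a b] assms(4,5) by metis
  with assms(1) show False ..
qed

lemma actF_W:
  assumes f: "f \<in> Zp m n"
  shows "actF m n a (W m n f) h =
    (if h \<in> Zp m n then gop False a (Wt (st m n f) (cups m n f)) (st m n h) else 0)"
proof (cases "h \<in> Zp m n")
  case True
  have 1: "W m n f (repl h (negI m) (a + 1) a) = Wt (st m n f) (cups m n f)
     ((st m n h)(a := (True, snd (st m n h a)), a + 1 := (False, snd (st m n h (a + 1)))))"
    if "fst (st m n h (a + 1))" "\<not> fst (st m n h a)"
    using st_repl_neg [OF True _ that] by (simp add: W_def fun_upd_twist)
  have 2: "W m n f (repl h (posI n) (a + 1) a) = Wt (st m n f) (cups m n f)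
     ((st m n h)(a := (fst (st m n h a), True), a + 1 := (fst (st m n h (a + 1)), False)))"
    if "snd (st m n h (a + 1))" "\<not> snd (st m n h a)"
    using st_repl_pos [OF True _ that] by (simp add: W_def fun_upd_twist)
  have s: "x \<in> h ` negI m \<longleftrightarrow> fst (st m n h x)" "x \<in> h ` posI n \<longleftrightarrow> snd (st m n h x)" for x
    by (simp_all add: st_def)
  show ?thesis
    unfolding actF_eq [OF W_Evec [OF f]] gop_False eexp_def s using 1 2 True by simp
next
  case False
  then show ?thesis
    unfolding actF_eq [OF W_Evec [OF f]]
    using repl_notin_Zp [OF False, of "a + 1" _ a] by (auto simp: W_def)
qed

lemma actE_W:
  assumes f: "f \<in> Zp m n"
  shows "actE m n a (W m n f) h =
    (if h \<in> Zp m n then gop True a (Wt (st m n f) (cups m n f)) (st m n h) else 0)"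
proof (cases "h \<in> Zp m n")
  case True
  have 1: "W m n f (repl h (negI m) a (a + 1)) = Wt (st m n f) (cups m n f)
     ((st m n h)(a := (False, snd (st m n h a)), a + 1 := (True, snd (st m n h (a + 1)))))"
    if "fst (st m n h a)" "\<not> fst (st m n h (a + 1))"
    using st_repl_neg [OF True _ that] by (simp add: W_def fun_upd_twist)
  have 2: "W m n f (repl h (posI n) a (a + 1)) = Wt (st m n f) (cups m n f)
     ((st m n h)(a := (fst (st m n h a), False), a + 1 := (fst (st m n h (a + 1)), True)))"
    if "snd (st m n h a)" "\<not> snd (st m n h (a + 1))"
    using st_repl_pos [OF True _ that] by (simp add: W_def fun_upd_twist)
  have s: "x \<in> h ` negI m \<longleftrightarrow> fst (st m n h x)" "x \<in> h ` posI n \<longleftrightarrow> snd (st m n h x)" for x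
    by (simp_all add: st_def)
  show ?thesis
    unfolding actE_eq [OF W_Evec [OF f]] gop_True eexp_def s using 1 2 True by simp
next
  case False
  then show ?thesis
    unfolding actE_eq [OF W_Evec [OF f]]
    using repl_notin_Zp [OF False, of a _ "a + 1"] by (auto simp: W_def)
qed

text \<open>If a vector of the form \<open>Wt s M\<close> occurs in the image, its label \<open>s\<close> is realised by a
  labelling in \<^term>\<open>Zp m n\<close>, because \<open>s\<close> itself has nonzero coefficient.\<close>

lemma gop_realised:
  assumes f: "f \<in> Zp m n" and nz: "gop u a (Wt (st m n f) (cups m n f)) t \<noteq> 0"
  shows "\<exists>g\<in>Zp m n. st m n g = t"
proof -
  let ?\<phi> = "Wt (st m n f) (cups m n f)"
  have ex: "\<exists>h\<in>Zp m n. st m n h = t'" if "?\<phi> t' \<noteq> 0" for t'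
    using Wt_support [OF f cupd_cups [OF f] that] by blast
  have moves: "\<exists>g\<in>Zp m n. st m n g = t"
    if nz: "fst (t y) \<and> \<not> fst (t x) \<and> ?\<phi> (t(x := (True, snd (t x)), y := (False, snd (t y)))) \<noteq> 0 \<or>
      snd (t y) \<and> \<not> snd (t x) \<and> ?\<phi> (t(x := (fst (t x), True), y := (fst (t y), False))) \<noteq> 0"
      (is "?A \<or> ?B") and xy: "y = x + 1 \<or> x = y + 1" for x y
    using nz
  proof
    assume A: ?A
    then obtain h where h: "h \<in> Zp m n" "st m n h = t(x := (True, snd (t x)), y := (False, snd (t y)))"
      using ex by blast
    have "fst (st m n h x)" "\<not> fst (st m n h y)" using h(2) xy by auto
    note R = st_repl_neg [OF h(1) xy this]
    have "st m n (repl h (negI m) x y) = t"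
      unfolding R(2) h(2) using A xy by (auto simp: fun_eq_iff prod_eq_iff)
    with R(1) show ?thesis by blast
  next
    assume B: ?B
    then obtain h where h: "h \<in> Zp m n" "st m n h = t(x := (fst (t x), True), y := (fst (t y), False))"
      using ex by blast
    have "snd (st m n h x)" "\<not> snd (st m n h y)" using h(2) xy by auto
    note R = st_repl_pos [OF h(1) xy this]
    have "st m n (repl h (posI n) x y) = t"
      unfolding R(2) h(2) using B xy by (auto simp: fun_eq_iff prod_eq_iff)
    with R(1) show ?thesis by blast
  qed
  show ?thesis
  proof (cases u)
    case False
    then have "fst (t (a + 1)) \<and> \<not> fst (t a) \<and> ?\<phi> (t(a := (True, snd (t a)), a + 1 := (False, snd (t (a + 1))))) \<noteq> 0 \<or>
      snd (t (a + 1)) \<and> \<not> snd (t a) \<and> ?\<phi> (t(a := (fst (t a), True), a + 1 := (fst (t (a + 1)), False))) \<noteq> 0"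
      using nz by (auto simp: gop_False split: if_splits)
    then show ?thesis by (rule moves) simp
  next
    case True
    then have "fst (t a) \<and> \<not> fst (t (a + 1)) \<and> ?\<phi> (t(a := (False, snd (t a)), a + 1 := (True, snd (t (a + 1))))) \<noteq> 0 \<or>
      snd (t a) \<and> \<not> snd (t (a + 1)) \<and> ?\<phi> (t(a := (fst (t a), False), a + 1 := (fst (t (a + 1)), True))) \<noteq> 0"
      using nz by (auto simp: gop_True split: if_splits)
    then show ?thesis using moves [of a "a + 1"] by (simp add: fun_upd_twist)
  qed
qed

lemma qbar_quantum_two: "qbar (qq + inverse qq) = qq + inverse qq"
  by (simp add: qbar_add qbar_inverse)

lemma act_W_multiple:
  assumes f: "f \<in> Zp m n"
    and X: "\<And>h. X h = (if h \<in> Zp m n then gop u a (Wt (st m n f) (cups m n f)) (st m n h) else 0)"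
  shows "\<exists>g\<in>Zp m n. \<exists>c. qbar c = c \<and> X = vsmult c (W m n g)"
proof -
  obtain s' M' c where M': "cupd s' M'" and c: "c = 0 \<or> c = 1 \<or> c = qq + inverse qq"
    and eq: "\<And>t. gop u a (Wt (st m n f) (cups m n f)) t = c * Wt s' M' t"
    using gop_Wt [OF cupd_cups [OF f]] by blast
  have qc: "qbar c = c" using c qbar_quantum_two by auto
  show ?thesis
  proof (cases "c = 0")
    case True
    then have "X = vsmult 0 (W m n f)" using X eq by (auto simp: vsmult_def)
    then show ?thesis using f by (intro bexI [of _ f] exI [of _ 0]) auto
  next
    case False
    then have "gop u a (Wt (st m n f) (cups m n f)) s' \<noteq> 0" by (simp add: eq Wt_self [OF M'])
    then obtain g where g: "g \<in> Zp m n" "st m n g = s'" using gop_realised [OF f] by blast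
    then have "cups m n g = M'" using cups_unique M' by blast
    then have "X = vsmult c (W m n g)" using g X eq by (auto simp: vsmult_def W_def)
    then show ?thesis using g(1) qc by blast
  qed
qed

lemma actF_W_multiple:
  "f \<in> Zp m n \<Longrightarrow> \<exists>g\<in>Zp m n. \<exists>c. qbar c = c \<and> actF m n a (W m n f) = vsmult c (W m n g)"
  by (rule act_W_multiple [where u = False, OF _ actF_W])

lemma actE_W_multiple:
  "f \<in> Zp m n \<Longrightarrow> \<exists>g\<in>Zp m n. \<exists>c. qbar c = c \<and> actE m n a (W m n f) = vsmult c (W m n g)"
  by (rule act_W_multiple [where u = True, OF _ actE_W])

section \<open>Generation from J-typical vectors, by descent on the total length of the
  pairs\<close>

definition spread :: "(int \<times> int) set \<Rightarrow> nat" where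
  "spread M = nat (\<Sum>(b, a)\<in>M. a - b)"

lemma spread_insert:
  assumes "finite M" "\<And>b a. (b, a) \<in> M \<Longrightarrow> b < a" "b < a" "(b, a) \<notin> M"
  shows "spread (insert (b, a) M) = nat (a - b) + spread M"
proof -
  have "0 \<le> (\<Sum>(b, a)\<in>M. a - b)"
    using assms(2) by (intro sum_nonneg) force
  then show ?thesis using assms by (simp add: spread_def nat_add_distrib)
qed

text \<open>An innermost cup is shortened by one step, or created if it has length one.\<close>

lemma W_generated:
  assumes f: "f \<in> Zp m n" and ne: "cups m n f \<noteq> {}"
  shows "\<exists>g\<in>Zp m n. \<exists>a. spread (cups m n g) < spread (cups m n f) \<and>
    (W m n f = actF m n a (W m n g) \<or> W m n f = actE m n a (W m n g))"
proof -
  let ?s = "st m n f" and ?M = "cups m n f"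
  note M = cupd_cups [OF f]
  obtain b c where bc: "(b, c) \<in> ?M" and min: "\<And>b' c'. (b', c') \<in> ?M \<Longrightarrow> nat (c - b) \<le> nat (c' - b')"
  proof -
    obtain p where "p \<in> ?M" by (use ne in blast)
    then show ?thesis
      using that arg_min_nat_lemma [of "\<lambda>p. p \<in> ?M" p "\<lambda>(b, c). nat (c - b)"]
      by (cases "arg_min (\<lambda>(b, c). nat (c - b)) (\<lambda>p. p \<in> ?M)") fastforce
  qed
  have lt: "b < c" and sbc: "?s b = opn" "?s c = cls" using cupdD(2-4) [OF M bc] .
  \<comment> \<open>A bracket strictly inside the shortest pair would, by stability against one of
    its ends, belong to a still shorter pair.\<close>
  have inner: "?s x \<noteq> opn \<and> ?s x \<noteq> cls" if x: "b < x" "x < c" for x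
  proof (intro conjI notI)
    assume "?s x = opn"
    from cupd_pair [OF M x(2) this sbc(2)] show False
    proof
      assume "rpair ?M x c"
      then obtain z where z: "z \<le> c" "(x, z) \<in> ?M" unfolding rpair_def by blast
      then show False using min [OF z(2)] cupdD(2) [OF M z(2)] x lt by auto
    next
      assume "lpair ?M x c"
      then obtain z where z: "x \<le> z" "(z, c) \<in> ?M" unfolding lpair_def by blast
      then show False using cupdD(6) [OF M bc z(2)] x by auto
    qed
  next
    assume "?s x = cls"
    from cupd_pair [OF M x(1) sbc(1) this] show False
    proof
      assume "rpair ?M b x"
      then obtain z where z: "z \<le> x" "(b, z) \<in> ?M" unfolding rpair_def by blast
      then show False using cupdD(5) [OF M bc z(2)] x by auto
    next
      assume "lpair ?M b x"
      then obtain z where z: "b \<le> z" "(z, x) \<in> ?M" unfolding lpair_def by blast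
      then show False using min [OF z(2)] cupdD(2) [OF M z(2)] x lt by auto
    qed
  qed
  obtain M0 where M0: "?M = insert (b, c) M0" "finite M0" "b \<notin> verts M0" "c \<notin> verts M0"
    using cupd_remove [OF M bc] by metis
  have M0lt: "y < z" if "(y, z) \<in> M0" for y z using cupdD(2) [OF M] M0(1) that by blast
  have nM0: "(b, z) \<notin> M0" for z using M0(3) verts_mem(1) by blast
  have spreadM: "spread ?M = nat (c - b) + spread M0"
    unfolding M0(1) using M0(2) M0lt lt nM0 by (intro spread_insert) auto
  show ?thesis
  proof (cases "c = b + 1")
    case True
    have st: "fst (?s (b + 1))" "\<not> fst (?s b)" using sbc True by auto
    let ?g = "repl f (negI m) (b + 1) b"
    \<comment> \<open>These are the labels from which \<open>F_b\<close> creates the pair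
      \<open>(b, b + 1)\<close>.\<close>
    let ?s' = "?s(b := (True, True), b + 1 := (False, False))"
    have g: "?g \<in> Zp m n" "st m n ?g = ?s'"
      using st_repl_neg [OF f _ st] sbc True by (auto simp: fun_upd_twist)
    have "cupd ?s' M0"
    proof (rule cupd_subI [OF M])
      fix x y assume xy: "x < y" "?s' x = opn" "?s' y = cls"
      then have n: "x \<noteq> b" "x \<noteq> b + 1" "y \<noteq> b" "y \<noteq> b + 1" by (auto split: if_splits)
      then show "rpair M0 x y \<or> lpair M0 x y"
        using cupd_pair [OF M, of x y] xy True unfolding M0(1) rpair_insert lpair_insert by simp
    qed (use M0 True in auto)
    then have cg: "cups m n ?g = M0" using cups_unique [OF g(1)] g(2) by simp
    have s: "?s'(b := opn, b + 1 := cls) = ?s" using sbc True by auto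
    have "W m n f = actF m n b (W m n ?g)"
    proof
      fix h
      show "W m n f h = actF m n b (W m n ?g) h"
        unfolding actF_W [OF g(1)] cg g(2)
        using gop_Wt_new [OF \<open>cupd ?s' M0\<close>, of b False "st m n h"] s M0(1) True
        by (simp add: W_def)
    qed
    moreover have "spread (cups m n ?g) < spread ?M"
      unfolding cg spreadM using lt by simp
    ultimately show ?thesis using g(1) by blast
  next
    case False
    then have "b < b + 1" "b + 1 < c" using lt by simp_all
    then have nb: "?s (b + 1) \<noteq> opn" "?s (b + 1) \<noteq> cls" using inner by blast+
    \<comment> \<open>The neutral label that the opening bracket must pass. It selects the generator
      that moves the bracket back from \<open>b + 1\<close> to \<open>b\<close>: \<open>F_b\<close>
      past \<open>(True, True)\<close>, \<open>E_b\<close> past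
      \<open>(False, False)\<close>.\<close>
    define v where "v = fst (?s (b + 1))"
    have v: "?s (b + 1) = (v, v)" using nb by (cases "?s (b + 1)") (auto simp: v_def)
    have nv: "b + 1 \<notin> verts ?M" using cupd_verts [OF M] nb by blast
    let ?s' = "\<lambda>x. ?s (shft b x)" and ?f = "\<lambda>(x, y). (shft b x, shft b y)"
    have M': "cupd ?s' (?f ` ?M)" using nb by (intro cupd_shft [OF M]) simp
    have "\<exists>g\<in>Zp m n. st m n g = ?s'"
    proof -
      have s': "?s' = ?s(b := ?s (b + 1), b + 1 := ?s b)" by (auto simp: shft_def)
      show ?thesis
      proof (cases v)
        case True
        then have "fst (?s (b + 1))" "\<not> fst (?s b)" using v sbc by auto
        from st_repl_neg [OF f _ this] show ?thesis
          unfolding s' using True v sbc by (auto simp: fun_upd_twist)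
      next
        case False
        then have "snd (?s b)" "\<not> snd (?s (b + 1))" using v sbc by auto
        from st_repl_pos [OF f _ this] show ?thesis
          unfolding s' using False v sbc by auto
      qed
    qed
    then obtain g where g: "g \<in> Zp m n" "st m n g = ?s'" by blast
    have cg: "cups m n g = ?f ` ?M" using cups_unique [OF g(1)] g(2) M' by simp
    have ff: "?f ` ?f ` ?M = ?M" by (force simp: image_iff)
    have ss: "(\<lambda>x. ?s' (shft b x)) = ?s" by simp
    have "(?s' b = opn \<or> ?s' b = cls) \<and> ?s' (b + 1) = (\<not> v, \<not> v) \<or>
        ?s' b = (\<not> \<not> v, \<not> \<not> v) \<and> (?s' (b + 1) = opn \<or> ?s' (b + 1) = cls)"
      by (simp add: shft_def v sbc)
    from gop_Wt_shft [OF M' this]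
    have eq: "gop (\<not> v) b (Wt ?s' (?f ` ?M)) t = Wt ?s ?M t" for t
      by (simp only: ff shft_shft)
    have "W m n f = (if v then actF m n b (W m n g) else actE m n b (W m n g))"
    proof
      fix h
      show "W m n f h = (if v then actF m n b (W m n g) else actE m n b (W m n g)) h"
        using eq [of "st m n h"] actF_W [OF g(1), of b h] actE_W [OF g(1), of b h] cg g(2)
        by (cases v) (simp_all add: W_def)
    qed
    moreover have "spread (cups m n g) < spread ?M"
    proof -
      have "?f p = p" if "p \<in> M0" for p
      proof (cases p)
        case (Pair y z)
        then have "y \<in> verts M0" "z \<in> verts M0" using verts_mem that by blast+
        moreover have "b + 1 \<notin> verts M0" using nv M0(1) by simp
        ultimately have "y \<noteq> b" "y \<noteq> b + 1" "z \<noteq> b" "z \<noteq> b + 1" using M0(3) by metis+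
        then show ?thesis using Pair by (simp add: shft_def)
      qed
      then have "?f ` M0 = M0" by force
      then have e: "?f ` ?M = insert (b + 1, c) M0"
        unfolding M0(1) using \<open>b + 1 < c\<close> by (simp add: shft_def)
      have "(b + 1, c) \<notin> M0" using M0(4) verts_mem(2) by blast
      then have "spread (?f ` ?M) = nat (c - (b + 1)) + spread M0"
        unfolding e using M0(2) M0lt \<open>b + 1 < c\<close> by (intro spread_insert) auto
      then show ?thesis unfolding cg spreadM using \<open>b + 1 < c\<close> by simp
    qed
    ultimately show ?thesis using g(1) by (metis (full_types))
  qed
qed

section \<open>Linear maps on the Fock space\<close>

definition vzero :: vec where "vzero = (\<lambda>_. 0)"

lemma Evec_vzero: "vzero \<in> Evec m n"
  by (simp add: Evec_def vzero_def)

lemma Evec_vadd: "u \<in> Evec m n \<Longrightarrow> v \<in> Evec m n \<Longrightarrow> vadd u v \<in> Evec m n"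
proof -
  assume uv: "u \<in> Evec m n" "v \<in> Evec m n"
  then have "finite ({g. u g \<noteq> 0} \<union> {g. v g \<noteq> 0})" by (simp add: Evec_def)
  then have "finite {g. vadd u v g \<noteq> 0}"
    by (rule rev_finite_subset) (auto simp: vadd_def)
  moreover have "g \<in> Zp m n" if "vadd u v g \<noteq> 0" for g
    using that uv by (cases "u g = 0") (auto simp: Evec_def vadd_def)
  ultimately show ?thesis by (simp add: Evec_def)
qed

lemma Evec_vsmult: "u \<in> Evec m n \<Longrightarrow> vsmult c u \<in> Evec m n"
proof -
  assume u: "u \<in> Evec m n"
  have "finite {g. vsmult c u g \<noteq> 0}"
    by (rule finite_subset [of _ "{g. u g \<noteq> 0}"]) (use u in \<open>auto simp: vsmult_def Evec_def\<close>)
  then show ?thesis using u by (simp add: Evec_def vsmult_def)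
qed

lemma Evec_Kb: "f \<in> Zp m n \<Longrightarrow> Kb f \<in> Evec m n"
  by (simp add: Evec_def Kb_def)

lemma Evec_induct [consumes 1, case_names zero add smult base]:
  assumes u: "u \<in> Evec m n" and zero: "P vzero"
    and add: "\<And>u v. u \<in> Evec m n \<Longrightarrow> v \<in> Evec m n \<Longrightarrow> P u \<Longrightarrow> P v \<Longrightarrow> P (vadd u v)"
    and smult: "\<And>c u. u \<in> Evec m n \<Longrightarrow> P u \<Longrightarrow> P (vsmult c u)"
    and base: "\<And>f. f \<in> Zp m n \<Longrightarrow> P (Kb f)"
  shows "P u"
proof -
  have "finite A \<Longrightarrow> A \<subseteq> Zp m n \<Longrightarrow>
      (\<lambda>g. if g \<in> A then u g else 0) \<in> Evec m n \<and> P (\<lambda>g. if g \<in> A then u g else 0)" for A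
  proof (induction A rule: finite_induct)
    case empty
    then show ?case using zero Evec_vzero by (simp add: vzero_def)
  next
    case (insert f A)
    have "(\<lambda>g. if g \<in> insert f A then u g else 0) =
        vadd (\<lambda>g. if g \<in> A then u g else 0) (vsmult (u f) (Kb f))"
      using insert.hyps(2) by (intro ext) (auto simp: vadd_def vsmult_def Kb_def)
    moreover have "f \<in> Zp m n" using insert.prems by simp
    ultimately show ?case
      using insert add smult base Evec_vadd Evec_vsmult Evec_Kb by auto
  qed
  from this [of "{g. u g \<noteq> 0}"] have "P (\<lambda>g. if g \<in> {g. u g \<noteq> 0} then u g else 0)"
    using u by (auto simp: Evec_def)
  moreover have "(\<lambda>g. if g \<in> {g. u g \<noteq> 0} then u g else 0) = u" by auto
  ultimately show ?thesis by simp
qed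

lemma lin_superset:
  assumes "finite A" "{g. u g \<noteq> 0} \<subseteq> A"
  shows "lin T u h = (\<Sum>g\<in>A. u g * T g h)"
  unfolding lin_def using assms by (intro sum.mono_neutral_left) auto

lemma lin_vzero: "lin T vzero = vzero"
  by (simp add: lin_def vzero_def)

lemma lin_vadd:
  assumes "u \<in> Evec m n" "v \<in> Evec m n"
  shows "lin T (vadd u v) = vadd (lin T u) (lin T v)"
proof
  fix h
  let ?A = "{g. u g \<noteq> 0} \<union> {g. v g \<noteq> 0}"
  have fin: "finite ?A" using assms by (simp add: Evec_def)
  have "lin T (vadd u v) h = (\<Sum>g\<in>?A. vadd u v g * T g h)"
    by (rule lin_superset [OF fin]) (auto simp: vadd_def)
  also have "\<dots> = (\<Sum>g\<in>?A. u g * T g h) + (\<Sum>g\<in>?A. v g * T g h)"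
    by (simp add: vadd_def algebra_simps sum.distrib)
  also have "\<dots> = lin T u h + lin T v h"
    using lin_superset [OF fin, of u T h] lin_superset [OF fin, of v T h] by simp
  finally show "lin T (vadd u v) h = vadd (lin T u) (lin T v) h" by (simp add: vadd_def)
qed

lemma lin_vsmult:
  assumes "u \<in> Evec m n"
  shows "lin T (vsmult c u) = vsmult c (lin T u)"
proof
  fix h
  have fin: "finite {g. u g \<noteq> 0}" using assms by (simp add: Evec_def)
  have "lin T (vsmult c u) h = (\<Sum>g\<in>{g. u g \<noteq> 0}. vsmult c u g * T g h)"
    by (rule lin_superset [OF fin]) (auto simp: vsmult_def)
  then show "lin T (vsmult c u) h = vsmult c (lin T u) h"
    by (simp add: vsmult_def lin_def sum_distrib_left mult.assoc)
qed

lemma lin_Kb: "lin T (Kb f) = T f"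
proof
  fix h
  have "lin T (Kb f) h = (\<Sum>g\<in>{f}. Kb f g * T g h)"
    by (rule lin_superset) (auto simp: Kb_def)
  then show "lin T (Kb f) h = T f h" by (simp add: Kb_def)
qed

lemma lin_Evec:
  assumes u: "u \<in> Evec m n" and T: "\<And>f. f \<in> Zp m n \<Longrightarrow> T f \<in> Evec m n"
  shows "lin T u \<in> Evec m n"
  using u
proof (induction rule: Evec_induct)
  case zero
  then show ?case by (simp add: lin_vzero Evec_vzero)
next
  case (add u v)
  then show ?case by (simp add: lin_vadd Evec_vadd)
next
  case (smult c u)
  then show ?case by (simp add: lin_vsmult Evec_vsmult)
next
  case (base f)
  then show ?case by (simp add: lin_Kb T)
qed

definition vbar :: "vec \<Rightarrow> vec" where "vbar u = (\<lambda>g. qbar (u g))"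

lemma vbar_simps:
  "vbar (vadd u v) = vadd (vbar u) (vbar v)" "vbar (vsmult c u) = vsmult (qbar c) (vbar u)"
  "vbar (vbar u) = u" "vbar (Kb f) = Kb f" "vbar vzero = vzero"
  by (auto simp: fun_eq_iff vbar_def vadd_def vsmult_def qbar_add qbar_mult Kb_def vzero_def)

lemma Evec_vbar: "u \<in> Evec m n \<Longrightarrow> vbar u \<in> Evec m n"
  by (simp add: Evec_def vbar_def)

section \<open>Change of basis\<close>

definition Phi :: "nat \<Rightarrow> nat \<Rightarrow> vec \<Rightarrow> vec" where "Phi m n = lin (W m n)"

lemma Phi_Evec: "c \<in> Evec m n \<Longrightarrow> Phi m n c \<in> Evec m n"
  unfolding Phi_def by (erule lin_Evec) (rule W_Evec)

text \<open>Any other \<open>W h\<close> with a coefficient at \<open>g\<close> would have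
  \<open>g\<close> strictly below \<open>h\<close>, against maximality of the height. Hence leading
  coefficients are unchanged by the change of basis.\<close>

lemma Phi_top_coeff:
  assumes c: "c \<in> Evec m n" and g: "c g \<noteq> 0"
    and max: "\<And>h. c h \<noteq> 0 \<Longrightarrow> height m n h \<le> height m n g"
  shows "Phi m n c g = c g"
proof -
  have fin: "finite {h. c h \<noteq> 0}" and Zp: "\<And>h. c h \<noteq> 0 \<Longrightarrow> h \<in> Zp m n"
    using c by (auto simp: Evec_def)
  have "W m n h g = 0" if "c h \<noteq> 0" "h \<noteq> g" for h
  proof (rule ccontr)
    assume "W m n h g \<noteq> 0"
    then have "bruhat_less m n g h" using W_nonzeroD(2) [OF Zp] that by blast
    from height_less [OF this] max [OF that(1)] show False by simp
  qed
  then have "Phi m n c g = (\<Sum>h\<in>{h. c h \<noteq> 0}. if h = g then c g else 0)"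
    unfolding Phi_def lin_def using W_self [OF Zp] by (intro sum.cong) auto
  then show ?thesis using fin g by simp
qed

lemma top_exists:
  assumes "c \<in> Evec m n" "c \<noteq> vzero"
  obtains g where "c g \<noteq> 0" "\<And>h. c h \<noteq> 0 \<Longrightarrow> height m n h \<le> height m n g"
proof -
  let ?S = "{h. c h \<noteq> 0}"
  have S: "finite ?S" "?S \<noteq> {}" using assms by (auto simp: Evec_def vzero_def)
  then have "Max (height m n ` ?S) \<in> height m n ` ?S" by (intro Max_in) auto
  then obtain g where "g \<in> ?S" "height m n g = Max (height m n ` ?S)" by force
  then show ?thesis using that [of g] S by simp
qed

lemma Phi_eq_vzero:
  assumes "c \<in> Evec m n" "Phi m n c = vzero"
  shows "c = vzero"
proof (rule ccontr)
  assume "c \<noteq> vzero"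
  then obtain g where "c g \<noteq> 0" "\<And>h. c h \<noteq> 0 \<Longrightarrow> height m n h \<le> height m n g"
    using top_exists assms(1) by metis
  then show False using Phi_top_coeff [OF assms(1), of g] assms(2) by (simp add: vzero_def)
qed

lemma Phi_inj:
  assumes "c \<in> Evec m n" "d \<in> Evec m n" "Phi m n c = Phi m n d"
  shows "c = d"
proof -
  let ?e = "vadd c (vsmult (- 1) d)"
  have e: "?e \<in> Evec m n" using assms by (intro Evec_vadd Evec_vsmult)
  have "Phi m n ?e = vadd (Phi m n c) (vsmult (- 1) (Phi m n d))"
    unfolding Phi_def using assms by (simp add: lin_vadd lin_vsmult Evec_vsmult)
  also have "\<dots> = vzero" using assms(3) by (auto simp: vadd_def vsmult_def vzero_def)
  finally have "?e = vzero" by (rule Phi_eq_vzero [OF e])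
  then show ?thesis by (auto simp: fun_eq_iff vadd_def vsmult_def vzero_def)
qed

lemma lin_sum:
  assumes "finite S" "\<And>g. g \<in> S \<Longrightarrow> v g \<in> Evec m n"
  shows "(\<lambda>h. \<Sum>g\<in>S. k g * v g h) \<in> Evec m n \<and>
    lin T (\<lambda>h. \<Sum>g\<in>S. k g * v g h) = (\<lambda>x. \<Sum>g\<in>S. k g * lin T (v g) x)"
  using assms
proof (induction S rule: finite_induct)
  case empty
  then show ?case using Evec_vzero lin_vzero [of T] by (simp add: vzero_def)
next
  case (insert f S)
  let ?u = "\<lambda>h. \<Sum>g\<in>S. k g * v g h"
  have eq: "(\<lambda>h. \<Sum>g\<in>insert f S. k g * v g h) = vadd (vsmult (k f) (v f)) ?u"
    using insert.hyps by (simp add: vadd_def vsmult_def)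
  have f: "v f \<in> Evec m n" and u: "?u \<in> Evec m n" using insert by auto
  have "lin T (vadd (vsmult (k f) (v f)) ?u) = vadd (vsmult (k f) (lin T (v f))) (lin T ?u)"
    by (simp add: lin_vadd [OF Evec_vsmult [OF f] u] lin_vsmult [OF f])
  moreover have "lin T ?u = (\<lambda>x. \<Sum>g\<in>S. k g * lin T (v g) x)" using insert by auto
  ultimately show ?case
    unfolding eq using insert.hyps f u by (auto simp: vadd_def vsmult_def intro: Evec_vadd [unfolded vadd_def] Evec_vsmult [unfolded vsmult_def])
qed

text \<open>Inversion of a unitriangular matrix, by recursion on the height. Only sums and products
  are involved, so the entries remain Laurent polynomials with integer coefficients.\<close>

lemma Kb_coordinates:
  assumes "f \<in> Zp m n"
  shows "\<exists>c\<in>Evec m n. Phi m n c = Kb f \<and> c f = 1 \<and>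
    (\<forall>g. c g \<noteq> 0 \<longrightarrow> (g = f \<or> bruhat_less m n g f) \<and> laurent_int (c g))"
  using assms
proof (induction "height m n f" arbitrary: f rule: less_induct)
  case less
  note f = less.prems
  let ?S = "{g. W m n f g \<noteq> 0} - {f}"
  have fin: "finite ?S" using W_Evec [OF f] by (simp add: Evec_def)
  have S: "g \<in> Zp m n \<and> bruhat_less m n g f" if "g \<in> ?S" for g
    using that W_nonzeroD [OF f, of g] by blast
  have "\<forall>g\<in>?S. \<exists>c. c \<in> Evec m n \<and> Phi m n c = Kb g \<and>
    (\<forall>h. c h \<noteq> 0 \<longrightarrow> (h = g \<or> bruhat_less m n h g) \<and> laurent_int (c h))"
  proof
    fix g assume "g \<in> ?S"
    then have g: "g \<in> Zp m n" "bruhat_less m n g f" using S by blast+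
    show "\<exists>c. c \<in> Evec m n \<and> Phi m n c = Kb g \<and>
      (\<forall>h. c h \<noteq> 0 \<longrightarrow> (h = g \<or> bruhat_less m n h g) \<and> laurent_int (c h))"
      using less.hyps [OF height_less [OF g(2)] g(1)] by blast
  qed
  from bchoice [OF this] obtain c where c: "\<And>g. g \<in> ?S \<Longrightarrow> c g \<in> Evec m n" "\<And>g. g \<in> ?S \<Longrightarrow> Phi m n (c g) = Kb g"
    "\<And>g h. g \<in> ?S \<Longrightarrow> c g h \<noteq> 0 \<Longrightarrow> (h = g \<or> bruhat_less m n h g) \<and> laurent_int (c g h)"
    by blast
  \<comment> \<open>The correction in \<open>K_f = W f - (sum of W f g * K_g over g < f)\<close>,
    with each \<open>K_g\<close> replaced by its coordinates from the induction hypothesis.\<close>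
  define s where "s = (\<lambda>h. \<Sum>g\<in>?S. - W m n f g * c g h)"
  have s: "s \<in> Evec m n" and Phis: "Phi m n s = (\<lambda>x. \<Sum>g\<in>?S. - W m n f g * Phi m n (c g) x)"
    using lin_sum [OF fin c(1), where k = "\<lambda>g. - W m n f g" and T = "W m n"]
    by (simp_all add: s_def Phi_def)
  define d where "d = vadd (Kb f) s"
  have d: "d \<in> Evec m n" unfolding d_def by (intro Evec_vadd Evec_Kb f s)
  have snz: "bruhat_less m n h f \<and> laurent_int (s h)" if "s h \<noteq> 0" for h
  proof
    obtain g where g: "g \<in> ?S" "c g h \<noteq> 0"
    proof (rule ccontr)
      assume "\<not> thesis"
      then have "\<forall>g\<in>?S. c g h = 0" using that by blast
      then have "s h = 0" by (simp add: s_def)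
      with \<open>s h \<noteq> 0\<close> show False ..
    qed
    then show "bruhat_less m n h f" using c(3) [OF g] S [OF g(1)] bruhat_less_trans by blast
    have "laurent_int (- W m n f g * c g h)" if "g \<in> ?S" for g
    proof (cases "c g h = 0")
      case True
      then show ?thesis by (simp add: laurent_int_0)
    next
      case False
      obtain k where "W m n f g = qq ^ k" using W_off_diagonal [OF f, of g] \<open>g \<in> ?S\<close> by blast
      then have "laurent_int (W m n f g)" by (simp add: laurent_int_qq_power)
      then show ?thesis using c(3) [OF that False] laurent_int_mult laurent_int_minus by blast
    qed
    then show "laurent_int (s h)" unfolding s_def by (rule laurent_int_sum)
  qed
  have sf: "s f = 0" using snz [of f] bruhat_less_irrefl by blast
  have "Phi m n d = vadd (W m n f) (Phi m n s)"
    unfolding d_def Phi_def by (simp add: lin_vadd [OF Evec_Kb [OF f] s] lin_Kb)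
  also have "\<dots> = Kb f"
  proof
    fix x
    have "Phi m n s x = (\<Sum>g\<in>?S. if g = x then - W m n f x else 0)"
      unfolding Phis using c(2) by (intro sum.cong) (auto simp: Kb_def)
    also have "\<dots> = (if x \<in> ?S then - W m n f x else 0)" using fin by simp
    finally show "vadd (W m n f) (Phi m n s) x = Kb f x"
      using W_self [OF f] by (auto simp: vadd_def Kb_def)
  qed
  finally have "Phi m n d = Kb f" .
  moreover have "d f = 1" by (simp add: d_def vadd_def Kb_def sf)
  moreover have "(h = f \<or> bruhat_less m n h f) \<and> laurent_int (d h)" if "d h \<noteq> 0" for h
  proof (cases "h = f")
    case True
    then show ?thesis using \<open>d f = 1\<close> laurent_int_qq_power [of 0] by simp
  next
    case False
    then have "d h = s h" by (simp add: d_def vadd_def Kb_def)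
    then show ?thesis using snz that by simp
  qed
  ultimately show ?case using d by blast
qed

lemma Phi_surj:
  assumes "u \<in> Evec m n"
  shows "\<exists>c\<in>Evec m n. Phi m n c = u"
  using assms
proof (induction rule: Evec_induct)
  case zero
  then show ?case using Evec_vzero lin_vzero unfolding Phi_def by blast
next
  case (add u v)
  then show ?case unfolding Phi_def using lin_vadd Evec_vadd by metis
next
  case (smult c u)
  then show ?case unfolding Phi_def using lin_vsmult Evec_vsmult by metis
next
  case (base f)
  then show ?case using Kb_coordinates by blast
qed

lemma Evec_W_induct [consumes 1, case_names zero add smult W]:
  assumes u: "u \<in> Evec m n" and zero: "P vzero"
    and add: "\<And>u v. u \<in> Evec m n \<Longrightarrow> v \<in> Evec m n \<Longrightarrow> P u \<Longrightarrow> P v \<Longrightarrow> P (vadd u v)"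
    and smult: "\<And>c u. u \<in> Evec m n \<Longrightarrow> P u \<Longrightarrow> P (vsmult c u)"
    and W: "\<And>f. f \<in> Zp m n \<Longrightarrow> P (W m n f)"
  shows "P u"
proof -
  obtain c where c: "c \<in> Evec m n" and u: "u = Phi m n c" using Phi_surj [OF u] by blast
  show ?thesis unfolding u using c
  proof (induction rule: Evec_induct)
    case zero
    then show ?case using assms(2) by (simp add: Phi_def lin_vzero)
  next
    case (add u v)
    then have "P (vadd (Phi m n u) (Phi m n v))" using assms(3) Phi_Evec by blast
    then show ?case using add unfolding Phi_def by (simp add: lin_vadd)
  next
    case (smult c u)
    then have "P (vsmult c (Phi m n u))" using assms(4) Phi_Evec by blast
    then show ?case using smult unfolding Phi_def by (simp add: lin_vsmult)
  next
    case (base f)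
    then show ?case using W by (simp add: Phi_def lin_Kb)
  qed
qed

section \<open>The bar involution\<close>

definition coord :: "nat \<Rightarrow> nat \<Rightarrow> vec \<Rightarrow> vec" where
  "coord m n u = (THE c. c \<in> Evec m n \<and> Phi m n c = u)"

lemma coord_Phi: "c \<in> Evec m n \<Longrightarrow> coord m n (Phi m n c) = c"
  unfolding coord_def using Phi_inj by blast

lemma coord_props: "u \<in> Evec m n \<Longrightarrow> coord m n u \<in> Evec m n \<and> Phi m n (coord m n u) = u"
  using Phi_surj coord_Phi by metis

text \<open>The antilinear map that conjugates coordinates with respect to the \<open>W f\<close>,
  and therefore fixes each of them.\<close>

definition Bar :: "nat \<Rightarrow> nat \<Rightarrow> vec \<Rightarrow> vec" where
  "Bar m n u = (if u \<in> Evec m n then Phi m n (vbar (coord m n u)) else vzero)"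

lemma Bar_Phi: "c \<in> Evec m n \<Longrightarrow> Bar m n (Phi m n c) = Phi m n (vbar c)"
  by (simp add: Bar_def Phi_Evec coord_Phi)

lemma Bar_Evec: "Bar m n u \<in> Evec m n"
  by (simp add: Bar_def Evec_vzero Phi_Evec Evec_vbar coord_props)

lemma Bar_W: "f \<in> Zp m n \<Longrightarrow> Bar m n (W m n f) = W m n f"
  using Bar_Phi [OF Evec_Kb, of f m n] by (simp add: vbar_simps Phi_def lin_Kb)

lemma Bar_vadd:
  assumes "u \<in> Evec m n" "v \<in> Evec m n"
  shows "Bar m n (vadd u v) = vadd (Bar m n u) (Bar m n v)"
proof -
  obtain c d where cd: "c \<in> Evec m n" "u = Phi m n c" "d \<in> Evec m n" "v = Phi m n d"
    using Phi_surj assms by metis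
  have "vadd u v = Phi m n (vadd c d)" using cd by (simp add: Phi_def lin_vadd)
  then show ?thesis
    using cd by (simp add: Bar_Phi Evec_vadd vbar_simps) (simp add: Phi_def lin_vadd [OF Evec_vbar Evec_vbar, OF cd(1,3)])
qed

lemma Bar_vsmult:
  assumes "u \<in> Evec m n"
  shows "Bar m n (vsmult k u) = vsmult (qbar k) (Bar m n u)"
proof -
  obtain c where c: "c \<in> Evec m n" "u = Phi m n c" using Phi_surj assms by metis
  have "vsmult k u = Phi m n (vsmult k c)" using c by (simp add: Phi_def lin_vsmult)
  then show ?thesis
    using c by (simp add: Bar_Phi Evec_vsmult vbar_simps) (simp add: Phi_def lin_vsmult [OF Evec_vbar, OF c(1)])
qed

lemma Bar_Bar:
  assumes "u \<in> Evec m n"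
  shows "Bar m n (Bar m n u) = u"
proof -
  obtain c where c: "c \<in> Evec m n" "u = Phi m n c" using Phi_surj assms by metis
  then show ?thesis by (simp add: Bar_Phi Evec_vbar vbar_simps)
qed

lemma Bar_vzero: "Bar m n vzero = vzero"
  using Bar_Phi [OF Evec_vzero] by (simp add: Phi_def lin_vzero vbar_simps)

text \<open>Both sides are antilinear, so checking on the \<open>W f\<close> suffices. Two operators
  are allowed because the bar map exchanges \<open>K_{a,a+1}\<close> with its inverse; for
  \<open>E_a\<close> and \<open>F_a\<close> they coincide.\<close>

lemma Bar_intertwines:
  assumes T: "\<And>f. f \<in> Zp m n \<Longrightarrow> T f \<in> Evec m n" and W: "\<And>f. f \<in> Zp m n \<Longrightarrow>
      Bar m n (lin T (W m n f)) = lin T' (W m n f)"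
    and u: "u \<in> Evec m n"
  shows "Bar m n (lin T u) = lin T' (Bar m n u)"
  using u
proof (induction rule: Evec_W_induct)
  case zero
  then show ?case by (simp add: lin_vzero Bar_vzero)
next
  case (add u v)
  then show ?case
    using lin_Evec [OF _ T] by (simp add: lin_vadd Bar_vadd lin_vadd [OF Bar_Evec Bar_Evec])
next
  case (smult c u)
  then show ?case
    using lin_Evec [OF _ T] by (simp add: lin_vsmult Bar_vsmult lin_vsmult [OF Bar_Evec])
next
  case (W f)
  then show ?case using assms(2) by (simp add: Bar_W)
qed

lemma Bar_multiple_W:
  assumes "\<exists>g\<in>Zp m n. \<exists>c. qbar c = c \<and> v = vsmult c (W m n g)"
  shows "Bar m n v = v"
  using assms Bar_vsmult [OF W_Evec] Bar_W by auto

lemma Evec_support_two: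
  assumes "\<And>h. u h \<noteq> 0 \<Longrightarrow> (h = x \<or> h = y) \<and> h \<in> Zp m n"
  shows "u \<in> Evec m n"
proof -
  have "{h. u h \<noteq> 0} \<subseteq> {x, y}" using assms by blast
  then have "finite {h. u h \<noteq> 0}" by (rule finite_subset) simp
  then show ?thesis using assms by (simp add: Evec_def)
qed

lemma Fb_Evec:
  assumes f: "f \<in> Zp m n"
  shows "Fb m n a f \<in> Evec m n"
proof (rule Evec_support_two)
  fix h assume "Fb m n a f h \<noteq> 0"
  then show "(h = repl f (negI m) a (a + 1) \<or> h = repl f (posI n) a (a + 1)) \<and> h \<in> Zp m n"
    using Zp_repl_neg(1) [OF f, of "a + 1" a] Zp_repl_pos(1) [OF f, of "a + 1" a]
    by (auto simp: Fb_def Let_def split: if_splits)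
qed

lemma Eb_Evec:
  assumes f: "f \<in> Zp m n"
  shows "Eb m n a f \<in> Evec m n"
proof (rule Evec_support_two)
  fix h assume "Eb m n a f h \<noteq> 0"
  then show "(h = repl f (negI m) (a + 1) a \<or> h = repl f (posI n) (a + 1) a) \<and> h \<in> Zp m n"
    using Zp_repl_neg(1) [OF f, of a "a + 1"] Zp_repl_pos(1) [OF f, of a "a + 1"]
    by (auto simp: Eb_def Let_def split: if_splits)
qed

definition weight :: "nat \<Rightarrow> nat \<Rightarrow> int \<Rightarrow> (int \<Rightarrow> int) \<Rightarrow> int" where
  "weight m n a f = eexp (f ` negI m) a + eexp (f ` posI n) a"

text \<open>Flipping a pair exchanges \<open>opn\<close> and \<open>cls\<close>, both of which count
  a value once. So each \<open>W f\<close> is a weight vector.\<close>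

lemma weight_constant:
  assumes f: "f \<in> Zp m n" and g: "W m n f g \<noteq> 0"
  shows "weight m n a g = weight m n a f"
proof -
  have "Wt (st m n f) (cups m n f) (st m n g) \<noteq> 0" using g by (auto simp: W_def split: if_splits)
  note D = Wt_nonzeroD [OF cupd_cups [OF f] this]
  define k :: "bool \<times> bool \<Rightarrow> int" where
    "k p = (if fst p then 1 else 0) + (if snd p then 1 else 0)" for p
  have "weight m n a h = k (st m n h a) - k (st m n h (a + 1))" for h
    by (simp add: weight_def eexp_def st_def k_def)
  moreover have "k (st m n g x) = k (st m n f x)" for x
    using D [of x] by (elim disjE conjE) (simp_all add: k_def)
  ultimately show ?thesis by simp
qed

lemma lin_diagonal_W:
  assumes f: "f \<in> Zp m n" and T: "\<And>g. W m n f g \<noteq> 0 \<Longrightarrow> T g = vsmult k (Kb g)"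
  shows "lin T (W m n f) = vsmult k (W m n f)"
proof
  fix h
  have fin: "finite {g. W m n f g \<noteq> 0}" using W_Evec [OF f] by (simp add: Evec_def)
  have "lin T (W m n f) h = (\<Sum>g\<in>{g. W m n f g \<noteq> 0}. if g = h then k * W m n f h else 0)"
    unfolding lin_def using T by (intro sum.cong) (auto simp: vsmult_def Kb_def)
  also have "\<dots> = vsmult k (W m n f) h" using fin by (simp add: vsmult_def)
  finally show "lin T (W m n f) h = vsmult k (W m n f) h" .
qed

lemma actK_W:
  assumes f: "f \<in> Zp m n"
  shows "lin (Kgb m n a) (W m n f) = vsmult (qpow (weight m n a f)) (W m n f)"
    "lin (Kinvb m n a) (W m n f) = vsmult (qpow (- weight m n a f)) (W m n f)"
  using weight_constant [OF f, of _ a]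
  by (auto intro!: lin_diagonal_W [OF f] simp: Kgb_def Kinvb_def weight_def)

lemma Jtypical_W:
  assumes "Jtypical m n f"
  shows "W m n f = Kb f"
proof -
  have f: "f \<in> Zp m n" using assms by (simp add: Jtypical_def)
  then have e: "cups m n f = {}" using Jtypical_iff [OF f cupd_cups [OF f]] assms by simp
  show ?thesis
  proof
    fix g
    show "W m n f g = Kb f g"
    proof (cases "g \<in> Zp m n \<and> st m n g = st m n f")
      case True
      then have "g = f" using st_inj f by blast
      then show ?thesis using W_self [OF f] by (simp add: Kb_def)
    next
      case False
      then have "W m n f g = 0" by (auto simp: W_def e Wt_def fun_eq_iff)
      then show ?thesis using False f by (auto simp: Kb_def)
    qed
  qed
qed

text \<open>The bar matrix is the product of the expansion of \<open>K_f\<close> in the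
  \<open>W g\<close>, conjugated, with the expansion of the \<open>W g\<close> in monomials. Both
  factors are unitriangular with Laurent entries; a further diagonal contribution would need
  \<open>f < g < f\<close>.\<close>

lemma Bar_Kb:
  assumes f: "f \<in> Zp m n"
  shows "Bar m n (Kb f) f = 1"
    and "g \<noteq> f \<Longrightarrow> Bar m n (Kb f) g \<noteq> 0 \<Longrightarrow> bruhat_less m n g f \<and> laurent_int (Bar m n (Kb f) g)"
proof -
  obtain c where c: "c \<in> Evec m n" "Phi m n c = Kb f" "c f = 1"
    and cnz: "\<And>g. c g \<noteq> 0 \<Longrightarrow> (g = f \<or> bruhat_less m n g f) \<and> laurent_int (c g)"
    using Kb_coordinates [OF f] by blast
  let ?S = "{g. c g \<noteq> 0}"
  have fin: "finite ?S" and Zp: "\<And>g. c g \<noteq> 0 \<Longrightarrow> g \<in> Zp m n" using c(1) by (auto simp: Evec_def)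
  have B: "Bar m n (Kb f) h = (\<Sum>g\<in>?S. qbar (c g) * W m n g h)" for h
    using Bar_Phi [OF c(1)] c(2) by (simp add: Phi_def lin_def vbar_def)
  have "qbar (c g) * W m n g f = (if g = f then 1 else 0)" if "g \<in> ?S" for g
  proof (cases "g = f")
    case True
    then show ?thesis using c(3) W_self [OF f] by simp
  next
    case False
    have "W m n g f = 0"
    proof (rule ccontr)
      assume "W m n g f \<noteq> 0"
      then have "bruhat_less m n f g" using W_nonzeroD(2) [OF Zp] that False by blast
      moreover have "bruhat_less m n g f" using cnz that False by blast
      ultimately show False using bruhat_less_trans bruhat_less_irrefl by blast
    qed
    then show ?thesis using False by simp
  qed
  then have "Bar m n (Kb f) f = (\<Sum>g\<in>?S. if g = f then 1 else 0)"
    unfolding B by (rule sum.cong [OF refl])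
  then show "Bar m n (Kb f) f = 1" using fin c(3) by simp
  assume g: "g \<noteq> f" "Bar m n (Kb f) g \<noteq> 0"
  obtain h where h: "h \<in> ?S" "W m n h g \<noteq> 0"
  proof (rule ccontr)
    assume "\<not> thesis"
    then have "\<forall>h\<in>?S. W m n h g = 0" using that by blast
    then have "Bar m n (Kb f) g = 0" unfolding B by simp
    with g(2) show False ..
  qed
  have "h = f \<or> bruhat_less m n h f" using cnz h(1) by blast
  moreover have "g = h \<or> bruhat_less m n g h" using W_nonzeroD(2) [OF Zp h(2)] h(1) by blast
  ultimately have "bruhat_less m n g f" using g(1) bruhat_less_trans by blast
  moreover have "laurent_int (Bar m n (Kb f) g)"
    unfolding B
  proof (rule laurent_int_sum)
    fix h assume h: "h \<in> ?S"
    have "laurent_int (W m n h g)"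
    proof (cases "W m n h g = 0 \<or> g = h")
      case True
      then show ?thesis
        using W_self [OF Zp] h laurent_int_0 laurent_int_qq_power [of 0] by auto
    next
      case False
      then obtain k where "W m n h g = qq ^ k" using W_off_diagonal [OF Zp] h by blast
      then show ?thesis by (simp add: laurent_int_qq_power)
    qed
    then show "laurent_int (qbar (c h) * W m n h g)"
      using cnz h laurent_int_mult laurent_int_qbar by blast
  qed
  ultimately show "bruhat_less m n g f \<and> laurent_int (Bar m n (Kb f) g)" by blast
qed

lemma is_bar_Bar: "is_bar m n (Bar m n)"
  unfolding is_bar_def
proof (intro conjI allI ballI impI)
  show "Bar m n u = (\<lambda>_. 0)" if "u \<notin> Evec m n" for u
    using that by (simp add: Bar_def vzero_def)
  show "Bar m n (Kb f) = Kb f" if "Jtypical m n f" for f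
    using Bar_W [of f m n] that by (simp add: Jtypical_W) (simp add: Jtypical_def)
  show "Bar m n (actE m n a u) = actE m n a (Bar m n u)" if "u \<in> Evec m n" for a u
    unfolding actE_def
    by (rule Bar_intertwines [OF _ _ that])
       (erule Eb_Evec, rule Bar_multiple_W, erule actE_W_multiple [unfolded actE_def])
  show "Bar m n (actF m n a u) = actF m n a (Bar m n u)" if "u \<in> Evec m n" for a u
    unfolding actF_def
    by (rule Bar_intertwines [OF _ _ that])
       (erule Fb_Evec, rule Bar_multiple_W, erule actF_W_multiple [unfolded actF_def])
  show "Bar m n (actK m n a u) = actKinv m n a (Bar m n u)" if "u \<in> Evec m n" for a u
    unfolding actK_def actKinv_def
    by (rule Bar_intertwines [OF _ _ that])
       (auto simp: Kgb_def actK_W Bar_vsmult W_Evec Bar_W qbar_qpow intro: Evec_vsmult Evec_Kb)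
  show "Bar m n (actKinv m n a u) = actK m n a (Bar m n u)" if "u \<in> Evec m n" for a u
    unfolding actK_def actKinv_def
    by (rule Bar_intertwines [OF _ _ that])
       (auto simp: Kinvb_def actK_W Bar_vsmult W_Evec Bar_W qbar_qpow intro: Evec_vsmult Evec_Kb)
qed (use Bar_Kb in \<open>simp_all add: Bar_Evec Bar_vadd Bar_vsmult Bar_Bar\<close>)

text \<open>Descent on \<open>spread\<close>: a generator fixed by the bar map produces
  \<open>W f\<close> from a vector already known to be fixed, until no pairs are left and the vector
  is a J-typical monomial.\<close>

lemma is_bar_W:
  assumes B: "is_bar m n B" and f: "f \<in> Zp m n"
  shows "B (W m n f) = W m n f"
  using f
proof (induction "spread (cups m n f)" arbitrary: f rule: less_induct)
  case less
  note f = less.prems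
  show ?case
  proof (cases "cups m n f = {}")
    case True
    then have J: "Jtypical m n f" using Jtypical_iff [OF f cupd_cups [OF f]] by simp
    then have "B (Kb f) = Kb f" using B unfolding is_bar_def by blast
    then show ?thesis by (simp add: Jtypical_W [OF J])
  next
    case False
    then obtain g a where g: "g \<in> Zp m n" "spread (cups m n g) < spread (cups m n f)"
      "W m n f = actF m n a (W m n g) \<or> W m n f = actE m n a (W m n g)"
      using W_generated [OF f] by blast
    have "B (W m n g) = W m n g" using less.hyps g by blast
    moreover have "B (actF m n a (W m n g)) = actF m n a (B (W m n g))"
      "B (actE m n a (W m n g)) = actE m n a (B (W m n g))"
      using B W_Evec [OF g(1)] unfolding is_bar_def by blast+
    ultimately show ?thesis using g(3) by auto
  qed
qed

lemma bar_inv_eq: "bar_inv m n = Bar m n"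
  unfolding bar_inv_def
proof (rule the_equality)
  show "is_bar m n (Bar m n)" by (rule is_bar_Bar)
next
  fix B assume B: "is_bar m n B"
  have out: "B u = (\<lambda>_. 0)" if "u \<notin> Evec m n" for u
    using B that unfolding is_bar_def by blast
  have add: "B (vadd u v) = vadd (B u) (B v)" if "u \<in> Evec m n" "v \<in> Evec m n" for u v
    using B that unfolding is_bar_def by blast
  have smult: "B (vsmult c u) = vsmult (qbar c) (B u)" if "u \<in> Evec m n" for c u
    using B that unfolding is_bar_def by blast
  have "B u = Bar m n u" if "u \<in> Evec m n" for u
    using that
  proof (induction rule: Evec_W_induct)
    case zero
    have z: "vsmult 0 v = vzero" for v by (simp add: vsmult_def vzero_def)
    show ?case using smult [OF Evec_vzero, of 0] by (simp add: z Bar_vzero)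
  next
    case (add u v)
    then show ?case by (simp add: \<open>\<And>u v. u \<in> Evec m n \<Longrightarrow> v \<in> Evec m n \<Longrightarrow> B (vadd u v) = vadd (B u) (B v)\<close> Bar_vadd)
  next
    case (smult c u)
    then show ?case by (simp add: \<open>\<And>c u. u \<in> Evec m n \<Longrightarrow> B (vsmult c u) = vsmult (qbar c) (B u)\<close> Bar_vsmult)
  next
    case (W f)
    then show ?case by (simp add: is_bar_W [OF B] Bar_W)
  qed
  \<comment> \<open>Outside the Fock space both maps take the value zero, so agreement on
    \<open>Evec m n\<close> is equality of functions.\<close>
  then show "B = Bar m n" using out by (auto simp: fun_eq_iff Bar_def vzero_def)
qed

section \<open>The canonical basis\<close>

text \<open>The coordinates of \<open>u\<close> with respect to the \<open>W g\<close> are bar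
  invariant, and one of maximal height is also a monomial coefficient of \<open>u\<close>, hence
  lies in qZ[q]. By \<open>qbar_fixed_qZq\<close> it is zero, so there is no leading
  coordinate.\<close>

lemma bar_fixed_eq_vzero:
  assumes u: "u \<in> Evec m n" and bar: "Bar m n u = u" and q: "\<And>g. qZq (u g)"
  shows "u = vzero"
proof -
  obtain c where c: "c \<in> Evec m n" and uc: "u = Phi m n c" using Phi_surj [OF u] by blast
  have "Phi m n (vbar c) = Phi m n c" using bar Bar_Phi [OF c] uc by simp
  then have cc: "vbar c = c" using Phi_inj Evec_vbar c by blast
  have "c = vzero"
  proof (rule ccontr)
    assume "c \<noteq> vzero"
    then obtain g where g: "c g \<noteq> 0" "\<And>h. c h \<noteq> 0 \<Longrightarrow> height m n h \<le> height m n g"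
      using top_exists c by metis
    have "qbar (c g) = c g" using cc by (metis vbar_def)
    moreover have "qZq (c g)" using q [of g] Phi_top_coeff [OF c g] uc by simp
    ultimately show False using qbar_fixed_qZq g(1) by blast
  qed
  then show ?thesis using uc by (simp add: Phi_def lin_vzero)
qed

lemma Ucan_eq_W:
  assumes f: "f \<in> Zp m n"
  shows "Ucan m n f = W m n f"
proof -
  have qW: "qZq (W m n f g)" if gf: "g \<noteq> f" for g
  proof (cases "W m n f g = 0")
    case False
    then obtain k where "0 < k" "W m n f g = qq ^ k" using W_off_diagonal [OF f False gf] by blast
    then show ?thesis by (simp add: qZq_qq_power)
  qed simp
  show ?thesis
    unfolding Ucan_def bar_inv_eq
  proof (rule the_equality)
    show "W m n f \<in> Evec m n \<and> Bar m n (W m n f) = W m n f \<and> W m n f f = 1 \<and>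
      (\<forall>g. g \<noteq> f \<longrightarrow> W m n f g \<noteq> 0 \<longrightarrow> bruhat_less m n g f \<and> qZq (W m n f g))"
      using W_Evec [OF f] Bar_W [OF f] W_self [OF f] W_nonzeroD(2) [OF f] qW by blast
  next
    fix u assume u: "u \<in> Evec m n \<and> Bar m n u = u \<and> u f = 1 \<and>
      (\<forall>g. g \<noteq> f \<longrightarrow> u g \<noteq> 0 \<longrightarrow> bruhat_less m n g f \<and> qZq (u g))"
    \<comment> \<open>The difference of two candidates is bar invariant, and its coefficient at
      \<open>f\<close> cancels as 1 - 1; so all its coefficients lie in qZ[q].\<close>
    let ?d = "vadd u (vsmult (- 1) (W m n f))"
    have q1: "qbar (- 1) = - 1"
      using qbar_emb [of "- 1"] by (simp add: emb_def One_fract_def one_pCons)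
    have "?d \<in> Evec m n" using u W_Evec [OF f] by (intro Evec_vadd Evec_vsmult) auto
    moreover have "Bar m n ?d = ?d"
      using u W_Evec [OF f] by (simp add: Bar_vadd Bar_vsmult Evec_vsmult Bar_W [OF f] q1)
    moreover have "qZq (?d g)" for g
    proof (cases "g = f")
      case True
      then show ?thesis using u W_self [OF f] by (simp add: vadd_def vsmult_def)
    next
      case False
      then have "qZq (u g)" using u by (cases "u g = 0") auto
      then show ?thesis using qZq_diff qW [OF False] by (simp add: vadd_def vsmult_def)
    qed
    ultimately have "?d = vzero" by (rule bar_fixed_eq_vzero)
    then show "u = W m n f" by (auto simp: fun_eq_iff vadd_def vsmult_def vzero_def)
  qed
qed

theorem theorem4p16:
  fixes m n :: nat and f :: "int \<Rightarrow> int"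
  assumes "f \<in> Zp m n"
  shows "Ucan m n f = (\<lambda>g. \<Sum>\<Sigma>\<in>Pow (SigPlus m n f). if fSig m n f \<Sigma> = g then qq ^ card \<Sigma> else 0)"
  unfolding Ucan_eq_W [OF assms] using W_eq_sum(1) [OF assms] by blast

end
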